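(* Let $G^\circ,H^\circ,K^\circ$ be unimodular second-countable locally compact groups with fixed Haar measures, and let $R^\circ\in\operatorname{Polh}(G^\circ,H^\circ)$, $T^\circ\in\operatorname{Polh}(H^\circ,K^\circ)$. Then the product $T^\circ R^\circ\in \operatorname{Polh}(G^\circ,K^\circ)$ in the sense of polyhomomorphisms, regarded as a measure on $G\times K$, coincides with the product of $R^\circ$ and $T^\circ$ regarded as polymorphisms of measure spaces (measures on $G\times H$ and $H\times K$ respectively).
   Context: All locally compact groups are second countable. $G^\circ=(G,\gamma)$, $H^\circ=(H,\eta)$, etc. denote unimodular groups with fixed Haar measures. The set $\operatorname{Polh}(G^\circ,H^\circ)$ of polyhomomorphisms consists of: the zero measure $0_{G,H}$ on $G\times H$; and all pairs $R^\circ=(R,\rho)$ where $R\subset G\times H$ is a closed subgroup and $\rho$ is a Haar measure on $R$ whose image under the projection to $G$ is dominated by $\gamma$ (i.e. the $\rho$-measure of $R\cap(A\times H)$ is $\le\gamma(A)$ for all Borel $A$) and whose image under the projection to $H$ is dominated by $\eta$. For a subgroup $R\subset G\times H$: $\operatorname{dom}R$, $\operatorname{im}R$ are its projections to $G$ and $H$; $\ker R=\{g:(g,1)\in R\}$; $\operatorname{indef}R=\{h:(1,h)\in R\}$. For nonzero $R^\circ$ the image of $\rho$ in $G$ equals $\alpha(R^\circ)\gamma|_{\operatorname{dom}R}$ and the image in $H$ equals $\beta(R^\circ)\eta|_{\operatorname{im}R}$, with constants $0<\alpha(R^\circ),\beta(R^\circ)\le1$. Product of polyhomomorphisms: for nonzero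 $R^\circ\in\operatorname{Polh}(G^\circ,H^\circ)$, $T^\circ\in\operatorname{Polh}(H^\circ,K^\circ)$ the product $S^\circ=T^\circ R^\circ$ has underlying subgroup $S=TR=\{(g,k): \exists h\in H,\ (g,h)\in R,\ (h,k)\in T\}\subset G\times K$, with Haar measure normalized by $$\alpha(S^\circ)=\frac{\alpha(R^\circ)\alpha(T^\circ)}{[\operatorname{indef}R:(\operatorname{indef}R\cap\operatorname{dom}T)]},\qquad \beta(S^\circ)=\frac{\beta(R^\circ)\beta(T^\circ)}{[\ker T:(\ker T\cap\operatorname{im}R)]}.$$ A product with a zero factor is zero. Polymorphisms: for Lebesgue measure spaces $(X,\xi)$, $(Y,\upsilon)$ with finite or $\sigma$-finite measures, a polymorphism $\mu$ from $X$ to $Y$ is a measure on $X\times Y$ whose projection to $X$ is dominated by $\xi$ and whose projection to $Y$ is dominated by $\upsilon$. It has conditional measures $\mu_x$ on $Y$ (defined for $\xi$-almost all $x\in X$) with $\mu(A\times B)=\int_A\mu_x(B)\,d\xi(x)$ for all $A\subset X$, $B\subset Y$ of finite measure. The product $\kappa=\nu\mu$ of polymorphisms $\mu$ (from $X$ to $Y$) and $\nu$ (from $Y$ to $Z$) is the polymorphism from $X$ to $Z$ with conditional measures $\kappa_x=\int_Y\nu_y\,d\mu_x(y)$. *)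

theory Defs
  imports "HOL-Probability.Probability"
begin

text \<open>
  Groups are types of class \<open>topological_group_add\<close>. This class is written additively but is
  not commutative: \<open>x + y\<close> is the product, \<open>0\<close> the unit, \<open>- x\<close> the inverse. On a product
  type the group structure, topology and Borel sets are the product ones. For
  \<open>R \<subseteq> G \<times> H\<close>, the sets dom R and im R are \<^term>\<open>Domain R\<close> and \<^term>\<open>Range R\<close>.
\<close>

definition is_subgroup :: "'a::group_add set \<Rightarrow> bool" where
  "is_subgroup R \<longleftrightarrow> 0 \<in> R \<and> (\<forall>x\<in>R. \<forall>y\<in>R. x + y \<in> R) \<and> (\<forall>x\<in>R. - x \<in> R)"

text \<open>
  Left Haar measure on a closed subgroup \<open>R\<close>, as a measure whose space is \<open>R\<close>. Regularity
  is not listed: in a second countable locally compact Hausdorff group every Borel measure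
  that is finite on compact sets is regular.
\<close>

definition haar_measure_on ::
    "'a::{group_add, topological_space} set \<Rightarrow> 'a measure \<Rightarrow> bool" where
  "haar_measure_on R \<rho> \<longleftrightarrow>
     sets \<rho> = sets (restrict_space borel R) \<and>
     (\<forall>x\<in>R. \<forall>A\<in>sets \<rho>. emeasure \<rho> ((\<lambda>y. x + y) ` A) = emeasure \<rho> A) \<and>
     (\<forall>C. compact C \<and> C \<subseteq> R \<longrightarrow> emeasure \<rho> C < \<infinity>) \<and>
     emeasure \<rho> R \<noteq> 0"

definition unimodular_haar_measure :: "'a::topological_group_add measure \<Rightarrow> bool" where
  "unimodular_haar_measure \<gamma> \<longleftrightarrow>
     haar_measure_on UNIV \<gamma> \<and>
     (\<forall>x. \<forall>A\<in>sets \<gamma>. emeasure \<gamma> ((\<lambda>y. y + x) ` A) = emeasure \<gamma> A)"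

text \<open>
  A subgroup carrying a polyhomomorphism between unimodular groups is itself unimodular, so
  it does not matter that left Haar measures are used below.
\<close>

datatype ('g, 'h) polyhom =
    Zero_Polyhom
  | Polyhom "('g \<times> 'h) set" "('g \<times> 'h) measure"

definition Polh ::
    "'g::topological_group_add measure \<Rightarrow> 'h::topological_group_add measure
      \<Rightarrow> ('g, 'h) polyhom set" where
  "Polh \<gamma> \<eta> =
     {Zero_Polyhom} \<union>
     {Polyhom R \<rho> | R \<rho>.
        closed R \<and> is_subgroup R \<and> haar_measure_on R \<rho> \<and>
        (\<forall>A\<in>sets borel. emeasure \<rho> (R \<inter> (A \<times> UNIV)) \<le> emeasure \<gamma> A) \<and>
        (\<forall>B\<in>sets borel. emeasure \<rho> (R \<inter> (UNIV \<times> B)) \<le> emeasure \<eta> B)}"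

text \<open>The measure on the whole product space obtained by extending \<open>\<rho>\<close> by zero off \<open>R\<close>.\<close>

fun polyhom_measure ::
    "('g::topological_space, 'h::topological_space) polyhom \<Rightarrow> ('g \<times> 'h) measure" where
  "polyhom_measure Zero_Polyhom = null_measure borel"
| "polyhom_measure (Polyhom R \<rho>) = distr \<rho> borel (\<lambda>x. x)"

definition polyhom_ker :: "('g \<times> 'h::zero) set \<Rightarrow> 'g set" where
  "polyhom_ker R = {g. (g, 0) \<in> R}"

definition polyhom_indef :: "('g::zero \<times> 'h) set \<Rightarrow> 'h set" where
  "polyhom_indef R = {h. (0, h) \<in> R}"

definition polyhom_alpha ::
    "'g::topological_space measure \<Rightarrow> ('g \<times> 'h) set \<Rightarrow> ('g \<times> 'h) measure \<Rightarrow> real" where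
  "polyhom_alpha \<gamma> R \<rho> =
     (THE a. 0 < a \<and>
        (\<forall>A\<in>sets borel. emeasure \<rho> (R \<inter> (A \<times> UNIV)) = ennreal a * emeasure \<gamma> (A \<inter> Domain R)))"

definition polyhom_beta ::
    "'h::topological_space measure \<Rightarrow> ('g \<times> 'h) set \<Rightarrow> ('g \<times> 'h) measure \<Rightarrow> real" where
  "polyhom_beta \<eta> R \<rho> =
     (THE b. 0 < b \<and>
        (\<forall>B\<in>sets borel. emeasure \<rho> (R \<inter> (UNIV \<times> B)) = ennreal b * emeasure \<eta> (B \<inter> Range R)))"

text \<open>
  The number of cosets. The indices in the product below are finite, since \<open>polyhom_indef R\<close>
  and \<open>polyhom_ker T\<close> are compact while \<open>Domain T\<close> and \<open>Range R\<close> are open; so the value 0 of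
  \<^const>\<open>card\<close> on infinite sets plays no role.
\<close>

definition subgroup_index :: "'a::group_add set \<Rightarrow> 'a set \<Rightarrow> nat" where
  "subgroup_index A B = card ((\<lambda>a. (\<lambda>b. a + b) ` B) ` A)"

text \<open>
  The product is written in the order \<open>T R\<close> (first \<open>R\<close>, then \<open>T\<close>); its subgroup is
  \<^term>\<open>R O T\<close> in the notation of relational composition.
\<close>

fun polyhom_prod ::
    "'g::topological_group_add measure \<Rightarrow> 'h::topological_group_add measure \<Rightarrow>
     'k::topological_group_add measure \<Rightarrow>
     ('h, 'k) polyhom \<Rightarrow> ('g, 'h) polyhom \<Rightarrow> ('g, 'k) polyhom" where
  "polyhom_prod \<gamma> \<eta> \<zeta> (Polyhom T \<tau>) (Polyhom R \<rho>) =
     Polyhom (R O T)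
       (THE \<sigma>. haar_measure_on (R O T) \<sigma> \<and>
          polyhom_alpha \<gamma> (R O T) \<sigma> =
            polyhom_alpha \<gamma> R \<rho> * polyhom_alpha \<eta> T \<tau>
              / real (subgroup_index (polyhom_indef R) (polyhom_indef R \<inter> Domain T)) \<and>
          polyhom_beta \<zeta> (R O T) \<sigma> =
            polyhom_beta \<eta> R \<rho> * polyhom_beta \<zeta> T \<tau>
              / real (subgroup_index (polyhom_ker T) (polyhom_ker T \<inter> Range R)))"
| "polyhom_prod \<gamma> \<eta> \<zeta> Zero_Polyhom _ = Zero_Polyhom"
| "polyhom_prod \<gamma> \<eta> \<zeta> _ Zero_Polyhom = Zero_Polyhom"

definition polymorphism :: "'x measure \<Rightarrow> 'y measure \<Rightarrow> ('x \<times> 'y) measure \<Rightarrow> bool" where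
  "polymorphism X Y \<mu> \<longleftrightarrow>
     sets \<mu> = sets (X \<Otimes>\<^sub>M Y) \<and>
     (\<forall>A\<in>sets X. emeasure \<mu> (A \<times> space Y) \<le> emeasure X A) \<and>
     (\<forall>B\<in>sets Y. emeasure \<mu> (space X \<times> B) \<le> emeasure Y B)"

text \<open>
  Conditional measures are determined only up to a null set of \<open>X\<close>. They have total mass at
  most 1 almost everywhere, because the projection of \<open>\<mu>\<close> to \<open>X\<close> is dominated by \<open>X\<close>;
  here a version is chosen for which this holds everywhere.
\<close>

definition conditional_measures ::
    "'x measure \<Rightarrow> 'y measure \<Rightarrow> ('x \<times> 'y) measure \<Rightarrow> ('x \<Rightarrow> 'y measure) \<Rightarrow> bool" where
  "conditional_measures X Y \<mu> m \<longleftrightarrow>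
     m \<in> measurable X (subprob_algebra Y) \<and>
     (\<forall>A\<in>sets X. \<forall>B\<in>sets Y. emeasure X A < \<infinity> \<longrightarrow> emeasure Y B < \<infinity> \<longrightarrow>
        emeasure \<mu> (A \<times> B) = (\<integral>\<^sup>+ x\<in>A. emeasure (m x) B \<partial>X))"

text \<open>
  The product \<open>\<nu> \<mu>\<close> (first \<open>\<mu>\<close>, then \<open>\<nu>\<close>). The measure \<open>m x \<bind> n\<close> is the integral of the
  measures \<open>n y\<close> against \<open>m x\<close>. The result does not depend on the versions \<open>m\<close>, \<open>n\<close>.
\<close>

definition polymorphism_prod ::
    "'x measure \<Rightarrow> 'y measure \<Rightarrow> 'z measure \<Rightarrow>
     ('y \<times> 'z) measure \<Rightarrow> ('x \<times> 'y) measure \<Rightarrow> ('x \<times> 'z) measure" where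
  "polymorphism_prod X Y Z \<nu> \<mu> =
     (THE \<kappa>. polymorphism X Z \<kappa> \<and>
        (\<exists>m n. conditional_measures X Y \<mu> m \<and> conditional_measures Y Z \<nu> n \<and>
               conditional_measures X Z \<kappa> (\<lambda>x. m x \<bind> n)))"

end

theory Submission
  imports Defs
begin

text \<open>
  Write \<open>\<mu>\<close> and \<open>\<nu>\<close> for the measures of \<open>R\<close> and \<open>T\<close> and \<open>n\<close> for conditional measures of
  \<open>\<nu>\<close>. The product of polymorphisms is
  \<open>\<kappa> E = \<integral> n y {z. (x, z) \<in> E} d\<mu>(x, y)\<close>. Since \<open>n\<close> is almost everywhere equivariant under \<open>T\<close>
  and \<open>\<mu>\<close> is invariant under \<open>R\<close>, the measure \<open>\<kappa>\<close> is invariant under \<open>S = R O T\<close>, on which it is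
  concentrated; being locally finite, it forces the \<open>\<sigma>\<close>-compact subgroup \<open>S\<close> to be closed and is a
  Haar measure on it. Its marginal on \<open>G\<close> is \<open>\<alpha> T\<close> times the marginal of \<open>\<mu>\<close> restricted to
  \<open>G \<times> Domain T\<close>, and the cosets of \<open>indef R \<inter> Domain T\<close> in \<open>indef R\<close> tile the part of \<open>R\<close> over
  \<open>Domain S\<close> by translates of the part over \<open>Domain T\<close>: hence the index in \<open>\<alpha> S\<close>. The constant
  \<open>\<beta> S\<close> arises in the same way.

  Conditional measures of \<open>\<mu>\<close> exist because a Borel section of \<open>R \<rightarrow> Domain R\<close> turns \<open>\<mu>\<close> into a
  product measure.
\<close>

section \<open>Left invariant measures\<close>

text \<open>The definite description in \<open>polyhom_prod\<close> asks for one Haar measure on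
  \<open>R O T\<close> with two prescribed constants. But \<open>R O T\<close> is only the
  projection of a closed set, so neither its closedness nor the compatibility of the two constants
  is known beforehand; both are read off from \<open>\<kappa>\<close>. Therefore invariance and
  uniqueness are developed for sigma-finite measures carried by a Borel subgroup of an ambient
  group: one uniqueness lemma then serves the projections of \<open>R\<close>, its fibre subgroup
  and \<open>R O T\<close>. That lemma divides by the masses of right translates of a test set; on
  the projections and on \<open>R O T\<close>, right invariance of the given Haar measures keeps
  these masses constant, and this is where unimodularity enters.

  That \<open>\<kappa>\<close> does not vanish is a fact about \<open>\<eta>\<close>:
  \<open>Range R\<close> and \<open>Domain T\<close> are subgroups of positive measure, and two such
  subgroups meet in positive measure. The same positivity makes the indices finite, since infinitely
  many disjoint translates of equal positive mass do not fit into a set of finite mass.\<close>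

instance prod :: (topological_monoid_add, topological_monoid_add) topological_monoid_add
proof
  fix a b :: "'a \<times> 'b"
  have "((\<lambda>x. (fst (fst x) + fst (snd x), snd (fst x) + snd (snd x))) \<longlongrightarrow>
      (fst a + fst b, snd a + snd b)) (nhds a \<times>\<^sub>F nhds b)"
    by (intro tendsto_intros filterlim_fst filterlim_snd)
  then show "LIM x (nhds a \<times>\<^sub>F nhds b). fst x + snd x :> nhds (a + b)"
    by (simp add: plus_prod_def)
qed

instance prod :: (topological_group_add, topological_group_add) topological_group_add
proof
  fix a :: "'a \<times> 'b"
  have "((\<lambda>x. (- fst x, - snd x)) \<longlongrightarrow> (- fst a, - snd a)) (nhds a)"
    by (intro tendsto_intros filterlim_ident)
  then show "(uminus \<longlongrightarrow> - a) (nhds a)"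
    by (simp add: uminus_prod_def[abs_def])
qed

section \<open>Inversion, subgroups and translation invariance\<close>

lemma measurable_uminus_group [measurable (raw)]:
  fixes f :: "'a \<Rightarrow> 'b::{topological_group_add, second_countable_topology}"
  assumes "f \<in> borel_measurable M"
  shows "(\<lambda>x. - f x) \<in> borel_measurable M"
  by (rule borel_measurable_continuous_on[OF _ assms]) (intro continuous_intros)

lemma is_subgroupD:
  assumes "is_subgroup D"
  shows "0 \<in> D" "x \<in> D \<Longrightarrow> y \<in> D \<Longrightarrow> x + y \<in> D" "x \<in> D \<Longrightarrow> - x \<in> D"
  using assms by (auto simp: is_subgroup_def)

lemma is_subgroup_minus: "is_subgroup D \<Longrightarrow> x \<in> D \<Longrightarrow> y \<in> D \<Longrightarrow> x - y \<in> D"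
  by (metis is_subgroupD(2,3) diff_conv_add_uminus)

lemma is_subgroup_add_iff:
  assumes "is_subgroup D" "x \<in> D"
  shows "x + y \<in> D \<longleftrightarrow> y \<in> D"
proof
  assume "x + y \<in> D"
  then have "- x + (x + y) \<in> D"
    by (rule is_subgroupD(2)[OF assms(1) is_subgroupD(3)[OF assms]])
  then show "y \<in> D" by simp
qed (intro is_subgroupD(2) assms)

text \<open>The measure lives on the Borel sets of the ambient group and only the translations are
  restricted to \<open>D\<close>. Measures carried by different subgroups thus share one
  sigma-algebra, and equality of measures lets integrals be rewritten directly.\<close>

definition left_invariant :: "'a::{topological_space, plus} set \<Rightarrow> 'a measure \<Rightarrow> bool" where
  "left_invariant D \<mu> \<longleftrightarrow> (\<forall>x\<in>D. distr \<mu> borel ((+) x) = \<mu>)"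

lemma left_invariant_nn_integral:
  fixes \<mu> :: "'a::{topological_monoid_add, second_countable_topology} measure"
  assumes "left_invariant D \<mu>" "sets \<mu> = sets borel" "x \<in> D" "f \<in> borel_measurable borel"
  shows "(\<integral>\<^sup>+y. f (x + y) \<partial>\<mu>) = (\<integral>\<^sup>+y. f y \<partial>\<mu>)"
proof -
  have [measurable_cong]: "sets \<mu> = sets borel" by fact
  have [measurable]: "f \<in> borel_measurable borel" by fact
  have "(\<integral>\<^sup>+y. f y \<partial>\<mu>) = (\<integral>\<^sup>+y. f y \<partial>distr \<mu> borel ((+) x))"
    using assms by (simp add: left_invariant_def)
  also have "\<dots> = (\<integral>\<^sup>+y. f (x + y) \<partial>\<mu>)"
    by (subst nn_integral_distr) auto
  finally show ?thesis ..
qed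

lemma left_invariant_emeasure_image:
  fixes \<mu> :: "'a::{topological_group_add, second_countable_topology} measure"
  assumes "left_invariant D \<mu>" "sets \<mu> = sets borel" "x \<in> D" "- x \<in> D" "A \<in> sets borel"
  shows "emeasure \<mu> ((+) x ` A) = emeasure \<mu> A"
proof -
  have [measurable_cong]: "sets \<mu> = sets borel" by fact
  have [measurable]: "A \<in> sets borel" by fact
  have "(+) x ` A = (+) (- x) -` A"
    by (auto intro: rev_image_eqI simp: add.assoc[symmetric])
  then have "emeasure \<mu> ((+) x ` A) = emeasure (distr \<mu> borel ((+) (- x))) A"
    using sets_eq_imp_space_eq[OF assms(2)] by (subst emeasure_distr) auto
  then show ?thesis
    using assms by (simp add: left_invariant_def)
qed

lemma nn_integral_indicator_shift:
  fixes \<nu> :: "'a::{topological_group_add, second_countable_topology} measure"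
  assumes "sets \<nu> = sets borel" "A \<in> sets borel"
  shows "(\<integral>\<^sup>+y. indicator A (y + x) \<partial>\<nu>) = emeasure \<nu> {y. y + x \<in> A}"
proof -
  have [measurable]: "A \<in> sets borel" by fact
  have "(\<lambda>y. indicator A (y + x)) = (indicator {y. y + x \<in> A} :: 'a \<Rightarrow> ennreal)"
    by (auto simp: fun_eq_iff split: split_indicator)
  moreover have "{y. y + x \<in> A} \<in> sets borel" by measurable
  ultimately show ?thesis using assms(1) by simp
qed

text \<open>Two left translations inside an exchange of integrals. For fixed \<open>y\<close>,
  replacing \<open>x\<close> by \<open>- y + x\<close> frees the indicator from \<open>y\<close> and
  turns \<open>g (- x)\<close> into \<open>g (- x + y)\<close>; for fixed \<open>x\<close>, left
  invariance of \<open>\<nu>\<close> then removes \<open>- x\<close>. The inversion in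
  \<open>g (- x)\<close> is what makes the second step a left translation too.\<close>

lemma nn_integral_invariant_swap:
  fixes \<mu> \<nu> :: "'a::{topological_group_add, second_countable_topology} measure"
  assumes sets: "sets \<mu> = sets borel" "sets \<nu> = sets borel"
    and sf: "sigma_finite_measure \<mu>" "sigma_finite_measure \<nu>"
    and D: "is_subgroup D" "AE x in \<mu>. x \<in> D" "AE x in \<nu>. x \<in> D"
    and inv: "left_invariant D \<mu>" "left_invariant D \<nu>"
    and A[measurable]: "A \<in> sets borel" and g[measurable]: "g \<in> borel_measurable borel"
  shows "emeasure \<mu> A * (\<integral>\<^sup>+y. g y \<partial>\<nu>) = (\<integral>\<^sup>+x. g (- x) * emeasure \<nu> {y. y + x \<in> A} \<partial>\<mu>)"
proof -
  have [measurable_cong]: "sets \<mu> = sets borel" "sets \<nu> = sets borel" by fact+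
  have sp: "space \<mu> = UNIV" "space \<nu> = UNIV"
    using sets_eq_imp_space_eq[OF sets(1)] sets_eq_imp_space_eq[OF sets(2)] by auto
  interpret M: sigma_finite_measure \<mu> by fact
  interpret N: sigma_finite_measure \<nu> by fact
  interpret pair_sigma_finite \<mu> \<nu> ..
  let ?i = "indicator A :: 'a \<Rightarrow> ennreal"
  have "(\<integral>\<^sup>+x. g (- x) * emeasure \<nu> {y. y + x \<in> A} \<partial>\<mu>) =
      (\<integral>\<^sup>+x. \<integral>\<^sup>+y. g (- x) * ?i (y + x) \<partial>\<nu> \<partial>\<mu>)"
    by (intro nn_integral_cong, subst nn_integral_cmult) (auto simp: nn_integral_indicator_shift[OF sets(2) A])
  also have "\<dots> = (\<integral>\<^sup>+y. \<integral>\<^sup>+x. g (- x) * ?i (y + x) \<partial>\<mu> \<partial>\<nu>)"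
    by (rule Fubini'[symmetric]) measurable
  also have "\<dots> = (\<integral>\<^sup>+y. \<integral>\<^sup>+x. g (- x + y) * ?i x \<partial>\<mu> \<partial>\<nu>)"
    using D(3)
  proof (intro nn_integral_cong_AE, eventually_elim)
    fix y assume y: "y \<in> D"
    have "(\<integral>\<^sup>+x. (\<lambda>z. g (- z + y) * ?i z) (y + x) \<partial>\<mu>) = (\<integral>\<^sup>+x. g (- x + y) * ?i x \<partial>\<mu>)"
      by (intro left_invariant_nn_integral[OF inv(1) sets(1) y]) measurable
    then show "(\<integral>\<^sup>+x. g (- x) * ?i (y + x) \<partial>\<mu>) = (\<integral>\<^sup>+x. g (- x + y) * ?i x \<partial>\<mu>)"
      by (simp add: minus_add add.assoc)
  qed
  also have "\<dots> = (\<integral>\<^sup>+x. \<integral>\<^sup>+y. g (- x + y) * ?i x \<partial>\<nu> \<partial>\<mu>)"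
    by (rule Fubini') measurable
  also have "\<dots> = (\<integral>\<^sup>+x. (\<integral>\<^sup>+y. g y \<partial>\<nu>) * ?i x \<partial>\<mu>)"
    using D(2)
  proof (intro nn_integral_cong_AE, eventually_elim)
    fix x assume "x \<in> D"
    then have x: "- x \<in> D" by (rule is_subgroupD(3)[OF D(1)])
    have "(\<integral>\<^sup>+y. g (- x + y) * ?i x \<partial>\<nu>) = (\<integral>\<^sup>+y. g (- x + y) \<partial>\<nu>) * ?i x"
      by (rule nn_integral_multc) measurable
    also have "(\<integral>\<^sup>+y. g (- x + y) \<partial>\<nu>) = (\<integral>\<^sup>+y. g y \<partial>\<nu>)"
      by (rule left_invariant_nn_integral[OF inv(2) sets(2) x]) measurable
    finally show "(\<integral>\<^sup>+y. g (- x + y) * ?i x \<partial>\<nu>) = (\<integral>\<^sup>+y. g y \<partial>\<nu>) * ?i x" .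
  qed
  also have "\<dots> = emeasure \<mu> A * (\<integral>\<^sup>+y. g y \<partial>\<nu>)"
    by (subst nn_integral_cmult) (auto simp: mult.commute)
  finally show ?thesis ..
qed

text \<open>
  Dividing by the function \<open>w x = \<nu> (A - x)\<close> in the preceding identity cancels the translate of \<open>A\<close>; the
  remaining integral against \<open>\<nu>\<close> does not depend on \<open>\<mu>\<close>, so it may be compared with \<open>\<mu> = \<nu>\<close>.
\<close>

lemma left_invariant_unique:
  fixes \<mu> \<nu> :: "'a::{topological_group_add, second_countable_topology} measure"
  assumes sets: "sets \<mu> = sets borel" "sets \<nu> = sets borel"
    and sf: "sigma_finite_measure \<mu>" "sigma_finite_measure \<nu>"
    and D: "is_subgroup D" "AE x in \<mu>. x \<in> D" "AE x in \<nu>. x \<in> D"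
    and inv: "left_invariant D \<mu>" "left_invariant D \<nu>"
    and A[measurable]: "A \<in> sets borel" and B[measurable]: "B \<in> sets borel"
    and w: "\<And>x. x \<in> D \<Longrightarrow> emeasure \<nu> {y. y + x \<in> A} \<noteq> 0"
      "\<And>x. x \<in> D \<Longrightarrow> emeasure \<nu> {y. y + x \<in> A} \<noteq> \<infinity>"
  shows "emeasure \<mu> A * emeasure \<nu> B = emeasure \<nu> A * emeasure \<mu> B"
proof -
  have [measurable_cong]: "sets \<mu> = sets borel" "sets \<nu> = sets borel" by fact+
  interpret N: sigma_finite_measure \<nu> by fact
  define w where "w = (\<lambda>x. emeasure \<nu> {y. y + x \<in> A})"
  have [measurable]: "w \<in> borel_measurable borel"
  proof -
    have "(\<lambda>x. \<integral>\<^sup>+y. indicator A (y + x) \<partial>\<nu>) \<in> borel_measurable borel"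
      by measurable
    also have "(\<lambda>x. \<integral>\<^sup>+y. indicator A (y + x) \<partial>\<nu>) = w"
      unfolding w_def by (simp add: nn_integral_indicator_shift[OF sets(2) A])
    finally show ?thesis .
  qed
  \<comment> \<open>The signs undo the inversion in the swap identity, so that
    \<open>g (- x) * w x\<close> is the indicator of \<open>B\<close> on \<open>D\<close>, where
    \<open>w\<close> is neither zero nor infinite and the quotient cancels.\<close>
  define g where "g = (\<lambda>y. indicator B (- y) / w (- y))"
  have [measurable]: "g \<in> borel_measurable borel"
    unfolding g_def by measurable
  have *: "emeasure \<mu>' A * (\<integral>\<^sup>+y. g y \<partial>\<nu>) = emeasure \<mu>' B"
    if \<mu>': "sets \<mu>' = sets borel" "sigma_finite_measure \<mu>'" "AE x in \<mu>'. x \<in> D"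
      "left_invariant D \<mu>'" for \<mu>' :: "'a measure"
  proof -
    have [measurable_cong]: "sets \<mu>' = sets borel" by fact
    have "emeasure \<mu>' A * (\<integral>\<^sup>+y. g y \<partial>\<nu>) = (\<integral>\<^sup>+x. g (- x) * w x \<partial>\<mu>')"
      unfolding w_def by (rule nn_integral_invariant_swap) (use assms \<mu>' in auto)
    also have "\<dots> = (\<integral>\<^sup>+x. indicator B x \<partial>\<mu>')"
      using \<mu>'(3)
    proof (intro nn_integral_cong_AE, eventually_elim)
      fix x assume "x \<in> D"
      then show "g (- x) * w x = indicator B x"
        using w[of x] by (cases "x \<in> B") (simp_all add: g_def w_def ennreal_divide_times ennreal_divide_self
            top.not_eq_extremum)
    qed
    also have "\<dots> = emeasure \<mu>' B" by simp
    finally show ?thesis .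
  qed
  show ?thesis
    using *[OF sets(1) sf(1) D(2) inv(1)] *[OF sets(2) sf(2) D(3) inv(2)]
    by (metis mult.assoc mult.commute)
qed

text \<open>The integral over \<open>x\<close> of the measure of \<open>E \<inter> (x + F)\<close>
  is the product of the measures of \<open>E\<close> and \<open>F\<close>. Each of these sets is
  empty or a left coset of \<open>E \<inter> F\<close>, so a null intersection would make the
  integral vanish.\<close>

lemma emeasure_Int_subgroup_pos:
  fixes \<eta> :: "'a::{topological_group_add, second_countable_topology} measure"
  assumes sets: "sets \<eta> = sets borel" and sf: "sigma_finite_measure \<eta>"
    and inv: "left_invariant UNIV \<eta>"
    and E[measurable]: "E \<in> sets borel" "is_subgroup E" "emeasure \<eta> E \<noteq> 0"
    and F[measurable]: "F \<in> sets borel" "is_subgroup F" "emeasure \<eta> F \<noteq> 0"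
  shows "emeasure \<eta> (E \<inter> F) \<noteq> 0"
proof
  assume 0: "emeasure \<eta> (E \<inter> F) = 0"
  have [measurable_cong]: "sets \<eta> = sets borel" by fact
  interpret M: sigma_finite_measure \<eta> by fact
  interpret pair_sigma_finite \<eta> \<eta> ..
  have "(\<integral>\<^sup>+x. indicator E y * indicator F (- x + y) \<partial>\<eta>) = indicator E y * emeasure \<eta> F" for y
  proof -
    have "(\<integral>\<^sup>+x. indicator E y * indicator F (- x + y) \<partial>\<eta>) =
        indicator E y * (\<integral>\<^sup>+x. indicator F (- x + y) \<partial>\<eta>)"
      by (rule nn_integral_cmult) measurable
    also have "(\<integral>\<^sup>+x. indicator F (- x + y) \<partial>\<eta>) = (\<integral>\<^sup>+x. (\<lambda>z. indicator F (- z + y)) (y + x) \<partial>\<eta>)"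
      by (rule left_invariant_nn_integral[OF inv sets UNIV_I, symmetric]) measurable
    also have "\<dots> = (\<integral>\<^sup>+x. indicator F x \<partial>\<eta>)"
    proof (rule nn_integral_cong)
      fix x
      \<comment> \<open>The left side is \<open>- x\<close>; the symmetry of \<open>F\<close>
        absorbs the inversion.\<close>
      have "- (y + x) + y \<in> F \<longleftrightarrow> x \<in> F"
        using is_subgroupD(3)[OF F(2), of x] is_subgroupD(3)[OF F(2), of "- x"]
        by (auto simp: minus_add add.assoc)
      then show "(indicator F (- (y + x) + y) :: ennreal) = indicator F x"
        by (simp add: indicator_def)
    qed
    finally show ?thesis by simp
  qed
  then have "(\<integral>\<^sup>+y. \<integral>\<^sup>+x. indicator E y * indicator F (- x + y) \<partial>\<eta> \<partial>\<eta>) = emeasure \<eta> E * emeasure \<eta> F"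
    by (simp add: nn_integral_multc)
  also have "(\<integral>\<^sup>+y. \<integral>\<^sup>+x. indicator E y * indicator F (- x + y) \<partial>\<eta> \<partial>\<eta>) =
      (\<integral>\<^sup>+x. \<integral>\<^sup>+y. indicator E y * indicator F (- x + y) \<partial>\<eta> \<partial>\<eta>)"
    by (rule Fubini') measurable
  also have "\<dots> = (\<integral>\<^sup>+x. 0 \<partial>\<eta>)"
  proof (rule nn_integral_cong)
    fix x
    have meas: "{y. y \<in> E \<and> - x + y \<in> F} \<in> sets borel" by measurable
    have ind: "(\<lambda>y. indicator E y * indicator F (- x + y)) =
        (indicator {y. y \<in> E \<and> - x + y \<in> F} :: 'a \<Rightarrow> ennreal)"
      by (auto simp: fun_eq_iff split: split_indicator)
    have "(\<integral>\<^sup>+y. indicator E y * indicator F (- x + y) \<partial>\<eta>) = emeasure \<eta> {y. y \<in> E \<and> - x + y \<in> F}"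
      unfolding ind by (rule nn_integral_indicator) (simp add: sets meas)
    also have "\<dots> = 0"
    proof (cases "\<exists>e\<in>E. - x + e \<in> F")
      case True
      then obtain e where e: "e \<in> E" "- x + e \<in> F" by auto
      have "{y. y \<in> E \<and> - x + y \<in> F} = (\<lambda>y. e + y) ` (E \<inter> F)"
      proof (safe; (intro rev_image_eqI)?)
        fix y assume y: "y \<in> E" "- x + y \<in> F"
        show "y = e + (- e + y)" by (simp add: add.assoc[symmetric])
        have "- (- x + e) + (- x + y) \<in> F" using e y F(2) by (metis is_subgroupD(2,3))
        then show "- e + y \<in> E \<inter> F"
          using e y is_subgroupD(2,3)[OF E(2)] by (simp add: minus_add add.assoc)
      next
        fix y assume y: "y \<in> E" "y \<in> F"
        show "e + y \<in> E" using e y E(2) by (metis is_subgroupD(2))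
        show "- x + (e + y) \<in> F" using e y F(2) by (metis is_subgroupD(2) add.assoc)
      qed
      then show ?thesis using left_invariant_emeasure_image[OF inv sets UNIV_I UNIV_I, of "E \<inter> F" e] E F 0
        by simp
    next
      case False
      then have "{y. y \<in> E \<and> - x + y \<in> F} = {}" by blast
      then show ?thesis by (metis emeasure_empty)
    qed
    finally show "(\<integral>\<^sup>+y. indicator E y * indicator F (- x + y) \<partial>\<eta>) = 0" .
  qed
  finally show False using E(3) F(3) by simp
qed

section \<open>Sigma-compact subgroups\<close>

text \<open>Domains, ranges and composites of closed subgroups are continuous images and need not be
  closed. Sigma-compactness survives images and products and still implies Borel.\<close>

definition sigma_compact :: "'a::topological_space set \<Rightarrow> bool" where
  "sigma_compact S \<longleftrightarrow> (\<exists>\<C>. countable \<C> \<and> (\<forall>C\<in>\<C>. compact C) \<and> \<Union>\<C> = S)"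

lemma sigma_compact_borel:
  fixes S :: "'a::t2_space set"
  assumes "sigma_compact S"
  shows "S \<in> sets borel"
proof -
  obtain \<C> where "countable \<C>" "\<forall>C\<in>\<C>. compact C" "\<Union>\<C> = S"
    using assms by (auto simp: sigma_compact_def)
  then show ?thesis
    using sets.countable_Union[of \<C> borel] by (auto intro: borel_compact)
qed

lemma sigma_compact_Int_closed:
  assumes "sigma_compact S" "closed F"
  shows "sigma_compact (S \<inter> F)"
proof -
  obtain \<C> where "countable \<C>" "\<forall>C\<in>\<C>. compact C" "\<Union>\<C> = S"
    using assms by (auto simp: sigma_compact_def)
  then show ?thesis
    unfolding sigma_compact_def
    by (intro exI[of _ "(\<lambda>C. C \<inter> F) ` \<C>"]) (auto intro: compact_Int_closed assms)
qed

lemma sigma_compact_image: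
  assumes "sigma_compact S" "continuous_on UNIV f"
  shows "sigma_compact (f ` S)"
proof -
  obtain \<C> where "countable \<C>" "\<forall>C\<in>\<C>. compact C" "\<Union>\<C> = S"
    using assms by (auto simp: sigma_compact_def)
  then show ?thesis
    unfolding sigma_compact_def
    by (intro exI[of _ "(`) f ` \<C>"])
       (auto intro: compact_continuous_image continuous_on_subset[OF assms(2)])
qed

lemma sigma_compact_Times:
  assumes "sigma_compact S" "sigma_compact T"
  shows "sigma_compact (S \<times> T)"
proof -
  obtain \<C> \<D> where "countable \<C>" "\<forall>C\<in>\<C>. compact C" "\<Union>\<C> = S"
      "countable \<D>" "\<forall>C\<in>\<D>. compact C" "\<Union>\<D> = T"
    using assms by (auto simp: sigma_compact_def)
  then show ?thesis
    unfolding sigma_compact_def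
    by (intro exI[of _ "(\<lambda>(C, D). C \<times> D) ` (\<C> \<times> \<D>)"]) (auto intro: compact_Times)
qed

text \<open>The open sets contained in a compact set cover the space, and second countability
  extracts a countable subcover.\<close>

lemma sigma_compact_UNIV:
  assumes "locally_compact_space (euclidean :: 'a::second_countable_topology topology)"
  shows "sigma_compact (UNIV :: 'a set)"
proof -
  let ?F = "{U :: 'a set. open U \<and> (\<exists>K. compact K \<and> U \<subseteq> K)}"
  obtain F' where F': "F' \<subseteq> ?F" "countable F'" "\<Union>F' = \<Union>?F"
    by (rule Lindelof[of ?F]) auto
  have "\<forall>U\<in>F'. \<exists>K. compact K \<and> U \<subseteq> K" using F'(1) by blast
  from bchoice[OF this] obtain k where k: "\<And>U. U \<in> F' \<Longrightarrow> compact (k U) \<and> U \<subseteq> k U"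
    by blast
  have "\<exists>U\<in>?F. x \<in> U" for x
    using assms by (simp add: locally_compact_space_def) blast
  then have "\<Union>F' = UNIV" using F'(3) by blast
  then have "\<Union>(k ` F') = UNIV" using k by blast
  then show ?thesis
    unfolding sigma_compact_def using F'(2) k by (intro exI[of _ "k ` F'"]) auto
qed

section \<open>Approximation of measures by compact and open sets\<close>

lemma locally_compact_compact_nbhd:
  assumes "locally_compact_space (euclidean :: 'a::topological_space topology)"
    and Q: "compact (Q :: 'a set)"
  obtains V K where "open V" "compact K" "Q \<subseteq> V" "V \<subseteq> K"
proof -
  have "\<exists>U K. open U \<and> compact K \<and> x \<in> U \<and> U \<subseteq> K" for x :: 'a
    using assms(1) by (simp add: locally_compact_space_def)
  then obtain u k where uk: "\<And>x. open (u x) \<and> compact (k x) \<and> x \<in> u x \<and> u x \<subseteq> (k x :: 'a set)"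
    by metis
  obtain F where F: "finite F" "F \<subseteq> Q" "Q \<subseteq> (\<Union>x\<in>F. u x)"
    by (rule compactE_image[OF Q, of Q u]) (use uk in auto)
  have "open (\<Union>x\<in>F. u x)" "compact (\<Union>x\<in>F. k x)" "(\<Union>x\<in>F. u x) \<subseteq> (\<Union>x\<in>F. k x)"
    using uk F(1) by (auto intro!: compact_UN)
  with F(3) show ?thesis using that by blast
qed

text \<open>A weak inner regularity: a countable union of null compact sets is null.\<close>

lemma sigma_compact_emeasure_pos:
  fixes \<mu> :: "'a::t2_space measure"
  assumes "sigma_compact S" "sets \<mu> = sets borel" "emeasure \<mu> S \<noteq> 0"
  obtains C where "compact C" "C \<subseteq> S" "emeasure \<mu> C \<noteq> 0"
proof (rule ccontr)
  assume no: "\<not> thesis"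
  obtain \<C> where \<C>: "countable \<C>" "\<forall>C\<in>\<C>. compact C" "\<Union>\<C> = S"
    using assms by (auto simp: sigma_compact_def)
  have "C \<in> null_sets \<mu>" if "C \<in> \<C>" for C
    using \<C> that no that assms(2) \<open>\<And>C. \<lbrakk>compact C; C \<subseteq> S; emeasure \<mu> C \<noteq> 0\<rbrakk> \<Longrightarrow> thesis\<close>
    by (auto simp: null_sets_def intro: borel_compact)
  then have "(\<Union>C\<in>\<C>. C) \<in> null_sets \<mu>"
    by (intro null_sets_UN' \<C>(1)) auto
  then show False using \<C>(3) assms(3) by auto
qed

text \<open>Outer regularity at a compact set. The finite unions of base sets that cover
  \<open>Q\<close> form a countable family, and its intersection is \<open>Q\<close> because
  finitely many base sets avoiding a given outside point suffice to cover \<open>Q\<close>.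
  Continuity from above along partial intersections gives the bound.\<close>

lemma compact_open_superset_emeasure_less:
  fixes \<mu> :: "'a::{t2_space, second_countable_topology} measure"
  assumes "sets \<mu> = sets borel" and Q: "compact Q" and V: "open V" "Q \<subseteq> V" "emeasure \<mu> V < \<infinity>"
    and c: "emeasure \<mu> Q < c"
  obtains U where "open U" "Q \<subseteq> U" "emeasure \<mu> U < c"
proof -
  have [measurable_cong]: "sets \<mu> = sets borel" by fact
  obtain B :: "'a set set" where B: "countable B" "topological_basis B"
    using ex_countable_basis by auto
  define F where "F = {\<Union>b | b. finite b \<and> b \<subseteq> B \<and> Q \<subseteq> \<Union>b}"
  have "F \<subseteq> Union ` {b. finite b \<and> b \<subseteq> B}" by (auto simp: F_def)
  then have "countable F"
    using countable_Collect_finite_subset[OF B(1)] by (meson countable_image countable_subset)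
  have opF: "open U" "Q \<subseteq> U" if "U \<in> F" for U
    using that topological_basis_open[OF B(2)] by (auto simp: F_def)
  have sep: "\<exists>U\<in>F. y \<notin> U" if "y \<notin> Q" for y
  proof -
    have "\<exists>b\<in>B. q \<in> b \<and> y \<notin> b" if q: "q \<in> Q" for q
    proof -
      obtain O' where "open O'" "q \<in> O'" "y \<notin> O'"
        using q \<open>y \<notin> Q\<close> by (metis t1_space)
      then show ?thesis
        using topological_basisE[OF B(2)] by (metis subsetD)
    qed
    then obtain b where b: "\<And>q. q \<in> Q \<Longrightarrow> b q \<in> B \<and> q \<in> b q \<and> y \<notin> b q" by metis
    obtain T where "T \<subseteq> Q" "finite T" "Q \<subseteq> (\<Union>q\<in>T. b q)"
      by (rule compactE_image[OF Q, of Q b]) (use b topological_basis_open[OF B(2)] in auto)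
    then show ?thesis using b
      by (intro bexI[of _ "\<Union>(b ` T)"]) (auto simp: F_def intro!: exI[of _ "b ` T"])
  qed
  define e where "e = from_nat_into (insert V F)"
  have e: "range e = insert V F"
    unfolding e_def using \<open>countable F\<close> by (intro range_from_nat_into) auto
  \<comment> \<open>Cutting with \<open>V\<close> makes all members of the decreasing sequence
    finite in measure, as continuity from above requires.\<close>
  define U where "U n = V \<inter> (\<Inter>i\<le>n. e i)" for n
  have op: "open (e i)" "Q \<subseteq> e i" for i
    using e opF V by (metis insertE rangeI)+
  have oU: "open (U n)" "Q \<subseteq> U n" for n
    unfolding U_def using V op by auto
  have "(\<Inter>n. U n) = Q"
  proof
    show "(\<Inter>n. U n) \<subseteq> Q"
    proof (rule subsetI, rule ccontr)
      fix y assume y: "y \<in> (\<Inter>n. U n)" "y \<notin> Q"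
      then obtain W where "W \<in> F" "y \<notin> W" using sep by auto
      then obtain i where "y \<notin> e i" using e by (metis insertI2 rangeE)
      with y show False by (auto simp: U_def)
    qed
  qed (use oU in auto)
  moreover have "(\<lambda>n. emeasure \<mu> (U n)) \<longlonglongrightarrow> emeasure \<mu> (\<Inter>n. U n)"
  proof (rule Lim_emeasure_decseq)
    show "range U \<subseteq> sets \<mu>" using oU by (auto simp: assms(1))
    show "decseq U" unfolding decseq_def U_def by fastforce
    have "emeasure \<mu> (U n) \<le> emeasure \<mu> V" for n
      using V by (intro emeasure_mono) (auto simp: U_def assms(1))
    from le_less_trans[OF this V(3)] show "emeasure \<mu> (U n) \<noteq> \<infinity>" for n
      by (metis less_irrefl infinity_ennreal_def)
  qed
  ultimately have "\<forall>\<^sub>F n in sequentially. emeasure \<mu> (U n) < c"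
    using c by (intro order_tendstoD(2)[of _ "emeasure \<mu> Q"]) simp_all
  then obtain n where "emeasure \<mu> (U n) < c"
    by (auto simp: eventually_sequentially)
  then show ?thesis using oU that by blast
qed

text \<open>
  For \<open>x\<close> in the closure but not in the subgroup, the coset of \<open>x\<close> is a null set, whereas the
  invariant mass of a compact subset does not drop under translations converging to \<open>x\<close>.
\<close>

lemma closed_subgroup_of_invariant_measure:
  fixes \<kappa> :: "'a::{topological_group_add, t2_space, second_countable_topology} measure"
  assumes sets: "sets \<kappa> = sets borel" and S: "sigma_compact S" "is_subgroup S"
    and inv: "left_invariant S \<kappa>" and ae: "AE x in \<kappa>. x \<in> S" and nz: "emeasure \<kappa> S \<noteq> 0"
    and fin: "\<And>Q. compact Q \<Longrightarrow> \<exists>V. open V \<and> Q \<subseteq> V \<and> emeasure \<kappa> V < \<infinity>"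
  shows "closed S"
proof -
  have [measurable_cong]: "sets \<kappa> = sets borel" by fact
  have "x \<in> S" if x: "x \<in> closure S" for x
  proof (rule ccontr)
    assume xS: "x \<notin> S"
    obtain C where C: "compact C" "C \<subseteq> S" "emeasure \<kappa> C \<noteq> 0"
      by (rule sigma_compact_emeasure_pos[OF S(1) sets nz])
    define Q where "Q = (+) x ` C"
    have Q: "compact Q"
      unfolding Q_def using C(1) by (intro compact_continuous_image continuous_intros)
    have "Q \<inter> S = {}"
    proof (rule ccontr)
      assume "Q \<inter> S \<noteq> {}"
      then obtain c where c: "c \<in> S" "x + c \<in> S" using C(2) by (auto simp: Q_def)
      then have "(x + c) - c \<in> S" by (intro is_subgroup_minus[OF S(2)])
      with xS show False by simp
    qed
    have "Q \<in> sets borel" using Q by (auto intro: borel_compact)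
    moreover have "AE y in \<kappa>. y \<notin> Q"
      using ae by eventually_elim (use \<open>Q \<inter> S = {}\<close> in auto)
    ultimately have "emeasure \<kappa> Q = 0"
      using sets_eq_imp_space_eq[OF sets] by (subst (asm) AE_iff_measurable[of Q]) (auto simp: sets)
    obtain V where V: "open V" "Q \<subseteq> V" "emeasure \<kappa> V < \<infinity>" using fin[OF Q] by auto
    \<comment> \<open>Since \<open>x + C\<close> is null, it has an open hull with less mass than
      \<open>C\<close>. The tube lemma then places a translate of \<open>C\<close> by some element
      of \<open>S\<close> near \<open>x\<close> inside this hull.\<close>
    obtain U where U: "open U" "Q \<subseteq> U" "emeasure \<kappa> U < emeasure \<kappa> C"
      by (rule compact_open_superset_emeasure_less[OF sets Q V, of "emeasure \<kappa> C"])
         (use C \<open>emeasure \<kappa> Q = 0\<close> in \<open>auto simp: zero_less_iff_neq_zero\<close>)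
    have O1: "open ((\<lambda>p. fst p + snd p) -` U :: ('a \<times> 'a) set)"
      using U(1) by (intro open_vimage continuous_intros)
    have "{x} \<times> C \<subseteq> (\<lambda>p. fst p + snd p) -` U" using U(2) by (auto simp: Q_def)
    from Elementary_Topology.tube_lemma[OF C(1) O1 this]
    obtain W where W: "open W" "x \<in> W" "W \<times> C \<subseteq> (\<lambda>p. fst p + snd p) -` U"
      by blast
    then obtain s where s: "s \<in> S" "s \<in> W"
      using x by (meson closure_iff_nhds_not_empty disjoint_iff order_refl)
    have "emeasure \<kappa> C = emeasure \<kappa> ((+) s ` C)"
      using s S(2) C(1) by (intro left_invariant_emeasure_image[OF inv sets, symmetric])
        (auto intro: borel_compact is_subgroupD)
    also have "\<dots> \<le> emeasure \<kappa> U"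
      using W(3) s U(1) by (intro emeasure_mono) (auto simp: sets)
    finally show False using U(3) by simp
  qed
  then show ?thesis by (metis closure_subset_eq subsetI)
qed

section \<open>Extended Haar measures and their projections\<close>

lemma vimage_add_borel [measurable]:
  fixes A :: "'a::{topological_monoid_add, second_countable_topology} set"
  assumes "A \<in> sets borel"
  shows "(+) x -` A \<in> sets borel"
  using assms measurable_sets[of "(+) x" borel borel A] by simp

lemma sigma_finite_of_compact_finite:
  fixes \<mu> :: "'a::t2_space measure"
  assumes "sets \<mu> = sets borel" "sigma_compact (UNIV :: 'a set)"
    "\<And>C. compact C \<Longrightarrow> emeasure \<mu> C < \<infinity>"
  shows "sigma_finite_measure \<mu>"
proof -
  obtain \<C> where \<C>: "countable \<C>" "\<forall>C\<in>\<C>. compact C" "\<Union>\<C> = (UNIV :: 'a set)"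
    using assms(2) by (auto simp: sigma_compact_def)
  show ?thesis
  proof
    have "emeasure \<mu> C \<noteq> \<infinity>" if "C \<in> \<C>" for C
      using assms(3)[of C] \<C>(2) that by auto
    then show "\<exists>A. countable A \<and> A \<subseteq> sets \<mu> \<and> \<Union> A = space \<mu> \<and> (\<forall>a\<in>A. emeasure \<mu> a \<noteq> \<infinity>)"
      using \<C> sets_eq_imp_space_eq[OF assms(1)]
      by (intro exI[of _ \<C>]) (auto simp: assms(1) intro: borel_compact)
  qed
qed

lemma unimodular_haar_measureD:
  fixes \<gamma> :: "'a::{topological_group_add, second_countable_topology} measure"
  assumes "unimodular_haar_measure \<gamma>"
  shows "sets \<gamma> = sets borel" "left_invariant UNIV \<gamma>"
    "\<And>C. compact C \<Longrightarrow> emeasure \<gamma> C < \<infinity>"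
    "\<And>A x. A \<in> sets borel \<Longrightarrow> emeasure \<gamma> {y. y + x \<in> A} = emeasure \<gamma> A"
proof -
  show s: "sets \<gamma> = sets borel"
    using assms by (simp add: unimodular_haar_measure_def haar_measure_on_def sets_restrict_space)
  have sp: "space \<gamma> = UNIV" using sets_eq_imp_space_eq[OF s] by simp
  show "\<And>C. compact C \<Longrightarrow> emeasure \<gamma> C < \<infinity>"
    using assms by (simp add: unimodular_haar_measure_def haar_measure_on_def)
  note [measurable_cong] = s
  have l: "emeasure \<gamma> ((\<lambda>y. x + y) ` A) = emeasure \<gamma> A"
    and r: "emeasure \<gamma> ((\<lambda>y. y + x) ` A) = emeasure \<gamma> A" if "A \<in> sets borel" for x A
    using assms that by (auto simp: unimodular_haar_measure_def haar_measure_on_def s[symmetric])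
  show "left_invariant UNIV \<gamma>"
    unfolding left_invariant_def
  proof (intro ballI measure_eqI)
    fix x A assume "A \<in> sets (distr \<gamma> borel ((+) x))"
    then have A[measurable]: "A \<in> sets borel" by simp
    have "(+) x -` A = (\<lambda>y. - x + y) ` A"
      by (auto intro: rev_image_eqI simp: add.assoc[symmetric])
    then show "emeasure (distr \<gamma> borel ((+) x)) A = emeasure \<gamma> A"
      using l[OF A, of "- x"] by (subst emeasure_distr) (auto simp: sp)
  qed (simp add: s)
  show "emeasure \<gamma> {y. y + x \<in> A} = emeasure \<gamma> A" if A: "A \<in> sets borel" for A x
  proof -
    have "{y. y + x \<in> A} = (\<lambda>y. y + - x) ` A"
      by (auto intro: rev_image_eqI simp: add.assoc)
    then show ?thesis using r[OF A, of "- x"] by simp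
  qed
qed

text \<open>A left Haar measure of the Borel subgroup \<open>R\<close>, extended by zero to the whole group.\<close>

definition extended_haar :: "'a::topological_group_add set \<Rightarrow> 'a measure \<Rightarrow> bool" where
  "extended_haar R \<mu> \<longleftrightarrow> R \<in> sets borel \<and> is_subgroup R \<and> sets \<mu> = sets borel \<and>
     left_invariant R \<mu> \<and> (AE x in \<mu>. x \<in> R) \<and> emeasure \<mu> R \<noteq> 0"

lemma distr_restrict_id:
  assumes \<rho>: "sets \<rho> = sets (restrict_space borel R)" and R: "R \<in> sets borel" and E: "E \<in> sets borel"
  shows "(\<lambda>x. x) \<in> measurable \<rho> borel" "emeasure (distr \<rho> borel (\<lambda>x. x)) E = emeasure \<rho> (R \<inter> E)"
proof -
  show m: "(\<lambda>x. x) \<in> measurable \<rho> borel"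
    unfolding measurable_cong_sets[OF \<rho> refl] by (intro measurable_restrict_space1) simp
  have "space \<rho> = R" using sets_eq_imp_space_eq[OF \<rho>] by (simp add: space_restrict_space)
  then show "emeasure (distr \<rho> borel (\<lambda>x. x)) E = emeasure \<rho> (R \<inter> E)"
    by (subst emeasure_distr[OF m]) (auto simp: E Int_commute)
qed

lemma haar_measure_on_imp_extended_haar:
  fixes R :: "'a::{topological_group_add, second_countable_topology} set"
  assumes R: "R \<in> sets borel" "is_subgroup R" and h: "haar_measure_on R \<rho>"
  shows "extended_haar R (distr \<rho> borel (\<lambda>x. x))"
proof -
  have \<rho>: "sets \<rho> = sets (restrict_space borel R)" using h by (simp add: haar_measure_on_def)
  note em = distr_restrict_id(2)[OF \<rho> R(1)]
  let ?\<mu> = "distr \<rho> borel (\<lambda>x. x)"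
  have inv: "left_invariant R ?\<mu>"
    unfolding left_invariant_def
  proof (intro ballI measure_eqI)
    fix x A assume x: "x \<in> R" and "A \<in> sets (distr ?\<mu> borel ((+) x))"
    then have A[measurable]: "A \<in> sets borel" by simp
    have B: "(+) x -` A \<in> sets borel" by measurable
    have "emeasure (distr ?\<mu> borel ((+) x)) A = emeasure ?\<mu> ((+) x -` A \<inter> space ?\<mu>)"
      by (rule emeasure_distr) auto
    also have "\<dots> = emeasure ?\<mu> ((+) x -` A)" by simp
    also have "\<dots> = emeasure \<rho> (R \<inter> (+) x -` A)" by (rule em[OF B])
    also have "\<dots> = emeasure \<rho> ((\<lambda>y. x + y) ` (R \<inter> (+) x -` A))"
    proof -
      have "R \<inter> (+) x -` A \<in> sets \<rho>" unfolding \<rho> sets_restrict_space using B by (rule imageI)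
      then show ?thesis using h x unfolding haar_measure_on_def by simp
    qed
    also have "(\<lambda>y. x + y) ` (R \<inter> (+) x -` A) = R \<inter> A"
    proof (intro equalityI subsetI)
      fix y assume y: "y \<in> R \<inter> A"
      then have "- x + y \<in> R" using R(2) x by (intro is_subgroupD(2,3)) auto
      then show "y \<in> (\<lambda>y. x + y) ` (R \<inter> (+) x -` A)"
        using y by (intro rev_image_eqI[of "- x + y"]) (auto simp: add.assoc[symmetric])
    qed (use x is_subgroupD(2)[OF R(2)] in auto)
    also have "emeasure \<rho> (R \<inter> A) = emeasure ?\<mu> A" by (rule em[OF A, symmetric])
    finally show "emeasure (distr ?\<mu> borel ((+) x)) A = emeasure ?\<mu> A" .
  qed simp
  have "emeasure ?\<mu> (- R) = 0" using R(1) by (subst em) auto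
  then have "AE x in ?\<mu>. x \<in> R"
    using R(1) by (subst AE_iff_measurable[of "- R"]) auto
  moreover have "emeasure ?\<mu> R \<noteq> 0"
    using h R(1) by (subst em) (auto simp: haar_measure_on_def)
  ultimately show ?thesis
    using inv R by (simp add: extended_haar_def)
qed

lemma emeasure_AE_Int:
  assumes "AE x in \<mu>. x \<in> R" "R \<in> sets \<mu>" "A \<in> sets \<mu>"
  shows "emeasure \<mu> (A \<inter> R) = emeasure \<mu> A"
  using assms by (intro emeasure_eq_AE) auto

lemma extended_haar_imp_haar_measure_on:
  fixes S :: "'a::{topological_group_add, second_countable_topology, t2_space} set"
  assumes h: "extended_haar S \<mu>" and fin: "\<And>C. compact C \<Longrightarrow> emeasure \<mu> C < \<infinity>"
  shows "haar_measure_on S (restrict_space \<mu> S)"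
    "distr (restrict_space \<mu> S) borel (\<lambda>x. x) = \<mu>"
    "E \<in> sets borel \<Longrightarrow> emeasure (restrict_space \<mu> S) (S \<inter> E) = emeasure \<mu> E"
proof -
  have S: "S \<in> sets borel" "is_subgroup S" and s: "sets \<mu> = sets borel"
    and inv: "left_invariant S \<mu>" and ae: "AE x in \<mu>. x \<in> S" and nz: "emeasure \<mu> S \<noteq> 0"
    using h by (auto simp: extended_haar_def)
  have sp: "space \<mu> = UNIV" using sets_eq_imp_space_eq[OF s] by simp
  have rs: "sets (restrict_space \<mu> S) = sets (restrict_space borel S)"
    by (simp add: sets_restrict_space s)
  have em: "emeasure (restrict_space \<mu> S) A = emeasure \<mu> A" if "A \<subseteq> S" for A
    using that S by (intro emeasure_restrict_space) (auto simp: s sp)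
  show em': "emeasure (restrict_space \<mu> S) (S \<inter> E) = emeasure \<mu> E" if "E \<in> sets borel" for E
    using emeasure_AE_Int[OF ae, of E] S that by (subst em) (auto simp: s Int_commute)
  show "distr (restrict_space \<mu> S) borel (\<lambda>x. x) = \<mu>"
    using s by (intro measure_eqI) (simp_all add: distr_restrict_id(2)[OF rs S(1)] em')
  show "haar_measure_on S (restrict_space \<mu> S)"
    unfolding haar_measure_on_def
  proof (intro conjI ballI allI impI)
    fix x A assume x: "x \<in> S" and "A \<in> sets (restrict_space \<mu> S)"
    then have A: "A \<in> sets borel" "A \<subseteq> S"
      using S by (auto simp: sets_restrict_space s)
    then have "(\<lambda>y. x + y) ` A \<subseteq> S" using x is_subgroupD(2)[OF S(2)] by auto
    then show "emeasure (restrict_space \<mu> S) ((\<lambda>y. x + y) ` A) = emeasure (restrict_space \<mu> S) A"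
      using A left_invariant_emeasure_image[OF inv s x is_subgroupD(3)[OF S(2) x] A(1)]
      by (simp add: em)
  next
    fix C assume "compact C \<and> C \<subseteq> S"
    then show "emeasure (restrict_space \<mu> S) C < \<infinity>" using fin[of C] by (simp add: em)
  qed (use rs nz em in auto)
qed

section \<open>Images of invariant measures under homomorphisms\<close>

lemma additive_zero_minus:
  fixes p :: "'a::group_add \<Rightarrow> 'b::group_add"
  assumes "\<And>x y. p (x + y) = p x + p y"
  shows "p 0 = 0" "p (- x) = - p x"
proof -
  have "p 0 + p 0 = p 0 + 0" using assms[of 0 0] by simp
  then show 0: "p 0 = 0" by (rule add_left_imp_eq)
  have "p (- x) + p x = 0" using assms[of "- x" x] 0 by simp
  then show "p (- x) = - p x" by (simp add: eq_neg_iff_add_eq_0)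
qed

lemma is_subgroup_image:
  fixes p :: "'a::group_add \<Rightarrow> 'b::group_add"
  assumes p: "\<And>x y. p (x + y) = p x + p y" and R: "is_subgroup R"
  shows "is_subgroup (p ` R)"
  unfolding is_subgroup_def
proof (intro conjI ballI)
  show "0 \<in> p ` R"
    using is_subgroupD(1)[OF R] additive_zero_minus(1)[of p, OF p] by (metis image_eqI)
next
  fix x y assume "x \<in> p ` R" "y \<in> p ` R"
  then show "x + y \<in> p ` R" using is_subgroupD(2)[OF R] p by (metis (no_types, lifting) imageE image_eqI)
next
  fix x assume "x \<in> p ` R"
  then show "- x \<in> p ` R"
    using is_subgroupD(3)[OF R] additive_zero_minus(2)[of p, OF p] by (metis imageE image_eqI)
qed

text \<open>The image of \<open>\<mu>\<close> under \<open>p\<close> and the restriction of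
  \<open>\<gamma>\<close> to the image of \<open>R\<close> are both sigma-finite and invariant under
  that image, hence proportional. The compact set \<open>C\<close> is the test set of the uniqueness
  lemma; it is exported because a set of finite positive measure is what later pins down the
  constant. Leaving \<open>p\<close> abstract covers both projections.\<close>

lemma projection_scaling:
  fixes p :: "'p::{topological_group_add, t2_space, second_countable_topology} \<Rightarrow>
      'g::{topological_group_add, t2_space, second_countable_topology}"
  assumes p: "\<And>x y. p (x + y) = p x + p y" "continuous_on UNIV p"
    and R: "sigma_compact R" "extended_haar R \<mu>"
    and \<gamma>: "unimodular_haar_measure \<gamma>" "sigma_compact (UNIV :: 'g set)"
    and dom: "\<And>A. A \<in> sets borel \<Longrightarrow> emeasure \<mu> (p -` A) \<le> emeasure \<gamma> A"
  obtains a C where "0 < a" "\<And>A. A \<in> sets borel \<Longrightarrow>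
      emeasure \<mu> (p -` A) = ennreal a * emeasure \<gamma> (A \<inter> p ` R)"
    "compact C" "C \<subseteq> p ` R" "emeasure \<gamma> C \<noteq> 0"
proof -
  define D where "D = p ` R"
  have Rs: "R \<in> sets borel" "is_subgroup R" and s: "sets \<mu> = sets borel"
    and inv: "left_invariant R \<mu>" and ae: "AE x in \<mu>. x \<in> R" and nz: "emeasure \<mu> R \<noteq> 0"
    using R(2) by (auto simp: extended_haar_def)
  note \<gamma>D = unimodular_haar_measureD[OF \<gamma>(1)]
  note [measurable_cong] = s \<gamma>D(1)
  have sp: "space \<mu> = UNIV" "space \<gamma> = UNIV"
    using sets_eq_imp_space_eq[OF s] sets_eq_imp_space_eq[OF \<gamma>D(1)] by auto
  have [measurable]: "p \<in> borel_measurable borel"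
    using p(2) by (rule borel_measurable_continuous_onI)
  have Dc: "sigma_compact D" unfolding D_def by (rule sigma_compact_image[OF R(1) p(2)])
  have D[measurable]: "D \<in> sets borel" by (rule sigma_compact_borel[OF Dc])
  have Ds: "is_subgroup D" unfolding D_def by (rule is_subgroup_image[of p, OF p(1) Rs(2)])
  have sfg: "sigma_finite_measure \<gamma>" by (rule sigma_finite_of_compact_finite[OF \<gamma>D(1) \<gamma>(2) \<gamma>D(3)])
  define \<mu>' where "\<mu>' = distr \<mu> borel p"
  define \<nu> where "\<nu> = density \<gamma> (indicator D)"
  have s': "sets \<mu>' = sets borel" "sets \<nu> = sets borel" by (auto simp: \<mu>'_def \<nu>_def \<gamma>D(1))
  have e\<mu>: "emeasure \<mu>' A = emeasure \<mu> (p -` A)" if [measurable]: "A \<in> sets borel" for A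
    unfolding \<mu>'_def by (subst emeasure_distr) (auto simp: sp)
  have e\<nu>: "emeasure \<nu> A = emeasure \<gamma> (A \<inter> D)" if [measurable]: "A \<in> sets borel" for A
    unfolding \<nu>_def by (subst emeasure_restricted) (auto simp: \<gamma>D(1) Int_commute)
  have sf: "sigma_finite_measure \<mu>'" "sigma_finite_measure \<nu>"
  proof -
    have "emeasure \<mu>' C < \<infinity>" "emeasure \<nu> C < \<infinity>" if C: "compact C" for C
    proof -
      have "emeasure \<gamma> (C \<inter> D) \<le> emeasure \<gamma> C"
        using borel_compact[OF C] by (intro emeasure_mono) (auto simp: \<gamma>D(1))
      then show "emeasure \<mu>' C < \<infinity>" "emeasure \<nu> C < \<infinity>"
        using \<gamma>D(3)[OF C] dom[OF borel_compact[OF C]] borel_compact[OF C]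
        by (auto simp: e\<mu> e\<nu> intro: le_less_trans)
    qed
    then show "sigma_finite_measure \<mu>'" "sigma_finite_measure \<nu>"
      by (auto intro!: sigma_finite_of_compact_finite s' \<gamma>(2))
  qed
  have inv': "left_invariant D \<mu>'" "left_invariant D \<nu>"
    unfolding left_invariant_def
  proof (safe intro!: measure_eqI)
    fix x A assume x: "x \<in> D" and "A \<in> sets (distr \<mu>' borel ((+) x))"
    then have A[measurable]: "A \<in> sets borel" by simp
    obtain r where r: "r \<in> R" "x = p r" using x by (auto simp: D_def)
    have B: "(+) x -` A \<in> sets borel" "p -` A \<in> sets borel"
      using A measurable_sets[of p borel borel A] by auto
    have "emeasure (distr \<mu>' borel ((+) x)) A = emeasure \<mu>' ((+) x -` A)"
      using sets_eq_imp_space_eq[OF s'(1)] by (subst emeasure_distr) (auto simp: measurable_cong_sets[OF s'(1) refl])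
    also have "\<dots> = emeasure \<mu> (p -` (+) x -` A)" by (rule e\<mu>[OF B(1)])
    also have "p -` (+) x -` A = (+) r -` p -` A" by (auto simp: r p(1))
    also have "emeasure \<mu> \<dots> = emeasure (distr \<mu> borel ((+) r)) (p -` A)"
      using B(2) by (subst emeasure_distr) (auto simp: sp)
    also have "\<dots> = emeasure \<mu>' A" using inv r by (simp add: left_invariant_def e\<mu>)
    finally show "emeasure (distr \<mu>' borel ((+) x)) A = emeasure \<mu>' A" .
  next
    fix x A assume x: "x \<in> D" and "A \<in> sets (distr \<nu> borel ((+) x))"
    then have A[measurable]: "A \<in> sets borel" by simp
    have B: "(+) x -` A \<in> sets borel" by measurable
    have "emeasure (distr \<nu> borel ((+) x)) A = emeasure \<nu> ((+) x -` A)"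
      using sets_eq_imp_space_eq[OF s'(2)] by (subst emeasure_distr) (auto simp: measurable_cong_sets[OF s'(2) refl])
    also have "\<dots> = emeasure \<gamma> ((+) x -` A \<inter> D)" by (rule e\<nu>[OF B(1)])
    also have "(+) x -` A \<inter> D = (+) x -` (A \<inter> D)" by (auto simp: is_subgroup_add_iff[OF Ds x])
    also have "emeasure \<gamma> \<dots> = emeasure (distr \<gamma> borel ((+) x)) (A \<inter> D)"
      by (subst emeasure_distr) (auto simp: sp)
    also have "\<dots> = emeasure \<nu> A" using \<gamma>D(2) by (simp add: left_invariant_def e\<nu>)
    finally show "emeasure (distr \<nu> borel ((+) x)) A = emeasure \<nu> A" .
  qed (auto simp: s')
  have ae': "AE x in \<mu>'. x \<in> D" "AE x in \<nu>. x \<in> D"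
  proof -
    show "AE x in \<mu>'. x \<in> D"
      unfolding \<mu>'_def using ae by (subst AE_distr_iff) (auto simp: D_def[symmetric], auto simp: D_def)
    show "AE x in \<nu>. x \<in> D"
      unfolding \<nu>_def by (subst AE_density) (auto split: split_indicator)
  qed
  have \<mu>D: "emeasure \<mu>' D \<noteq> 0"
  proof -
    have "R \<subseteq> p -` D" by (auto simp: D_def)
    moreover have "p -` D \<in> sets \<mu>" using measurable_sets[of p borel borel D] D by (simp add: s)
    ultimately have "emeasure \<mu> R \<le> emeasure \<mu> (p -` D)" by (rule emeasure_mono)
    then show ?thesis using nz by (auto simp: e\<mu>)
  qed
  \<comment> \<open>Domination is used backwards: the image measure charges \<open>D\<close>, so
    \<open>\<gamma>\<close> must.\<close>
  then have "emeasure \<gamma> D \<noteq> 0" using dom[OF D] by (auto simp: e\<mu>)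
  then obtain C where C: "compact C" "C \<subseteq> D" "emeasure \<gamma> C \<noteq> 0"
    using sigma_compact_emeasure_pos[OF Dc \<gamma>D(1)] by metis
  have Cb: "C \<in> sets borel" by (rule borel_compact[OF C(1)])
  have \<nu>C: "emeasure \<nu> C = emeasure \<gamma> C" using Cb C(2) by (simp add: e\<nu> Int_absorb2)
  \<comment> \<open>A right translate of \<open>C\<close> by an element of \<open>D\<close> stays in
    \<open>D\<close>, so \<open>\<nu>\<close> agrees there with \<open>\<gamma>\<close>, and right
    invariance of \<open>\<gamma>\<close> applies.\<close>
  have w: "emeasure \<nu> {y. y + x \<in> C} = emeasure \<gamma> C" if x: "x \<in> D" for x
  proof -
    have "y \<in> D" if "y + x \<in> C" for y
    proof -
      have "(y + x) - x \<in> D" using that x C(2) by (intro is_subgroup_minus[OF Ds]) auto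
      then show ?thesis by simp
    qed
    then have "{y. y + x \<in> C} \<inter> D = {y. y + x \<in> C}" by auto
    moreover have "{y. y + x \<in> C} \<in> sets borel" using Cb by measurable
    ultimately show ?thesis by (simp add: e\<nu> \<gamma>D(4)[OF Cb])
  qed
  have fin: "emeasure \<gamma> C \<noteq> \<infinity>" using \<gamma>D(3)[OF C(1)] by simp
  have uniq: "emeasure \<mu>' C * emeasure \<nu> B = emeasure \<gamma> C * emeasure \<mu>' B" if "B \<in> sets borel" for B
    unfolding \<nu>C[symmetric]
    by (rule left_invariant_unique[OF s' sf Ds ae' inv' Cb that]) (use C fin in \<open>auto simp: w\<close>)
  have "emeasure \<mu>' C \<le> emeasure \<gamma> C" using dom[OF Cb] by (simp add: e\<mu>[OF Cb])
  then have fin': "emeasure \<mu>' C \<noteq> \<infinity>" using fin by (auto simp: top_unique)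
  define a where "a = measure \<mu>' C / measure \<gamma> C"
  have m: "emeasure \<mu>' C = ennreal (measure \<mu>' C)" "emeasure \<gamma> C = ennreal (measure \<gamma> C)"
    using fin fin' by (auto simp: emeasure_eq_ennreal_measure)
  have pos: "0 < measure \<gamma> C" using C(3) m(2) by (metis ennreal_0 zero_less_measure_iff measure_nonneg order_le_less)
  \<comment> \<open>If \<open>C\<close> were null for the image measure, \<open>uniq\<close> with
    \<open>D\<close> as the second set would make the whole image measure vanish on
    \<open>D\<close>.\<close>
  have "0 < measure \<mu>' C"
  proof (rule ccontr)
    assume "\<not> 0 < measure \<mu>' C"
    then have "emeasure \<mu>' C = 0" using m(1) by (simp add: not_less measure_le_0_iff)
    with uniq[OF D] C(3) \<mu>D show False by simp
  qed
  with pos have "0 < a" by (simp add: a_def)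
  moreover have "emeasure \<mu> (p -` A) = ennreal a * emeasure \<gamma> (A \<inter> D)" if A: "A \<in> sets borel" for A
  proof -
    have "emeasure \<gamma> C * (ennreal a * emeasure \<nu> A) = emeasure \<mu>' C * emeasure \<nu> A"
      unfolding m a_def mult.assoc[symmetric] using pos by (simp flip: ennreal_mult')
    also have "\<dots> = emeasure \<gamma> C * emeasure \<mu>' A" by (rule uniq[OF A])
    finally have "ennreal a * emeasure \<nu> A = emeasure \<mu>' A"
      using C(3) fin by (simp add: ennreal_mult_cancel_left)
    then show ?thesis by (simp add: e\<mu>[OF A] e\<nu>[OF A])
  qed
  ultimately show ?thesis using that C unfolding D_def by blast
qed

section \<open>The index formula\<close>

lemma ennreal_eq_0_of_multiples_le:
  fixes y b :: ennreal
  assumes "\<And>k :: nat. of_nat k * y \<le> b" "b \<noteq> \<infinity>"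
  shows "y = 0"
proof (rule ccontr)
  assume y: "y \<noteq> 0"
  have "y \<noteq> \<infinity>" using assms(1)[of 1] assms(2) by (auto simp: top_unique)
  then obtain r s where r: "y = ennreal r" "0 < r" and s: "b = ennreal s" "0 \<le> s"
    using assms(2) y by (cases y; cases b) (auto simp: order_less_le)
  obtain k :: nat where "s < real k * r" using reals_Archimedean3[OF r(2)] by blast
  moreover have "ennreal (real k * r) \<le> ennreal s"
    using assms(1)[of k] r s by (simp add: ennreal_mult' flip: ennreal_of_nat_eq_real_of_nat)
  ultimately show False using s by (simp add: ennreal_le_iff)
qed

text \<open>
  The translates by representatives of the cosets in \<open>q ` ker p\<close> of the points of \<open>R\<close> over
  \<open>E\<close> tile the points of \<open>R\<close> over \<open>p ` (R \<inter> q -` E)\<close>.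
\<close>

lemma subgroup_index_tiling:
  fixes p :: "'p::{topological_group_add, second_countable_topology} \<Rightarrow>
        'g::{topological_group_add, second_countable_topology}"
    and q :: "'p \<Rightarrow> 'h::{topological_group_add, second_countable_topology}"
  assumes p: "\<And>x y. p (x + y) = p x + p y" "p \<in> borel_measurable borel"
    and q: "\<And>x y. q (x + y) = q x + q y" "q \<in> borel_measurable borel"
    and R: "extended_haar R \<mu>" and E: "E \<in> sets borel" "is_subgroup E"
    and N: "N = q ` {r \<in> R. p r = 0}"
    and A0: "A0 \<in> sets borel" "emeasure \<mu> (p -` A0) \<noteq> \<infinity>" "emeasure \<mu> (p -` A0 \<inter> q -` E) \<noteq> 0"
  shows "0 < subgroup_index N (N \<inter> E)"
    and "A \<in> sets borel \<Longrightarrow> emeasure \<mu> {r \<in> R. p r \<in> A \<and> p r \<in> p ` (R \<inter> q -` E)} =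
           of_nat (subgroup_index N (N \<inter> E)) * emeasure \<mu> (p -` A \<inter> q -` E)"
proof -
  have Rb[measurable]: "R \<in> sets borel" and Rs: "is_subgroup R" and s: "sets \<mu> = sets borel"
    and inv: "left_invariant R \<mu>" and ae: "AE x in \<mu>. x \<in> R"
    using R by (auto simp: extended_haar_def)
  note [measurable] = p(2) q(2) E(1)
  define \<C> where "\<C> = (\<lambda>n. (+) n ` (N \<inter> E)) ` N"
  have index: "subgroup_index N (N \<inter> E) = card \<C>" by (simp add: subgroup_index_def \<C>_def)
  define Y where "Y A = {r \<in> R. p r \<in> A \<and> q r \<in> E}" for A
  \<comment> \<open>Quantifying over the whole coset avoids choosing representatives; by
    \<open>mem\<close>, any single representative decides membership.\<close>
  define Z where "Z A c = {r \<in> R. p r \<in> A \<and> (\<exists>n\<in>c. - n + q r \<in> E)}" for A c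
  have p0: "p 0 = 0" "p (- x) = - p x" for x by (rule additive_zero_minus[OF p(1)])+
  have q0: "q 0 = 0" "q (- x) = - q x" for x by (rule additive_zero_minus[OF q(1)])+
  have NE: "n \<in> N \<Longrightarrow> n' \<in> N \<Longrightarrow> - n + n' \<in> N" for n n'
  proof -
    assume "n \<in> N" "n' \<in> N"
    then obtain r r' where "r \<in> R" "p r = 0" "q r = n" "r' \<in> R" "p r' = 0" "q r' = n'"
      by (auto simp: N)
    then show "- n + n' \<in> N"
      unfolding N using Rs by (intro image_eqI[of _ _ "- r + r'"]) (auto simp: p q p0 q0 is_subgroupD)
  qed
  have Yb: "Y A \<in> sets borel" if [measurable]: "A \<in> sets borel" for A
    unfolding Y_def by measurable
  have Yeq: "emeasure \<mu> (Y A) = emeasure \<mu> (p -` A \<inter> q -` E)" if [measurable]: "A \<in> sets borel" for A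
  proof -
    have "{r. p r \<in> A \<and> q r \<in> E} \<in> sets borel" by measurable
    then have "emeasure \<mu> ({r. p r \<in> A \<and> q r \<in> E} \<inter> R) = emeasure \<mu> {r. p r \<in> A \<and> q r \<in> E}"
      by (intro emeasure_AE_Int[OF ae]) (auto simp: s)
    moreover have "{r. p r \<in> A \<and> q r \<in> E} \<inter> R = Y A" by (auto simp: Y_def)
    moreover have "{r. p r \<in> A \<and> q r \<in> E} = p -` A \<inter> q -` E" by auto
    ultimately show ?thesis by simp
  qed
  have mem: "(\<exists>n'\<in>(+) n ` (N \<inter> E). - n' + h \<in> E) \<longleftrightarrow> - n + h \<in> E" if "n \<in> N" for n h
  proof
    assume "\<exists>n'\<in>(+) n ` (N \<inter> E). - n' + h \<in> E"
    then obtain e where e: "e \<in> E" "- (n + e) + h \<in> E" by auto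
    then have "e + (- (n + e) + h) \<in> E" by (rule is_subgroupD(2)[OF E(2)])
    then show "- n + h \<in> E"
      by (simp add: minus_add diff_conv_add_uminus add.assoc del: add_uminus_conv_diff)
  next
    assume h: "- n + h \<in> E"
    have "0 \<in> N" using NE[OF that that] by simp
    with h show "\<exists>n'\<in>(+) n ` (N \<inter> E). - n' + h \<in> E"
      by (intro bexI[of _ n] image_eqI[of _ _ 0]) (auto simp: is_subgroupD[OF E(2)])
  qed
  have Z: "Z A c \<in> sets borel \<and> emeasure \<mu> (Z A c) = emeasure \<mu> (Y A)"
    if c: "c \<in> \<C>" and A[measurable]: "A \<in> sets borel" for A c
  proof -
    obtain n where n: "n \<in> N" "c = (+) n ` (N \<inter> E)" using c by (auto simp: \<C>_def)
    \<comment> \<open>Translation by \<open>s\<close> leaves \<open>p\<close> unchanged and shifts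
      \<open>q\<close> by \<open>n\<close>, so it carries \<open>Y A\<close> onto the piece of the
      coset \<open>c\<close>.\<close>
    then obtain s where sR: "s \<in> R" "p s = 0" "q s = n" by (auto simp: N)
    have Zc: "Z A c = {r \<in> R. p r \<in> A \<and> - n + q r \<in> E}"
      unfolding Z_def n(2) mem[OF n(1)] ..
    have "Z A c = (+) s ` Y A"
    proof (intro equalityI subsetI)
      fix r assume "r \<in> Z A c"
      then show "r \<in> (+) s ` Y A"
        using sR Rs by (intro image_eqI[of _ _ "- s + r"])
          (auto simp: Zc Y_def p q p0 q0 is_subgroupD add.assoc[symmetric])
    next
      fix r assume "r \<in> (+) s ` Y A"
      then show "r \<in> Z A c"
        using sR Rs by (auto simp: Zc Y_def p q p0 q0 is_subgroupD add.assoc[symmetric])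
    qed
    then have "emeasure \<mu> (Z A c) = emeasure \<mu> (Y A)"
      using left_invariant_emeasure_image[OF inv s sR(1) is_subgroupD(3)[OF Rs sR(1)] Yb[OF A]]
      by simp
    moreover have "Z A c \<in> sets borel" unfolding Zc by measurable
    ultimately show ?thesis by simp
  qed
  have disj: "Z A c \<inter> Z A c' = {}" if c: "c \<in> \<C>" "c' \<in> \<C>" "c \<noteq> c'" for A c c'
  proof (rule ccontr)
    assume "Z A c \<inter> Z A c' \<noteq> {}"
    then obtain r where r: "r \<in> Z A c" "r \<in> Z A c'" by auto
    obtain n n' where n: "n \<in> N" "c = (+) n ` (N \<inter> E)" "n' \<in> N" "c' = (+) n' ` (N \<inter> E)"
      using c by (auto simp: \<C>_def)
    have e: "- n + q r \<in> E" "- n' + q r \<in> E"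
      using r mem[OF n(1)] mem[OF n(3)] by (auto simp: Z_def n)
    have sub: "(+) m ` (N \<inter> E) \<subseteq> (+) m' ` (N \<inter> E)"
      if m: "m \<in> N" "m' \<in> N" and e: "- m + q r \<in> E" "- m' + q r \<in> E" for m m'
    proof
      fix x assume "x \<in> (+) m ` (N \<inter> E)"
      then obtain y where y: "y \<in> N" "y \<in> E" "x = m + y" by auto
      have "(- m' + q r) - (- m + q r) \<in> E" using e by (intro is_subgroup_minus[OF E(2)])
      moreover have "(- m' + q r) - (- m + q r) = - m' + m"
        by (simp add: diff_conv_add_uminus minus_add add.assoc del: add_uminus_conv_diff)
      ultimately have "- m' + m + y \<in> E" using y by (metis is_subgroupD(2)[OF E(2)])
      moreover have "- m' + m + y \<in> N"
        using NE[OF NE[OF m(1) m(2)] y(1)] by (simp add: minus_add)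
      ultimately show "x \<in> (+) m' ` (N \<inter> E)"
        using y by (intro image_eqI[of _ _ "- m' + m + y"]) (auto simp: add.assoc[symmetric])
    qed
    show False using sub[OF n(1,3) e] sub[OF n(3,1) e(2,1)] c(3) n by auto
  qed
  have sum: "emeasure \<mu> (\<Union>c\<in>F. Z A c) = of_nat (card F) * emeasure \<mu> (Y A)"
    if F: "finite F" "F \<subseteq> \<C>" and A: "A \<in> sets borel" for F A
  proof -
    have "disjoint_family_on (Z A) F"
      using F(2) disj unfolding disjoint_family_on_def by blast
    moreover have "Z A ` F \<subseteq> sets \<mu>" using F(2) Z[OF _ A] by (auto simp: s)
    ultimately have "emeasure \<mu> (\<Union>c\<in>F. Z A c) = (\<Sum>c\<in>F. emeasure \<mu> (Z A c))"
      using F(1) by (intro sum_emeasure[symmetric])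
    also have "\<dots> = (\<Sum>c\<in>F. emeasure \<mu> (Y A))"
      using F Z[OF _ A] by (intro sum.cong) auto
    finally show ?thesis by simp
  qed
  \<comment> \<open>Any \<open>k\<close> cosets give \<open>k\<close> disjoint translates of
    \<open>Y A0\<close> inside the preimage of \<open>A0\<close>, all of the same positive mass,
    while the preimage has finite mass.\<close>
  have fin: "finite \<C>"
  proof (rule ccontr)
    assume inf: "infinite \<C>"
    have "of_nat k * emeasure \<mu> (Y A0) \<le> emeasure \<mu> (p -` A0)" for k
    proof -
      obtain F where F: "F \<subseteq> \<C>" "finite F" "card F = k"
        using infinite_arbitrarily_large[OF inf] by metis
      have "of_nat k * emeasure \<mu> (Y A0) = emeasure \<mu> (\<Union>c\<in>F. Z A0 c)"
        using sum[OF F(2,1) A0(1)] F by simp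
      also have "\<dots> \<le> emeasure \<mu> (p -` A0)"
        using measurable_sets[OF p(2) A0(1)] by (intro emeasure_mono) (auto simp: Z_def s)
      finally show ?thesis .
    qed
    from ennreal_eq_0_of_multiples_le[OF this A0(2)] A0(3) show False
      by (simp add: Yeq[OF A0(1)])
  qed
  have "0 \<in> N" unfolding N using p0 q0 is_subgroupD(1)[OF Rs] by (intro image_eqI[of _ _ 0]) auto
  then have "\<C> \<noteq> {}" by (auto simp: \<C>_def)
  with fin show "0 < subgroup_index N (N \<inter> E)" by (simp add: index card_gt_0_iff)
  assume A: "A \<in> sets borel"
  have "{r \<in> R. p r \<in> A \<and> p r \<in> p ` (R \<inter> q -` E)} = (\<Union>c\<in>\<C>. Z A c)"
  proof (intro equalityI subsetI)
    fix r assume "r \<in> {r \<in> R. p r \<in> A \<and> p r \<in> p ` (R \<inter> q -` E)}"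
    then obtain r0 where r: "r \<in> R" "p r \<in> A" "r0 \<in> R" "q r0 \<in> E" "p r0 = p r" by auto
    \<comment> \<open>Two points with the same value of \<open>p\<close> differ by a left factor in
      the kernel of \<open>p\<close>; the value of \<open>q\<close> at this factor names the coset
      whose piece contains \<open>r\<close>.\<close>
    have "r - r0 \<in> R" using r by (intro is_subgroup_minus[OF Rs])
    moreover have "p (r - r0) = 0" using r p(1)[of r "- r0"] p0 by simp
    ultimately have n: "q (r - r0) \<in> N" unfolding N by auto
    moreover have "- q (r - r0) + q r = q r0"
      using q(1)[of r "- r0"] q0 by (simp add: minus_add add.assoc diff_conv_add_uminus del: add_uminus_conv_diff)
    ultimately show "r \<in> (\<Union>c\<in>\<C>. Z A c)"
      using r mem[OF n, of "q r"] by (auto simp: \<C>_def Z_def)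
  next
    fix r assume "r \<in> (\<Union>c\<in>\<C>. Z A c)"
    then obtain n where n: "n \<in> N" "r \<in> R" "p r \<in> A" "- n + q r \<in> E"
      using mem by (auto simp: \<C>_def Z_def)
    then obtain t where t: "t \<in> R" "p t = 0" "q t = n" by (auto simp: N)
    have "- t + r \<in> R" "p (- t + r) = p r" "q (- t + r) \<in> E"
      using n t Rs by (auto simp: p q p0 q0 is_subgroupD)
    then have "p r \<in> p ` (R \<inter> q -` E)" by (intro image_eqI[of _ _ "- t + r"]) auto
    then show "r \<in> {r \<in> R. p r \<in> A \<and> p r \<in> p ` (R \<inter> q -` E)}" using n by simp
  qed
  then show "emeasure \<mu> {r \<in> R. p r \<in> A \<and> p r \<in> p ` (R \<inter> q -` E)} =
      of_nat (subgroup_index N (N \<inter> E)) * emeasure \<mu> (p -` A \<inter> q -` E)"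
    using sum[OF fin order_refl A] by (simp add: index Yeq[OF A])
qed

section \<open>Borel sections\<close>

text \<open>
  The section picks a point in the intersection of a decreasing sequence of nonempty compact
  subsets of the fibre, the \<open>n\<close>-th step intersecting with \<open>K n\<close> whenever possible. The closed
  sets \<open>K n\<close> are the complements of a countable base, so which of them contain the chosen
  point decides its measurability.
\<close>

primrec refine_fibre :: "('g \<times> 'h) set \<Rightarrow> (nat \<Rightarrow> 'h set) \<Rightarrow> nat \<Rightarrow> 'g \<Rightarrow> 'h set" where
  "refine_fibre C K 0 x = {y. (x, y) \<in> C}"
| "refine_fibre C K (Suc n) x =
     (if refine_fibre C K n x \<inter> K n = {} then refine_fibre C K n x else refine_fibre C K n x \<inter> K n)"

lemma compact_borel_section:
  fixes C :: "('g::t2_space \<times> 'h::{t2_space, second_countable_topology}) set"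
  assumes C: "compact C"
  obtains s where "s \<in> borel_measurable borel" "\<And>x. x \<in> fst ` C \<Longrightarrow> (x, s x) \<in> C"
proof -
  obtain B :: "'h set set" where B: "countable B" "topological_basis B"
    using ex_countable_basis by auto
  \<comment> \<open>The empty set guarantees a nonempty family for \<open>from_nat_into\<close>; its
    complement is the whole space, so the corresponding refinement changes nothing.\<close>
  define U where "U = from_nat_into (insert {} B)"
  have U: "range U = insert {} B"
    unfolding U_def using B(1) by (intro range_from_nat_into) auto
  have Uo: "open (U n)" for n
    using U topological_basis_open[OF B(2)] by (metis insertE open_empty rangeI)
  define K where "K n = - U n" for n
  have K: "closed (K n)" for n using Uo[of n] by (simp add: K_def closed_def)
  define F where "F = refine_fibre C K"
  have F: "F 0 x = {y. (x, y) \<in> C}"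
    "F (Suc n) x = (if F n x \<inter> K n = {} then F n x else F n x \<inter> K n)" for n x
    by (simp_all add: F_def)
  have cF: "compact (F n x)" for n x
  proof (induction n)
    case 0
    have "F 0 x = snd ` (C \<inter> ({x} \<times> UNIV))" by (force simp: F)
    moreover have "closed ({x} \<times> (UNIV :: 'h set))" by (intro closed_Times) auto
    ultimately show ?case
      using C by (simp only:) (intro compact_continuous_image compact_Int_closed continuous_intros)
  next
    case (Suc n)
    then show ?case using K by (auto simp: F intro: compact_Int_closed)
  qed
  have ne: "F n x \<noteq> {}" if "x \<in> fst ` C" for n x
    using that by (induction n) (force simp: F(1), simp add: F(2))
  have dec: "F n x \<subseteq> F m x" if "m \<le> n" for m n x
    using that by (induction rule: dec_induct) (auto simp: F split: if_splits)
  \<comment> \<open>The induction runs over all closed \<open>L\<close> at once, because the step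
    from \<open>n\<close> asks about \<open>K n \<inter> L\<close>. At the start the set is the
    projection of a compact set.\<close>
  have meas: "{x. F n x \<inter> L \<noteq> {}} \<in> sets borel" if "closed L" for n L
    using that
  proof (induction n arbitrary: L)
    case 0
    have "{x. F 0 x \<inter> L \<noteq> {}} = fst ` (C \<inter> (UNIV \<times> L))" by (force simp: F)
    moreover have "compact (fst ` (C \<inter> (UNIV \<times> L)))"
      using C 0 by (intro compact_continuous_image compact_Int_closed continuous_intros closed_Times) auto
    ultimately show ?case by (simp only: borel_compact)
  next
    case (Suc n)
    let ?E = "{x. F n x \<inter> K n \<noteq> {}}"
    have "{x. F (Suc n) x \<inter> L \<noteq> {}} =
        (?E \<inter> {x. F n x \<inter> (K n \<inter> L) \<noteq> {}}) \<union> ((UNIV - ?E) \<inter> {x. F n x \<inter> L \<noteq> {}})"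
      by (auto simp: F)
    moreover have "?E \<in> sets borel" "{x. F n x \<inter> (K n \<inter> L) \<noteq> {}} \<in> sets borel"
      "{x. F n x \<inter> L \<noteq> {}} \<in> sets borel"
      using Suc.IH[of "K n"] Suc.IH[of "K n \<inter> L"] Suc K by (auto simp: closed_Int)
    ultimately show ?case by (simp only:) (intro sets.Un sets.Int borel_comp[unfolded Compl_eq_Diff_UNIV])
  qed
  have "\<exists>y. \<forall>n. y \<in> F n x" if x: "x \<in> fst ` C" for x
  proof -
    have "F 0 x \<inter> (\<Inter>n\<in>UNIV. F n x) \<noteq> {}"
    proof (rule compact_imp_fip_image[OF cF])
      show "closed (F n x)" for n by (rule compact_imp_closed[OF cF])
      fix I :: "nat set" assume I: "finite I"
      have "F (Max (insert 0 I)) x \<subseteq> F 0 x \<inter> (\<Inter>n\<in>I. F n x)"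
        using I by (intro Int_greatest INF_greatest dec Max_ge) auto
      then show "F 0 x \<inter> (\<Inter>n\<in>I. F n x) \<noteq> {}" using ne[OF x] by blast
    qed
    then show ?thesis by auto
  qed
  then obtain t where t: "\<And>x n. x \<in> fst ` C \<Longrightarrow> t x \<in> F n x" by metis
  \<comment> \<open>Off the projection of \<open>C\<close> the section is constant, so only the
    choice \<open>t\<close> has to be examined for measurability.\<close>
  define s where "s x = (if x \<in> fst ` C then t x else undefined)" for x
  have fC: "fst ` C \<in> sets borel"
    using C by (intro borel_compact compact_continuous_image continuous_intros)
  \<comment> \<open>A possible refinement forces \<open>t x\<close> into \<open>K n\<close>; an
    impossible one means that \<open>F n x\<close>, which contains \<open>t x\<close>, misses
    \<open>K n\<close>.\<close>
  have tK: "t x \<in> K n \<longleftrightarrow> F n x \<inter> K n \<noteq> {}" if "x \<in> fst ` C" for x n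
    using t[OF that, of n] t[OF that, of "Suc n"] by (auto simp: F split: if_splits)
  have sU: "s -` U n \<in> sets borel" for n
  proof -
    have "s -` U n = (fst ` C - {x. F n x \<inter> K n \<noteq> {}}) \<union>
        (if undefined \<in> U n then UNIV - fst ` C else {})"
    proof (rule set_eqI)
      fix x
      have "t x \<in> U n \<longleftrightarrow> F n x \<inter> K n = {}" if "x \<in> fst ` C"
        using tK[OF that, of n] by (auto simp: K_def)
      then show "x \<in> s -` U n \<longleftrightarrow> x \<in> (fst ` C - {x. F n x \<inter> K n \<noteq> {}}) \<union>
          (if undefined \<in> U n then UNIV - fst ` C else {})"
        by (cases "x \<in> fst ` C") (simp_all add: s_def)
    qed
    then show ?thesis
      using fC meas[OF K[of n], of n] by (auto intro!: sets.Un sets.Diff borel_comp[unfolded Compl_eq_Diff_UNIV])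
  qed
  have "s \<in> borel_measurable borel"
  proof (rule borel_measurableI)
    fix S :: "'h set" assume "open S"
    then obtain B' where B': "B' \<subseteq> B" "S = \<Union>B'"
      using B(2) by (metis topological_basis_def)
    have "s -` b \<in> sets borel" if "b \<in> B'" for b
    proof -
      have "b \<in> range U" using that B' U by auto
      then show ?thesis using sU by auto
    qed
    moreover have "s -` S = (\<Union>b\<in>B'. s -` b)" using B' by auto
    ultimately show "s -` S \<inter> space borel \<in> sets borel"
      using countable_subset[OF B'(1) B(1)] by (auto intro!: sets.countable_UN')
  qed
  moreover have "(x, s x) \<in> C" if "x \<in> fst ` C" for x
    using t[OF that, of 0] that by (simp add: s_def F)
  ultimately show ?thesis using that by blast
qed

text \<open>Each point uses the section of the first compact piece whose projection contains it.
  Projections of compact pieces are compact, so this first index depends measurably on the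
  point.\<close>

lemma sigma_compact_borel_section:
  fixes R :: "('g::t2_space \<times> 'h::{t2_space, second_countable_topology}) set"
  assumes R: "sigma_compact R"
  obtains s where "s \<in> borel_measurable borel" "\<And>x. x \<in> fst ` R \<Longrightarrow> (x, s x) \<in> R"
proof -
  obtain \<C> where \<C>: "countable \<C>" "\<forall>C\<in>\<C>. compact C" "\<Union>\<C> = R"
    using R by (auto simp: sigma_compact_def)
  define C where "C = from_nat_into (insert {} \<C>)"
  have rC: "range C = insert {} \<C>"
    unfolding C_def using \<C>(1) by (intro range_from_nat_into) auto
  have C: "compact (C n)" for n
    using rC \<C>(2) by (metis compact_empty insertE rangeI)
  have "\<exists>s. s \<in> borel_measurable borel \<and> (\<forall>x\<in>fst ` C n. (x, s x) \<in> C n)" for n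
    using compact_borel_section[OF C[of n]] by metis
  then obtain s where s: "\<And>n. s n \<in> borel_measurable borel" "\<And>n x. x \<in> fst ` C n \<Longrightarrow> (x, s n x) \<in> C n"
    by metis
  have [measurable]: "fst ` C n \<in> sets borel" for n
    using C by (intro borel_compact compact_continuous_image continuous_intros)
  define i where "i x = (LEAST n. x \<in> fst ` C n)" for x
  have "(\<lambda>x. s (i x) x) \<in> borel_measurable borel"
  proof (rule measurable_compose_countable[OF s(1)])
    show "i \<in> measurable borel (count_space UNIV)" unfolding i_def by measurable
  qed
  moreover have "(x, s (i x) x) \<in> R" if "x \<in> fst ` R" for x
  proof -
    have "\<Union>(range C) = R" using rC \<C>(3) by auto
    then have "\<exists>n. x \<in> fst ` C n" using that by blast
    then have "x \<in> fst ` C (i x)" unfolding i_def by (rule LeastI_ex)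
    then show ?thesis using s(2) \<open>\<Union>(range C) = R\<close> by blast
  qed
  ultimately show ?thesis by (rule that)
qed

section \<open>Conditional measures of a Haar measure\<close>

lemma sets_borel_pair:
  fixes \<gamma> :: "'g::second_countable_topology measure" and \<eta> :: "'h::second_countable_topology measure"
  assumes "sets \<gamma> = sets borel" "sets \<eta> = sets borel"
  shows "sets (\<gamma> \<Otimes>\<^sub>M \<eta>) = sets borel"
  using sets_pair_measure_cong[OF assms] unfolding borel_prod .

lemma borel_Times2:
  fixes A :: "'a::second_countable_topology set" and B :: "'b::second_countable_topology set"
  assumes "A \<in> sets borel" "B \<in> sets borel"
  shows "A \<times> B \<in> sets borel"
  using pair_measureI[OF assms] unfolding borel_prod .

lemma borel_measurable_fst_snd [measurable]:
  "fst \<in> borel_measurable (borel :: ('a::second_countable_topology \<times> 'b::second_countable_topology) measure)"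
  "snd \<in> borel_measurable (borel :: ('a::second_countable_topology \<times> 'b::second_countable_topology) measure)"
  by (intro borel_measurable_continuous_onI continuous_intros)+

lemma vimage_fst_snd_borel:
  fixes A :: "'a::second_countable_topology set" and B :: "'b::second_countable_topology set"
  shows "A \<in> sets borel \<Longrightarrow> fst -` A \<in> sets (borel :: ('a \<times> 'b) measure)"
    "B \<in> sets borel \<Longrightarrow> snd -` B \<in> sets (borel :: ('a \<times> 'b) measure)"
  by (erule measurable_sets_borel[OF borel_measurable_fst_snd(1)],
      erule measurable_sets_borel[OF borel_measurable_fst_snd(2)])

text \<open>
  The shear \<open>(g, h) \<mapsto> (g, h - s g)\<close> along a Borel section \<open>s\<close> maps \<open>\<mu>\<close> to a measure invariant
  under translations of the second coordinate by \<open>N = polyhom_indef R\<close>. By uniqueness of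
  invariant measures on \<open>N\<close> this is a product measure, and its second factor, translated back by
  \<open>s x\<close>, is the conditional measure at \<open>x\<close>.
\<close>

lemma extended_haar_conditional_measures:
  fixes \<mu> :: "('g::{topological_group_add, t2_space, second_countable_topology} \<times>
      'h::{topological_group_add, t2_space, second_countable_topology}) measure"
  assumes R: "sigma_compact R" "closed R" "extended_haar R \<mu>"
    and \<gamma>: "unimodular_haar_measure \<gamma>" "sigma_compact (UNIV :: 'g set)"
    and \<eta>: "sets \<eta> = sets borel"
    and dom: "\<And>A. A \<in> sets borel \<Longrightarrow> emeasure \<mu> (fst -` A) \<le> emeasure \<gamma> A"
  obtains m where "conditional_measures \<gamma> \<eta> \<mu> m"
proof -
  define D where "D = fst ` R"
  have Rs: "R \<in> sets borel" "is_subgroup R" and s\<mu>: "sets \<mu> = sets borel"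
    and inv: "left_invariant R \<mu>" and ae: "AE x in \<mu>. x \<in> R"
    using R(3) by (auto simp: extended_haar_def)
  note \<gamma>D = unimodular_haar_measureD[OF \<gamma>(1)]
  note [measurable_cong] = s\<mu> \<gamma>D(1) \<eta>
  have sp: "space \<mu> = UNIV" "space \<gamma> = UNIV"
    using sets_eq_imp_space_eq[OF s\<mu>] sets_eq_imp_space_eq[OF \<gamma>D(1)] by auto
  have "sigma_compact D"
    unfolding D_def by (intro sigma_compact_image R continuous_intros)
  then have D[measurable]: "D \<in> sets borel" by (rule sigma_compact_borel)
  obtain a C where a: "0 < a" "\<And>A. A \<in> sets borel \<Longrightarrow>
      emeasure \<mu> (fst -` A) = ennreal a * emeasure \<gamma> (A \<inter> D)"
    and C: "compact C" "C \<subseteq> D" "emeasure \<gamma> C \<noteq> 0"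
    unfolding D_def
    by (rule projection_scaling[of fst, OF _ _ R(1,3) \<gamma> dom]) (auto intro: continuous_intros)
  have [measurable]: "C \<in> sets borel" by (rule borel_compact[OF C(1)])
  have Cfin: "emeasure \<gamma> C \<noteq> \<infinity>" using \<gamma>D(3)[OF C(1)] by simp
  have \<mu>C: "emeasure \<mu> (fst -` C) = ennreal a * emeasure \<gamma> C"
    using a(2)[of C] C(2) by (simp add: Int_absorb2)
  obtain s where [measurable]: "s \<in> borel_measurable borel" and s: "\<And>x. x \<in> D \<Longrightarrow> (x, s x) \<in> R"
    using sigma_compact_borel_section[OF R(1)] unfolding D_def by metis
  define N where "N = {n :: 'h. (0, n) \<in> R}"
  have N: "is_subgroup N"
    using Rs(2) unfolding is_subgroup_def N_def by (fastforce simp: zero_prod_def)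
  have "N = (\<lambda>n. (0, n)) -` R" by (auto simp: N_def)
  then have "closed N" using R(2) by (simp only:) (intro closed_vimage continuous_intros)
  then have [measurable]: "N \<in> sets borel" by (rule borel_closed)
  \<comment> \<open>Subtracting on the right makes \<open>f\<close> equivariant: left translation of
    \<open>z\<close> by \<open>(0, n)\<close> adds \<open>n\<close> on the left of
    \<open>f z\<close>.\<close>
  define f where "f z = snd z - s (fst z)" for z
  have [measurable]: "f \<in> borel_measurable borel"
    unfolding f_def diff_conv_add_uminus by measurable
  define \<nu> where "\<nu> A = distr (density \<mu> (indicator (fst -` A))) borel f" for A
  note [measurable] = vimage_fst_snd_borel
  have vf[measurable]: "f -` B \<in> sets borel" if "B \<in> sets borel" for B
    by (rule measurable_sets_borel[OF _ that]) measurable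
  have \<nu>: "emeasure (\<nu> A) B = emeasure \<mu> (fst -` A \<inter> f -` B)"
    if [measurable]: "A \<in> sets borel" "B \<in> sets borel" for A B
    unfolding \<nu>_def by (subst emeasure_distr, simp, simp, subst emeasure_restricted)
      (auto simp: sp s\<mu> vf)
  have sets\<nu>: "sets (\<nu> A) = sets borel" for A by (simp add: \<nu>_def)
  have sp\<nu>: "space (\<nu> A) = UNIV" for A using sets_eq_imp_space_eq[OF sets\<nu>] by simp
  have \<nu>UNIV: "emeasure (\<nu> A) UNIV = ennreal a * emeasure \<gamma> (A \<inter> D)" if "A \<in> sets borel" for A
    using that by (simp add: \<nu> a(2))
  have fin\<nu>: "finite_measure (\<nu> A)" if "A \<in> sets borel" "emeasure \<gamma> A \<noteq> \<infinity>" for A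
  proof
    have "emeasure (\<nu> A) UNIV \<le> emeasure \<gamma> A" using that dom[of A] by (simp add: \<nu>)
    then show "emeasure (\<nu> A) (space (\<nu> A)) \<noteq> \<infinity>" using that(2) by (auto simp: sp\<nu> top_unique)
  qed
  have ae\<nu>: "AE y in \<nu> A. y \<in> N" if [measurable]: "A \<in> sets borel" for A
  proof -
    have "f z \<in> N" if "z \<in> R" for z
    proof -
      have "(fst z, s (fst z)) \<in> R" using that by (intro s) (auto simp: D_def)
      then have "z - (fst z, s (fst z)) \<in> R" using that by (intro is_subgroup_minus[OF Rs(2)])
      then show ?thesis by (cases z) (simp add: N_def f_def)
    qed
    then have "AE z in \<mu>. f z \<in> N" using ae by auto
    then have "AE z in density \<mu> (indicator (fst -` A)). f z \<in> N"
      by (subst AE_density) auto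
    then show ?thesis unfolding \<nu>_def by (subst AE_distr_iff) auto
  qed
  have inv\<nu>: "left_invariant N (\<nu> A)" if A[measurable]: "A \<in> sets borel" for A
    unfolding left_invariant_def
  proof (intro ballI measure_eqI)
    fix n B assume n: "n \<in> N" and "B \<in> sets (distr (\<nu> A) borel ((+) n))"
    then have B[measurable]: "B \<in> sets borel" by simp
    have nR: "(0, n) \<in> R" using n by (simp add: N_def)
    let ?E = "fst -` A \<inter> f -` B :: ('g \<times> 'h) set"
    have E: "?E \<in> sets borel" by measurable
    have "emeasure (distr (\<nu> A) borel ((+) n)) B = emeasure (\<nu> A) ((+) n -` B)"
      by (subst emeasure_distr) (auto simp: sp\<nu> measurable_cong_sets[OF sets\<nu> refl])
    also have "\<dots> = emeasure \<mu> (fst -` A \<inter> f -` (+) n -` B)" by (rule \<nu>) measurable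
    also have "fst -` A \<inter> f -` (+) n -` B = (+) (0, n) -` ?E"
      by (auto simp: f_def diff_conv_add_uminus add.assoc simp del: add_uminus_conv_diff)
    also have "emeasure \<mu> \<dots> = emeasure (distr \<mu> borel ((+) (0, n))) ?E"
      using E by (subst emeasure_distr) (auto simp: sp)
    also have "\<dots> = emeasure (\<nu> A) B"
      using inv nR by (simp add: left_invariant_def \<nu>)
    finally show "emeasure (distr (\<nu> A) borel ((+) n)) B = emeasure (\<nu> A) B" .
  qed (simp add: sets\<nu>)
  \<comment> \<open>The common fibre measure, normalized by the base set \<open>C\<close>; its total
    mass is the scaling constant \<open>a\<close> of the projection.\<close>
  define \<theta> where "\<theta> = scale_measure (1 / emeasure \<gamma> C) (\<nu> C)"
  have s\<theta>[measurable_cong]: "sets \<theta> = sets borel" by (simp add: \<theta>_def sets\<nu>)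
  have sp\<theta>: "space \<theta> = UNIV" using sets_eq_imp_space_eq[OF s\<theta>] by simp
  have prod: "emeasure (\<nu> A) B = emeasure \<gamma> (A \<inter> D) * emeasure \<theta> B"
    if A[measurable]: "A \<in> sets borel" and Af: "emeasure \<gamma> A \<noteq> \<infinity>" and B: "B \<in> sets borel" for A B
  proof -
    have N1: "emeasure (\<nu> A') N = ennreal a * emeasure \<gamma> (A' \<inter> D)" if "A' \<in> sets borel" for A'
    proof -
      have "emeasure (\<nu> A') (UNIV \<inter> N) = emeasure (\<nu> A') UNIV"
        by (intro emeasure_AE_Int ae\<nu> that) (auto simp: sets\<nu>)
      then show ?thesis using \<nu>UNIV[OF that] by simp
    qed
    have CD: "C \<inter> D = C" using C(2) by auto
    have Ntr: "{y. y + x \<in> N} = N" if x: "x \<in> N" for x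
    proof -
      have "y \<in> N" if "y + x \<in> N" for y
        using is_subgroup_minus[OF N that x] by simp
      moreover have "y + x \<in> N" if "y \<in> N" for y
        by (rule is_subgroupD(2)[OF N that x])
      ultimately show ?thesis by blast
    qed
    \<comment> \<open>\<open>N\<close> itself is the test set for uniqueness: right translation by
      its own elements preserves it, and \<open>\<nu> C\<close> gives it finite positive
      mass.\<close>
    have "emeasure (\<nu> A) N * emeasure (\<nu> C) B = emeasure (\<nu> C) N * emeasure (\<nu> A) B"
    proof (rule left_invariant_unique[OF sets\<nu> sets\<nu> _ _ N ae\<nu>[OF A] ae\<nu> inv\<nu>[OF A] inv\<nu>])
      show "sigma_finite_measure (\<nu> A)" "sigma_finite_measure (\<nu> C)"
        using fin\<nu>[OF A Af] fin\<nu>[of C] Cfin by (auto simp: finite_measure_def)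
      fix x assume "x \<in> N"
      then show "emeasure (\<nu> C) {y. y + x \<in> N} \<noteq> 0" "emeasure (\<nu> C) {y. y + x \<in> N} \<noteq> \<infinity>"
        using a(1) C(3) Cfin by (auto simp: Ntr N1 CD ennreal_mult_eq_top_iff)
    qed (use B in auto)
    then have "ennreal a * (emeasure \<gamma> (A \<inter> D) * emeasure (\<nu> C) B) =
        ennreal a * (emeasure \<gamma> C * emeasure (\<nu> A) B)"
      by (simp add: N1 CD mult.assoc)
    then have eq: "emeasure \<gamma> (A \<inter> D) * emeasure (\<nu> C) B = emeasure \<gamma> C * emeasure (\<nu> A) B"
      using a(1) by (simp add: ennreal_mult_cancel_left)
    have "emeasure \<gamma> (A \<inter> D) * emeasure \<theta> B =
        (emeasure \<gamma> (A \<inter> D) * emeasure (\<nu> C) B) / emeasure \<gamma> C"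
      by (simp add: \<theta>_def divide_ennreal_def mult_ac)
    also have "\<dots> = emeasure (\<nu> A) B"
      unfolding eq mult.commute[of "emeasure \<gamma> C"] using C(3) Cfin
      by (simp add: ennreal_mult_divide_eq)
    finally show ?thesis ..
  qed
  have sub\<theta>: "subprob_space \<theta>"
  proof
    have "emeasure (\<nu> C) UNIV \<le> emeasure \<gamma> C" using dom[of C] by (simp add: \<nu>)
    then have "emeasure \<theta> UNIV \<le> emeasure \<gamma> C / emeasure \<gamma> C"
      by (simp add: \<theta>_def divide_ennreal_def mult.commute[of "emeasure \<gamma> C"] mult_left_mono)
    then show "emeasure \<theta> (space \<theta>) \<le> 1"
      using C(3) Cfin by (simp add: sp\<theta> top.not_eq_extremum)
  qed (simp add: sp\<theta>)
  define m where "m x = (if x \<in> D then distr \<theta> \<eta> (\<lambda>n. n + s x) else null_measure \<eta>)" for x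
  have "conditional_measures \<gamma> \<eta> \<mu> m"
    unfolding conditional_measures_def
  proof (intro conjI ballI impI)
    have sp\<eta>: "space \<eta> = UNIV" using sets_eq_imp_space_eq[OF \<eta>] by simp
    have "(\<lambda>x. distr \<theta> \<eta> (\<lambda>n. n + s x)) \<in> measurable \<gamma> (subprob_algebra \<eta>)"
    proof (rule measurable_distr2)
      show "(\<lambda>_. \<theta>) \<in> \<gamma> \<rightarrow>\<^sub>M subprob_algebra \<theta>"
        using sub\<theta> by (intro measurable_const) (simp add: space_subprob_algebra)
    qed measurable
    then show "m \<in> \<gamma> \<rightarrow>\<^sub>M subprob_algebra \<eta>"
      unfolding m_def by (intro measurable_If_set measurable_const) (auto simp: sp\<eta> sp)
    fix A B assume "A \<in> sets \<gamma>" "B \<in> sets \<eta>"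
    then have A[measurable]: "A \<in> sets borel" and B[measurable]: "B \<in> sets borel"
      by (auto simp: \<gamma>D(1) \<eta>)
    assume "emeasure \<gamma> A < \<infinity>"
    then have Af: "emeasure \<gamma> A \<noteq> \<infinity>" by simp
    let ?\<gamma>A = "density \<gamma> (indicator (A \<inter> D))"
    let ?\<Phi> = "\<lambda>z. (fst z, f z)"
    let ?\<mu>A = "density \<mu> (indicator (fst -` A))"
    have \<gamma>A: "emeasure ?\<gamma>A A' = emeasure \<gamma> ((A' \<inter> A) \<inter> D)" if "A' \<in> sets borel" for A'
      using that by (subst emeasure_restricted) (auto simp: \<gamma>D(1) intro!: arg_cong[where f="emeasure \<gamma>"])
    interpret L: subprob_space \<theta> by (rule sub\<theta>)
    \<comment> \<open>An identity of measures, not merely of rectangle masses, is needed: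
      translating back by the section turns \<open>B\<close> into the set \<open>?X\<close>, which
      is not a rectangle.\<close>
    have "?\<gamma>A \<Otimes>\<^sub>M \<theta> = distr ?\<mu>A (borel \<Otimes>\<^sub>M borel) ?\<Phi>"
    proof (rule pair_measure_eqI)
      have "finite_measure ?\<gamma>A"
      proof
        have "emeasure ?\<gamma>A UNIV \<le> emeasure \<gamma> A"
          using A by (simp add: \<gamma>A) (intro emeasure_mono, auto simp: \<gamma>D(1))
        then show "emeasure ?\<gamma>A (space ?\<gamma>A) \<noteq> \<infinity>" using Af by (auto simp: sp top_unique)
      qed
      then show "sigma_finite_measure ?\<gamma>A" by (simp add: finite_measure_def)
      show "sigma_finite_measure \<theta>" by (rule L.sigma_finite_measure_axioms)
      show "sets (?\<gamma>A \<Otimes>\<^sub>M \<theta>) = sets (distr ?\<mu>A (borel \<Otimes>\<^sub>M borel) ?\<Phi>)"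
        by (simp add: \<gamma>D(1) s\<theta> cong: sets_pair_measure_cong)
      fix A' B' assume "A' \<in> sets ?\<gamma>A" "B' \<in> sets \<theta>"
      then have A'[measurable]: "A' \<in> sets borel" and B'[measurable]: "B' \<in> sets borel"
        by (auto simp: \<gamma>D(1) s\<theta>)
      have "emeasure \<gamma> (A' \<inter> A) \<le> emeasure \<gamma> A" by (intro emeasure_mono) (auto simp: \<gamma>D(1))
      then have AA: "emeasure \<gamma> (A' \<inter> A) \<noteq> \<infinity>" using Af by (auto simp: top_unique)
      have "emeasure (distr ?\<mu>A (borel \<Otimes>\<^sub>M borel) ?\<Phi>) (A' \<times> B') = emeasure ?\<mu>A (fst -` A' \<inter> f -` B')"
        by (subst emeasure_distr) (auto simp: sp intro!: arg_cong[where f="emeasure ?\<mu>A"])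
      also have "\<dots> = emeasure \<mu> (fst -` (A' \<inter> A) \<inter> f -` B')"
        by (subst emeasure_restricted) (auto simp: s\<mu> intro!: arg_cong[where f="emeasure \<mu>"])
      also have "\<dots> = emeasure (\<nu> (A' \<inter> A)) B'" by (subst \<nu>) auto
      also have "\<dots> = emeasure \<gamma> ((A' \<inter> A) \<inter> D) * emeasure \<theta> B'"
        by (rule prod[OF _ AA]) auto
      also have "\<dots> = emeasure ?\<gamma>A A' * emeasure \<theta> B'" by (simp add: \<gamma>A)
      finally show "emeasure ?\<gamma>A A' * emeasure \<theta> B' =
          emeasure (distr ?\<mu>A (borel \<Otimes>\<^sub>M borel) ?\<Phi>) (A' \<times> B')" ..
    qed
    note pm = this
    let ?X = "{z. snd z + s (fst z) \<in> B}"
    have "{z \<in> space (borel \<Otimes>\<^sub>M borel). snd z + s (fst z) \<in> B} \<in> sets (borel \<Otimes>\<^sub>M borel)"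
      by measurable
    then have X[measurable]: "?X \<in> sets (borel \<Otimes>\<^sub>M borel)" by (simp add: space_pair_measure)
    have "emeasure \<mu> (A \<times> B) = emeasure ?\<mu>A {z. snd z \<in> B}"
    proof -
      have "{z. snd z \<in> B} \<in> sets \<mu>" by measurable
      then show ?thesis
        by (subst emeasure_restricted) (auto simp: s\<mu> intro!: arg_cong[where f="emeasure \<mu>"])
    qed
    also have "\<dots> = emeasure (distr ?\<mu>A (borel \<Otimes>\<^sub>M borel) ?\<Phi>) ?X"
    proof -
      have "?\<Phi> -` ?X = {z. snd z \<in> B}" by (auto simp: f_def)
      then show ?thesis by (subst emeasure_distr) (auto simp: sp)
    qed
    also have "\<dots> = emeasure (?\<gamma>A \<Otimes>\<^sub>M \<theta>) ?X" by (simp add: pm)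
    also have "\<dots> = (\<integral>\<^sup>+x. emeasure \<theta> (Pair x -` ?X) \<partial>?\<gamma>A)"
      using X by (intro L.emeasure_pair_measure_alt)
        (simp add: \<gamma>D(1) s\<theta> cong: sets_pair_measure_cong)
    also have "\<dots> = (\<integral>\<^sup>+x. indicator (A \<inter> D) x * emeasure \<theta> (Pair x -` ?X) \<partial>\<gamma>)"
      using X by (intro nn_integral_density L.measurable_emeasure_Pair)
        (auto simp: \<gamma>D(1) s\<theta> cong: sets_pair_measure_cong)
    also have "\<dots> = (\<integral>\<^sup>+x\<in>A. emeasure (m x) B \<partial>\<gamma>)"
    proof (intro nn_integral_cong)
      fix x
      have "emeasure (distr \<theta> \<eta> (\<lambda>n. n + s x)) B = emeasure \<theta> (Pair x -` ?X)"
        by (subst emeasure_distr) (auto simp: sp\<theta> \<eta> intro!: arg_cong[where f="emeasure \<theta>"])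
      then show "indicator (A \<inter> D) x * emeasure \<theta> (Pair x -` ?X) = emeasure (m x) B * indicator A x"
        by (auto simp: m_def split: split_indicator)
    qed
    finally show "emeasure \<mu> (A \<times> B) = (\<integral>\<^sup>+x\<in>A. emeasure (m x) B \<partial>\<gamma>)" .
  qed
  then show ?thesis by (rule that)
qed

section \<open>Composition of polymorphisms\<close>

text \<open>\<open>conditional_measures\<close> controls only rectangles whose sides have finite
  measure. These are stable under intersection, and exhausting both factors by sets of finite
  measure shows that they generate the product sigma-algebra.\<close>

lemma measure_eqI_finite_rectangles:
  assumes X: "sigma_finite_measure X" and Y: "sigma_finite_measure Y"
    and sets: "sets M = sets (X \<Otimes>\<^sub>M Y)" "sets M' = sets (X \<Otimes>\<^sub>M Y)"
    and eq: "\<And>A B. A \<in> sets X \<Longrightarrow> B \<in> sets Y \<Longrightarrow> emeasure X A < \<infinity> \<Longrightarrow> emeasure Y B < \<infinity> \<Longrightarrow>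
      emeasure M (A \<times> B) = emeasure M' (A \<times> B)"
    and fin: "\<And>A B. A \<in> sets X \<Longrightarrow> B \<in> sets Y \<Longrightarrow> emeasure X A < \<infinity> \<Longrightarrow> emeasure Y B < \<infinity> \<Longrightarrow>
      emeasure M (A \<times> B) < \<infinity>"
  shows "M = M'"
proof -
  define E where "E = {A \<times> B | A B. A \<in> sets X \<and> B \<in> sets Y \<and> emeasure X A < \<infinity> \<and> emeasure Y B < \<infinity>}"
  obtain F :: "nat \<Rightarrow> _" where F: "range F \<subseteq> sets X" "(\<Union>i. F i) = space X" "\<And>i. emeasure X (F i) \<noteq> \<infinity>"
    using sigma_finite_measure.sigma_finite[OF X] by metis
  obtain G :: "nat \<Rightarrow> _" where G: "range G \<subseteq> sets Y" "(\<Union>i. G i) = space Y" "\<And>i. emeasure Y (G i) \<noteq> \<infinity>"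
    using sigma_finite_measure.sigma_finite[OF Y] by metis
  have FX: "emeasure X (A \<inter> F i) < \<infinity>" if "A \<in> sets X" for A i
    using emeasure_mono[of "A \<inter> F i" "F i" X] F(1,3) by (auto simp: top.not_eq_extremum intro: le_less_trans)
  have GY: "emeasure Y (B \<inter> G i) < \<infinity>" if "B \<in> sets Y" for B i
    using emeasure_mono[of "B \<inter> G i" "G i" Y] G(1,3) by (auto simp: top.not_eq_extremum intro: le_less_trans)
  have ES: "sets (X \<Otimes>\<^sub>M Y) = sigma_sets (space X \<times> space Y) E"
    unfolding sets_pair_measure
  proof (rule sigma_sets_eqI)
    fix S assume "S \<in> {a \<times> b |a b. a \<in> sets X \<and> b \<in> sets Y}"
    then obtain A B where AB: "A \<in> sets X" "B \<in> sets Y" "S = A \<times> B" by auto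
    have "(A \<inter> F i) \<times> (B \<inter> G j) \<in> E" for i j
      unfolding E_def mem_Collect_eq using AB F(1) G(1) FX[OF AB(1), of i] GY[OF AB(2), of j]
      by (intro exI[of _ "A \<inter> F i"] exI[of _ "B \<inter> G j"]) auto
    then have "(\<Union>i. \<Union>j. (A \<inter> F i) \<times> (B \<inter> G j)) \<in> sigma_sets (space X \<times> space Y) E"
      by (intro sigma_sets.Union sigma_sets.Basic)
    moreover have "(\<Union>i. \<Union>j. (A \<inter> F i) \<times> (B \<inter> G j)) = S"
    proof -
      have "(\<Union>i. \<Union>j. (A \<inter> F i) \<times> (B \<inter> G j)) = (A \<inter> (\<Union>i. F i)) \<times> (B \<inter> (\<Union>j. G j))"
        by blast
      then show ?thesis using AB by (simp add: F(2) G(2))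
    qed
    ultimately show "S \<in> sigma_sets (space X \<times> space Y) E" by simp
  next
    fix S assume "S \<in> E"
    then show "S \<in> sigma_sets (space X \<times> space Y) {a \<times> b |a b. a \<in> sets X \<and> b \<in> sets Y}"
      by (auto simp: E_def intro!: sigma_sets.Basic)
  qed
  show ?thesis
  proof (rule measure_eqI_generator_eq_countable[where E=E and \<Omega>="space X \<times> space Y"
        and A="range (\<lambda>(i, j). F i \<times> G j)"])
    show "Int_stable E"
    proof (rule Int_stableI)
      fix S S' assume "S \<in> E" "S' \<in> E"
      then obtain A B A' B' where AB: "S = A \<times> B" "S' = A' \<times> B'" "A \<in> sets X" "B \<in> sets Y"
        "A' \<in> sets X" "B' \<in> sets Y" "emeasure X A < \<infinity>" "emeasure Y B < \<infinity>"
        unfolding E_def by auto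
      have "emeasure X (A \<inter> A') < \<infinity>" "emeasure Y (B \<inter> B') < \<infinity>"
        using AB emeasure_mono[of "A \<inter> A'" A X] emeasure_mono[of "B \<inter> B'" B Y]
        by (auto intro: le_less_trans)
      then show "S \<inter> S' \<in> E"
        unfolding E_def mem_Collect_eq using AB
        by (intro exI[of _ "A \<inter> A'"] exI[of _ "B \<inter> B'"]) (simp add: Times_Int_Times sets.Int)
    qed
    show "E \<subseteq> Pow (space X \<times> space Y)"
      unfolding E_def using sets.sets_into_space[of _ X] sets.sets_into_space[of _ Y] by blast
    show "emeasure M S = emeasure M' S" if "S \<in> E" for S using that eq by (auto simp: E_def)
    show "range (\<lambda>(i, j). F i \<times> G j) \<subseteq> E"
    proof (clarify)
      fix i j
      show "F i \<times> G j \<in> E"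
        unfolding E_def mem_Collect_eq using F(1,3) G(1,3)
        by (intro exI[of _ "F i"] exI[of _ "G j"]) (auto simp: top.not_eq_extremum)
    qed
    show "\<Union>(range (\<lambda>(i, j). F i \<times> G j)) = space X \<times> space Y"
      unfolding F(2)[symmetric] G(2)[symmetric] by auto
    show "emeasure M a \<noteq> \<infinity>" if aFG: "a \<in> range (\<lambda>(i, j). F i \<times> G j)" for a
    proof -
      obtain i j where a: "a = F i \<times> G j" using aFG by auto
      have "emeasure M (F i \<times> G j) < \<infinity>"
        using F(1,3) G(1,3) by (intro fin) (auto simp: top.not_eq_extremum)
      then show ?thesis by (simp add: a)
    qed
  qed (auto simp: sets ES)
qed

text \<open>Cutting along a countable partition into sets of finite measure upgrades the hypothesis
  to equality of the two densities as measures; sigma-finiteness then makes the density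
  unique.\<close>

lemma AE_eq_of_finite_set_integrals:
  assumes M: "sigma_finite_measure M" and f: "f \<in> borel_measurable M" "g \<in> borel_measurable M"
    and eq: "\<And>B. B \<in> sets M \<Longrightarrow> emeasure M B < \<infinity> \<Longrightarrow> (\<integral>\<^sup>+x\<in>B. f x \<partial>M) = (\<integral>\<^sup>+x\<in>B. g x \<partial>M)"
  shows "AE x in M. f x = (g x :: ennreal)"
proof -
  interpret sigma_finite_measure M by fact
  obtain F :: "nat \<Rightarrow> 'a set" where F: "range F \<subseteq> sets M" "(\<Union>i. F i) = space M"
    "\<And>i. emeasure M (F i) \<noteq> \<infinity>" "disjoint_family F"
    using sigma_finite_disjoint by metis
  have "density M f = density M g"
  proof (rule measure_eqI)
    fix B assume "B \<in> sets (density M f)"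
    then have B: "B \<in> sets M" by simp
    have *: "emeasure (density M h) B = (\<Sum>i. \<integral>\<^sup>+x\<in>B \<inter> F i. h x \<partial>M)"
      if h: "h \<in> borel_measurable M" for h
    proof -
      have "disjoint_family (\<lambda>i. B \<inter> F i)" using F(4) by (auto simp: disjoint_family_on_def)
      then have "emeasure (density M h) (\<Union>i. B \<inter> F i) = (\<Sum>i. emeasure (density M h) (B \<inter> F i))"
        using B F(1) by (intro suminf_emeasure[symmetric]) auto
      moreover have "(\<Union>i. B \<inter> F i) = B" using F(2) sets.sets_into_space[OF B] by auto
      moreover have "emeasure (density M h) (B \<inter> F i) = (\<integral>\<^sup>+x\<in>B \<inter> F i. h x \<partial>M)" for i
        using B F(1) h by (intro emeasure_density) auto
      ultimately show ?thesis by simp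
    qed
    have "(\<integral>\<^sup>+x\<in>B \<inter> F i. f x \<partial>M) = (\<integral>\<^sup>+x\<in>B \<inter> F i. g x \<partial>M)" for i
    proof (rule eq)
      show "B \<inter> F i \<in> sets M" using B F(1) by auto
      have "emeasure M (B \<inter> F i) \<le> emeasure M (F i)" using F(1) by (intro emeasure_mono) auto
      then show "emeasure M (B \<inter> F i) < \<infinity>" using F(3)[of i] by (auto simp: top.not_eq_extremum intro: le_less_trans)
    qed
    then show "emeasure (density M f) B = emeasure (density M g) B"
      by (simp add: *[OF f(1)] *[OF f(2)])
  qed simp
  then show ?thesis by (rule density_unique[OF f])
qed

text \<open>Conditional measures over \<open>Y\<close> are known only up to null sets of
  \<open>Y\<close>. Domination of the second projection makes such sets invisible to
  \<open>\<mu>\<close>, so a composite does not depend on the chosen version.\<close>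

lemma polymorphism_AE_snd:
  assumes "polymorphism X Y \<mu>" and P: "AE y in Y. P y"
  shows "AE p in \<mu>. P (snd p)"
proof -
  have sets: "sets \<mu> = sets (X \<Otimes>\<^sub>M Y)"
    and le: "\<And>B. B \<in> sets Y \<Longrightarrow> emeasure \<mu> (space X \<times> B) \<le> emeasure Y B"
    using assms(1) by (auto simp: polymorphism_def)
  obtain N where N: "{y \<in> space Y. \<not> P y} \<subseteq> N" "emeasure Y N = 0" "N \<in> sets Y"
    using P by (rule AE_E)
  show ?thesis
  proof (rule AE_I[of _ _ "space X \<times> N"])
    show "{p \<in> space \<mu>. \<not> P (snd p)} \<subseteq> space X \<times> N"
      using N(1) sets_eq_imp_space_eq[OF sets] by (auto simp: space_pair_measure)
    show "emeasure \<mu> (space X \<times> N) = 0" using le[OF N(3)] N(2) by simp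
  qed (use N(3) sets in auto)
qed

text \<open>The identity on rectangles says that \<open>\<mu>\<close> is the bind of
  \<open>X\<close> with the kernels that put \<open>m x\<close> on the fibre over \<open>x\<close>;
  the integral formula for bind then extends it to all nonnegative functions.\<close>

lemma nn_integral_conditional_measures:
  assumes X: "sigma_finite_measure X" and Y: "sigma_finite_measure Y"
    and \<mu>: "polymorphism X Y \<mu>" and m: "conditional_measures X Y \<mu> m"
    and \<phi>: "(\<lambda>(x, y). \<phi> x y) \<in> borel_measurable (X \<Otimes>\<^sub>M Y)"
  shows "(\<integral>\<^sup>+p. \<phi> (fst p) (snd p) \<partial>\<mu>) = (\<integral>\<^sup>+x. \<integral>\<^sup>+y. \<phi> x y \<partial>m x \<partial>X)"
proof -
  have sets: "sets \<mu> = sets (X \<Otimes>\<^sub>M Y)"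
    and le: "\<And>A. A \<in> sets X \<Longrightarrow> emeasure \<mu> (A \<times> space Y) \<le> emeasure X A"
    using \<mu> by (auto simp: polymorphism_def)
  have mm[measurable]: "m \<in> X \<rightarrow>\<^sub>M subprob_algebra Y"
    and mu: "\<And>A B. A \<in> sets X \<Longrightarrow> B \<in> sets Y \<Longrightarrow> emeasure X A < \<infinity> \<Longrightarrow> emeasure Y B < \<infinity> \<Longrightarrow>
        emeasure \<mu> (A \<times> B) = (\<integral>\<^sup>+ x\<in>A. emeasure (m x) B \<partial>X)"
    using m by (auto simp: conditional_measures_def)
  let ?k = "\<lambda>x. distr (m x) (X \<Otimes>\<^sub>M Y) (Pair x)"
  have k: "?k \<in> X \<rightarrow>\<^sub>M subprob_algebra (X \<Otimes>\<^sub>M Y)"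
    by (rule measurable_distr2[OF _ mm]) simp
  have ms: "sets (m x) = sets Y" "space (m x) = space Y" if "x \<in> space X" for x
    using subprob_measurableD[OF mm that] by auto
  have Pm: "Pair x \<in> m x \<rightarrow>\<^sub>M X \<Otimes>\<^sub>M Y" if "x \<in> space X" for x
    using that by (simp add: measurable_cong_sets[OF ms(1)[OF that] refl])
  have int: "(\<integral>\<^sup>+p. \<psi> p \<partial>(X \<bind> ?k)) = (\<integral>\<^sup>+x. \<integral>\<^sup>+y. \<psi> (x, y) \<partial>m x \<partial>X)"
    if "\<psi> \<in> borel_measurable (X \<Otimes>\<^sub>M Y)" for \<psi>
    unfolding nn_integral_bind[OF that k]
    by (intro nn_integral_cong nn_integral_distr Pm) (simp_all add: that)
  show ?thesis
  proof (cases "space X = {}")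
    case True
    then have "space \<mu> = {}" using sets_eq_imp_space_eq[OF sets] by (simp add: space_pair_measure)
    then show ?thesis using True by (simp add: nn_integral_empty)
  next
    case False
    have sk: "sets (X \<bind> ?k) = sets (X \<Otimes>\<^sub>M Y)"
      using False by (intro sets_bind) auto
    have "\<mu> = X \<bind> ?k"
    proof (rule measure_eqI_finite_rectangles[OF X Y sets sk])
      fix A B assume AB: "A \<in> sets X" "B \<in> sets Y" "emeasure X A < \<infinity>" "emeasure Y B < \<infinity>"
      have AB': "A \<times> B \<in> sets (X \<Otimes>\<^sub>M Y)" using AB by auto
      then have "emeasure (X \<bind> ?k) (A \<times> B) = (\<integral>\<^sup>+p. indicator (A \<times> B) p \<partial>(X \<bind> ?k))"
        by (intro nn_integral_indicator[symmetric]) (simp add: sk)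
      also have "\<dots> = (\<integral>\<^sup>+x. \<integral>\<^sup>+y. indicator A x * indicator B y \<partial>m x \<partial>X)"
        using AB' by (subst int) (auto intro!: nn_integral_cong split: split_indicator)
      also have "\<dots> = (\<integral>\<^sup>+x\<in>A. emeasure (m x) B \<partial>X)"
        using AB(2) by (intro nn_integral_cong, subst nn_integral_cmult) (auto simp: ms mult.commute)
      also have "\<dots> = emeasure \<mu> (A \<times> B)" using mu[OF AB] by simp
      finally show "emeasure \<mu> (A \<times> B) = emeasure (X \<bind> ?k) (A \<times> B)" ..
      have "emeasure \<mu> (A \<times> B) \<le> emeasure \<mu> (A \<times> space Y)"
        using AB sets.sets_into_space[OF AB(2)] by (intro emeasure_mono) (auto simp: sets)
      then show "emeasure \<mu> (A \<times> B) < \<infinity>" using le[OF AB(1)] AB(3) by (meson le_less_trans)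
    qed
    then have "(\<integral>\<^sup>+p. \<phi> (fst p) (snd p) \<partial>\<mu>) = (\<integral>\<^sup>+p. \<phi> (fst p) (snd p) \<partial>(X \<bind> ?k))" by simp
    also have "\<dots> = (\<integral>\<^sup>+x. \<integral>\<^sup>+y. \<phi> x y \<partial>m x \<partial>X)"
      using \<phi> by (subst int) (auto simp: split_beta')
    finally show ?thesis .
  qed
qed

text \<open>In contrast to the definition this covers sides of infinite measure, in particular whole
  spaces, over which the total masses of kernels are compared.\<close>

lemma emeasure_conditional_measures:
  assumes "sigma_finite_measure X" "sigma_finite_measure Y"
    "polymorphism X Y \<mu>" "conditional_measures X Y \<mu> m"
    and A: "A \<in> sets X" and B: "B \<in> sets Y"
  shows "emeasure \<mu> (A \<times> B) = (\<integral>\<^sup>+x\<in>A. emeasure (m x) B \<partial>X)"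
proof -
  have s: "sets \<mu> = sets (X \<Otimes>\<^sub>M Y)" using assms by (simp add: polymorphism_def)
  have mm: "m \<in> X \<rightarrow>\<^sub>M subprob_algebra Y" using assms by (simp add: conditional_measures_def)
  have [measurable]: "A \<in> sets X" "B \<in> sets Y" by fact+
  have "emeasure \<mu> (A \<times> B) = (\<integral>\<^sup>+p. indicator (A \<times> B) p \<partial>\<mu>)"
    using A B by (intro nn_integral_indicator[symmetric]) (simp add: s)
  also have "\<dots> = (\<integral>\<^sup>+p. indicator A (fst p) * indicator B (snd p) \<partial>\<mu>)"
    by (intro nn_integral_cong) (auto split: split_indicator)
  also have "\<dots> = (\<integral>\<^sup>+x. \<integral>\<^sup>+y. indicator A x * indicator B y \<partial>m x \<partial>X)"
    by (rule nn_integral_conditional_measures[OF assms(1-4)]) measurable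
  also have "\<dots> = (\<integral>\<^sup>+x\<in>A. emeasure (m x) B \<partial>X)"
  proof (rule nn_integral_cong)
    fix x assume "x \<in> space X"
    then have "B \<in> sets (m x)" using subprob_measurableD(2)[OF mm] B by simp
    then show "(\<integral>\<^sup>+y. indicator A x * indicator B y \<partial>m x) = emeasure (m x) B * indicator A x"
      by (subst nn_integral_cmult) (auto simp: mult.commute)
  qed
  finally show ?thesis .
qed

text \<open>The exceptional null set depends on \<open>B\<close>, which suits a comparison of
  measures one rectangle at a time.\<close>

lemma conditional_measures_AE_unique:
  assumes "sigma_finite_measure X" "conditional_measures X Y \<mu> m" "conditional_measures X Y \<mu> m'"
    and B: "B \<in> sets Y" "emeasure Y B < \<infinity>"
  shows "AE x in X. emeasure (m x) B = emeasure (m' x) B"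
proof (rule AE_eq_of_finite_set_integrals[OF assms(1)])
  show "(\<lambda>x. emeasure (m x) B) \<in> borel_measurable X" "(\<lambda>x. emeasure (m' x) B) \<in> borel_measurable X"
    using assms by (auto simp: conditional_measures_def intro: measurable_emeasure_kernel)
  fix A assume "A \<in> sets X" "emeasure X A < \<infinity>"
  then show "(\<integral>\<^sup>+x\<in>A. emeasure (m x) B \<partial>X) = (\<integral>\<^sup>+x\<in>A. emeasure (m' x) B \<partial>X)"
    using assms by (simp add: conditional_measures_def)
qed

text \<open>Integrating against \<open>\<mu>\<close> itself keeps the conditional measures of
  \<open>\<mu>\<close> out of the formula, so that invariance of \<open>\<mu>\<close> can be applied
  to it directly.\<close>

definition polymorphism_comp ::
    "'x measure \<Rightarrow> 'z measure \<Rightarrow> ('x \<times> 'y) measure \<Rightarrow> ('y \<Rightarrow> 'z measure) \<Rightarrow> ('x \<times> 'z) measure" where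
  "polymorphism_comp X Z \<mu> n = \<mu> \<bind> (\<lambda>p. distr (n (snd p)) (X \<Otimes>\<^sub>M Z) (Pair (fst p)))"

lemma polymorphism_comp:
  assumes \<mu>: "sets \<mu> = sets (X \<Otimes>\<^sub>M Y)" and n[measurable]: "n \<in> Y \<rightarrow>\<^sub>M subprob_algebra Z"
    and ne: "space X \<noteq> {}" "space Y \<noteq> {}"
  shows "sets (polymorphism_comp X Z \<mu> n) = sets (X \<Otimes>\<^sub>M Z)"
    and "E \<in> sets (X \<Otimes>\<^sub>M Z) \<Longrightarrow> emeasure (polymorphism_comp X Z \<mu> n) E =
        (\<integral>\<^sup>+p. emeasure (n (snd p)) (Pair (fst p) -` E) \<partial>\<mu>)"
    and "A \<in> sets X \<Longrightarrow> C \<in> sets Z \<Longrightarrow> emeasure (polymorphism_comp X Z \<mu> n) (A \<times> C) =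
        (\<integral>\<^sup>+p. indicator A (fst p) * emeasure (n (snd p)) C \<partial>\<mu>)"
proof -
  let ?k = "\<lambda>p. distr (n (snd p)) (X \<Otimes>\<^sub>M Z) (Pair (fst p))"
  note [measurable_cong] = \<mu>
  have sp: "space \<mu> = space X \<times> space Y"
    using sets_eq_imp_space_eq[OF \<mu>] by (simp add: space_pair_measure)
  have nsnd: "(\<lambda>p. n (snd p)) \<in> \<mu> \<rightarrow>\<^sub>M subprob_algebra Z" by measurable
  have k: "?k \<in> \<mu> \<rightarrow>\<^sub>M subprob_algebra (X \<Otimes>\<^sub>M Z)"
    by (rule measurable_distr2[OF _ nsnd]) measurable
  show "sets (polymorphism_comp X Z \<mu> n) = sets (X \<Otimes>\<^sub>M Z)"
    unfolding polymorphism_comp_def using ne sp by (intro sets_bind) auto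
  have ns: "sets (n y) = sets Z" "space (n y) = space Z" if "y \<in> space Y" for y
    using subprob_measurableD[OF n that] by auto
  show *: "emeasure (polymorphism_comp X Z \<mu> n) E =
        (\<integral>\<^sup>+p. emeasure (n (snd p)) (Pair (fst p) -` E) \<partial>\<mu>)" if E: "E \<in> sets (X \<Otimes>\<^sub>M Z)" for E
  proof -
    have "emeasure (polymorphism_comp X Z \<mu> n) E = (\<integral>\<^sup>+p. emeasure (?k p) E \<partial>\<mu>)"
      unfolding polymorphism_comp_def using ne sp E by (intro emeasure_bind[OF _ k]) auto
    also have "\<dots> = (\<integral>\<^sup>+p. emeasure (n (snd p)) (Pair (fst p) -` E) \<partial>\<mu>)"
    proof (rule nn_integral_cong)
      fix p assume "p \<in> space \<mu>"
      then have p: "fst p \<in> space X" "snd p \<in> space Y" by (auto simp: sp)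
      have Pm: "Pair (fst p) \<in> n (snd p) \<rightarrow>\<^sub>M X \<Otimes>\<^sub>M Z"
        using p by (simp add: measurable_cong_sets[OF ns(1)[OF p(2)] refl])
      have "Pair (fst p) -` E \<inter> space (n (snd p)) = Pair (fst p) -` E"
        using sets.sets_into_space[OF E] ns[OF p(2)] by (auto simp: space_pair_measure)
      then show "emeasure (?k p) E = emeasure (n (snd p)) (Pair (fst p) -` E)"
        using E by (simp add: emeasure_distr[OF Pm])
    qed
    finally show ?thesis .
  qed
  show "emeasure (polymorphism_comp X Z \<mu> n) (A \<times> C) =
        (\<integral>\<^sup>+p. indicator A (fst p) * emeasure (n (snd p)) C \<partial>\<mu>)"
    if AC: "A \<in> sets X" "C \<in> sets Z"
  proof -
    have "A \<times> C \<in> sets (X \<Otimes>\<^sub>M Z)" using AC by simp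
    from *[OF this] show ?thesis
      by (simp only:) (intro nn_integral_cong, auto split: split_indicator)
  qed
qed

text \<open>On rectangles, integrating a composite kernel over \<open>X\<close> becomes an integral
  against \<open>\<mu>\<close> in which \<open>m\<close> no longer appears; replacing one version of
  \<open>n\<close> by another changes the integrand only on a null set of \<open>\<mu>\<close>.
  Hence every candidate in the definite description has the same values.\<close>

lemma polymorphism_prod_eq_comp:
  assumes sf: "sigma_finite_measure X" "sigma_finite_measure Y" "sigma_finite_measure Z"
    and ne: "space X \<noteq> {}" "space Y \<noteq> {}"
    and \<mu>: "polymorphism X Y \<mu>" and \<nu>: "polymorphism Y Z \<nu>"
    and m: "conditional_measures X Y \<mu> m" and n: "conditional_measures Y Z \<nu> n"
  shows "polymorphism_prod X Y Z \<nu> \<mu> = polymorphism_comp X Z \<mu> n" (is ?prod)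
    and "polymorphism X Z (polymorphism_comp X Z \<mu> n)" (is ?poly)
proof -
  let ?\<kappa> = "polymorphism_comp X Z \<mu> n"
  have s\<mu>: "sets \<mu> = sets (X \<Otimes>\<^sub>M Y)" using \<mu> by (simp add: polymorphism_def)
  note [measurable_cong] = s\<mu>
  have nm[measurable]: "n \<in> Y \<rightarrow>\<^sub>M subprob_algebra Z" using n by (simp add: conditional_measures_def)
  have sp\<mu>: "space \<mu> = space X \<times> space Y"
    using sets_eq_imp_space_eq[OF s\<mu>] by (simp add: space_pair_measure)
  note \<kappa> = polymorphism_comp[OF s\<mu> nm ne]
  show poly: ?poly
    unfolding polymorphism_def
  proof (intro conjI ballI \<kappa>(1))
    fix A assume A: "A \<in> sets X"
    have "emeasure ?\<kappa> (A \<times> space Z) = (\<integral>\<^sup>+p. indicator A (fst p) * emeasure (n (snd p)) (space Z) \<partial>\<mu>)"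
      using A by (intro \<kappa>(3)) auto
    also have "\<dots> \<le> (\<integral>\<^sup>+p. indicator (A \<times> space Y) p \<partial>\<mu>)"
    proof (rule nn_integral_mono)
      fix p assume p: "p \<in> space \<mu>"
      then have "subprob_space (n (snd p))"
        using subprob_measurableD(1)[OF nm] subprob_space_kernel[OF nm] by (auto simp: sp\<mu>)
      then have "emeasure (n (snd p)) (space Z) \<le> 1" by (rule subprob_space.subprob_emeasure_le_1)
      then show "indicator A (fst p) * emeasure (n (snd p)) (space Z) \<le> indicator (A \<times> space Y) p"
        using p by (auto simp: sp\<mu> split: split_indicator)
    qed
    also have "\<dots> = emeasure \<mu> (A \<times> space Y)"
      using A by (intro nn_integral_indicator) (simp add: s\<mu>)
    also have "\<dots> \<le> emeasure X A" using \<mu> A by (simp add: polymorphism_def)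
    finally show "emeasure ?\<kappa> (A \<times> space Z) \<le> emeasure X A" .
  next
    fix C assume C[measurable]: "C \<in> sets Z"
    have "emeasure ?\<kappa> (space X \<times> C) = (\<integral>\<^sup>+p. indicator (space X) (fst p) * emeasure (n (snd p)) C \<partial>\<mu>)"
      by (intro \<kappa>(3)) auto
    also have "\<dots> = (\<integral>\<^sup>+p. emeasure (n (snd p)) C \<partial>\<mu>)"
      by (intro nn_integral_cong) (auto simp: sp\<mu>)
    also have "\<dots> = (\<integral>\<^sup>+y. emeasure (n y) C \<partial>distr \<mu> Y snd)"
      by (subst nn_integral_distr) auto
    \<comment> \<open>The second projection of \<open>\<mu>\<close> lies below \<open>Y\<close> as a
      measure; after enlarging it to \<open>Y\<close>, the remaining integral is a projection of
      \<open>\<nu>\<close>, which is dominated by \<open>Z\<close>.\<close>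
    also have "\<dots> \<le> (\<integral>\<^sup>+y. emeasure (n y) C \<partial>Y)"
    proof (rule nn_integral_mono_measure)
      show "distr \<mu> Y snd \<le> Y"
      proof (subst le_measure)
        show "\<forall>B\<in>sets (distr \<mu> Y snd). emeasure (distr \<mu> Y snd) B \<le> emeasure Y B"
        proof
          fix B assume "B \<in> sets (distr \<mu> Y snd)"
          then have B: "B \<in> sets Y" by simp
          have "snd -` B \<inter> space \<mu> = space X \<times> B"
            using sets.sets_into_space[OF B] by (auto simp: sp\<mu>)
          then have "emeasure (distr \<mu> Y snd) B = emeasure \<mu> (space X \<times> B)"
            using B by (subst emeasure_distr) auto
          also have "\<dots> \<le> emeasure Y B" using \<mu> B by (simp add: polymorphism_def)
          finally show "emeasure (distr \<mu> Y snd) B \<le> emeasure Y B" .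
        qed
      qed simp
    qed auto
    also have "\<dots> = (\<integral>\<^sup>+y\<in>space Y. emeasure (n y) C \<partial>Y)"
      by (intro nn_integral_cong) auto
    also have "\<dots> = emeasure \<nu> (space Y \<times> C)"
      by (rule emeasure_conditional_measures[OF sf(2,3) \<nu> n, symmetric]) auto
    also have "\<dots> \<le> emeasure Z C" using \<nu> C by (simp add: polymorphism_def)
    finally show "emeasure ?\<kappa> (space X \<times> C) \<le> emeasure Z C" .
  qed
  \<comment> \<open>Arbitrary versions are allowed because the identity serves both the given
    kernels and those of a competing measure.\<close>
  have comp: "(\<integral>\<^sup>+x\<in>A. emeasure (m' x \<bind> n') C \<partial>X) =
      (\<integral>\<^sup>+p. indicator A (fst p) * emeasure (n' (snd p)) C \<partial>\<mu>)"
    if A[measurable]: "A \<in> sets X" and C[measurable]: "C \<in> sets Z"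
      and m': "conditional_measures X Y \<mu> m'" and n': "conditional_measures Y Z \<nu> n'" for A C m' n'
  proof -
    have mm: "m' \<in> X \<rightarrow>\<^sub>M subprob_algebra Y" using m' by (simp add: conditional_measures_def)
    have nm': "n' \<in> Y \<rightarrow>\<^sub>M subprob_algebra Z" using n' by (simp add: conditional_measures_def)
    note [measurable] = measurable_emeasure_kernel[OF nm' C]
    have "(\<integral>\<^sup>+p. indicator A (fst p) * emeasure (n' (snd p)) C \<partial>\<mu>) =
        (\<integral>\<^sup>+x. \<integral>\<^sup>+y. indicator A x * emeasure (n' y) C \<partial>m' x \<partial>X)"
      by (rule nn_integral_conditional_measures[OF sf(1,2) \<mu> m']) measurable
    also have "\<dots> = (\<integral>\<^sup>+x\<in>A. emeasure (m' x \<bind> n') C \<partial>X)"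
    proof (rule nn_integral_cong)
      fix x assume x: "x \<in> space X"
      have ms: "sets (m' x) = sets Y" "space (m' x) = space Y"
        using subprob_measurableD[OF mm x] by auto
      have "emeasure (m' x \<bind> n') C = (\<integral>\<^sup>+y. emeasure (n' y) C \<partial>m' x)"
        using ne nm' C by (intro emeasure_bind) (auto simp: ms measurable_cong_sets[OF ms(1) refl])
      moreover have "(\<lambda>y. emeasure (n' y) C) \<in> borel_measurable (m' x)"
        unfolding measurable_cong_sets[OF ms(1) refl] by measurable
      ultimately show "(\<integral>\<^sup>+y. indicator A x * emeasure (n' y) C \<partial>m' x) =
          emeasure (m' x \<bind> n') C * indicator A x"
        by (simp add: nn_integral_cmult mult.commute)
    qed
    finally show ?thesis ..
  qed
  have cond: "conditional_measures X Z ?\<kappa> (\<lambda>x. m x \<bind> n)"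
    unfolding conditional_measures_def
  proof (intro conjI ballI impI)
    have mm: "m \<in> X \<rightarrow>\<^sub>M subprob_algebra Y" using m by (simp add: conditional_measures_def)
    show "(\<lambda>x. m x \<bind> n) \<in> X \<rightarrow>\<^sub>M subprob_algebra Z"
      by (rule measurable_bind2[OF mm nm])
    fix A C assume "A \<in> sets X" "C \<in> sets Z"
    then show "emeasure ?\<kappa> (A \<times> C) = (\<integral>\<^sup>+x\<in>A. emeasure (m x \<bind> n) C \<partial>X)"
      using comp[OF _ _ m n] \<kappa>(3) by simp
  qed
  show ?prod
    unfolding polymorphism_prod_def
  proof (rule the_equality)
    show "polymorphism X Z ?\<kappa> \<and> (\<exists>m n. conditional_measures X Y \<mu> m \<and> conditional_measures Y Z \<nu> n \<and>
        conditional_measures X Z ?\<kappa> (\<lambda>x. m x \<bind> n))"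
      using poly m n cond by blast
    fix \<kappa>' assume "polymorphism X Z \<kappa>' \<and> (\<exists>m n. conditional_measures X Y \<mu> m \<and>
        conditional_measures Y Z \<nu> n \<and> conditional_measures X Z \<kappa>' (\<lambda>x. m x \<bind> n))"
    then obtain m' n' where \<kappa>': "polymorphism X Z \<kappa>'" and m': "conditional_measures X Y \<mu> m'"
      and n': "conditional_measures Y Z \<nu> n'" and c: "conditional_measures X Z \<kappa>' (\<lambda>x. m' x \<bind> n')"
      by blast
    have s': "sets \<kappa>' = sets (X \<Otimes>\<^sub>M Z)" using \<kappa>' by (simp add: polymorphism_def)
    show "\<kappa>' = ?\<kappa>"
    proof (rule measure_eqI_finite_rectangles[OF sf(1,3) s' \<kappa>(1)])
      fix A C assume AC: "A \<in> sets X" "C \<in> sets Z" "emeasure X A < \<infinity>" "emeasure Z C < \<infinity>"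
      have "emeasure \<kappa>' (A \<times> C) = (\<integral>\<^sup>+p. indicator A (fst p) * emeasure (n' (snd p)) C \<partial>\<mu>)"
        using c AC comp[OF AC(1,2) m' n'] by (simp add: conditional_measures_def)
      also have "\<dots> = (\<integral>\<^sup>+p. indicator A (fst p) * emeasure (n (snd p)) C \<partial>\<mu>)"
        using polymorphism_AE_snd[OF \<mu> conditional_measures_AE_unique[OF sf(2) n' n AC(2,4)]]
        by (intro nn_integral_cong_AE) (auto elim!: eventually_mono)
      also have "\<dots> = emeasure ?\<kappa> (A \<times> C)" using AC by (simp add: \<kappa>(3))
      finally show "emeasure \<kappa>' (A \<times> C) = emeasure ?\<kappa> (A \<times> C)" .
      have "emeasure \<kappa>' (A \<times> C) \<le> emeasure \<kappa>' (A \<times> space Z)"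
        using AC sets.sets_into_space[OF AC(2)] by (intro emeasure_mono) (auto simp: s')
      also have "\<dots> \<le> emeasure X A" using \<kappa>' AC by (simp add: polymorphism_def)
      finally show "emeasure \<kappa>' (A \<times> C) < \<infinity>" using AC(3) by (rule le_less_trans)
    qed
  qed
qed

section \<open>The product of two polyhomomorphisms\<close>

lemma ennreal_scale_unique:
  assumes "ennreal a * x = ennreal b * x" "x \<noteq> 0" "x \<noteq> \<infinity>" "0 \<le> a" "0 \<le> b"
  shows "a = b"
proof -
  have "x * ennreal a = x * ennreal b" using assms(1) by (simp add: mult.commute)
  then show ?thesis using assms(2-) by (simp add: ennreal_mult_cancel_left)
qed

text \<open>One set \<open>C\<close> of finite positive measure inside the domain rules out a second
  constant.\<close>

lemma polyhom_alpha_eqI: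
  assumes "0 < a" "\<And>A. A \<in> sets borel \<Longrightarrow>
      emeasure \<rho> (R \<inter> (A \<times> UNIV)) = ennreal a * emeasure \<gamma> (A \<inter> Domain R)"
    and C: "C \<in> sets borel" "C \<subseteq> Domain R" "emeasure \<gamma> C \<noteq> 0" "emeasure \<gamma> C \<noteq> \<infinity>"
  shows "polyhom_alpha \<gamma> R \<rho> = a"
  unfolding polyhom_alpha_def
proof (rule the_equality)
  fix b assume b: "0 < b \<and> (\<forall>A\<in>sets borel. emeasure \<rho> (R \<inter> (A \<times> UNIV)) = ennreal b * emeasure \<gamma> (A \<inter> Domain R))"
  have "C \<inter> Domain R = C" using C(2) by auto
  then have "ennreal b * emeasure \<gamma> C = ennreal a * emeasure \<gamma> C"
    using b assms(2)[OF C(1)] C(1) by metis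
  then show "b = a" using assms(1) b C by (intro ennreal_scale_unique) auto
qed (use assms in auto)

lemma polyhom_beta_eqI:
  assumes "0 < b" "\<And>B. B \<in> sets borel \<Longrightarrow>
      emeasure \<rho> (R \<inter> (UNIV \<times> B)) = ennreal b * emeasure \<eta> (B \<inter> Range R)"
    and C: "C \<in> sets borel" "C \<subseteq> Range R" "emeasure \<eta> C \<noteq> 0" "emeasure \<eta> C \<noteq> \<infinity>"
  shows "polyhom_beta \<eta> R \<rho> = b"
  unfolding polyhom_beta_def
proof (rule the_equality)
  fix a assume a: "0 < a \<and> (\<forall>B\<in>sets borel. emeasure \<rho> (R \<inter> (UNIV \<times> B)) = ennreal a * emeasure \<eta> (B \<inter> Range R))"
  have "C \<inter> Range R = C" using C(2) by auto
  then have "ennreal a * emeasure \<eta> C = ennreal b * emeasure \<eta> C"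
    using a assms(2)[OF C(1)] C(1) by metis
  then show "a = b" using assms(1) a C by (intro ennreal_scale_unique) auto
qed (use assms in auto)

section \<open>The measure of a single polyhomomorphism\<close>

locale polyhomomorphism =
  fixes \<gamma> :: "'g::{topological_group_add, t2_space, second_countable_topology} measure"
    and \<eta> :: "'h::{topological_group_add, t2_space, second_countable_topology} measure"
    and R :: "('g \<times> 'h) set" and \<rho> :: "('g \<times> 'h) measure"
  assumes lcG: "locally_compact_space (euclidean :: 'g topology)"
    and lcH: "locally_compact_space (euclidean :: 'h topology)"
    and \<gamma>: "unimodular_haar_measure \<gamma>" and \<eta>: "unimodular_haar_measure \<eta>"
    and Polh: "Polyhom R \<rho> \<in> Polh \<gamma> \<eta>"
begin

abbreviation \<mu> :: "('g \<times> 'h) measure" where "\<mu> \<equiv> distr \<rho> borel (\<lambda>x. x)"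

lemmas scG = sigma_compact_UNIV[OF lcG]
lemmas scH = sigma_compact_UNIV[OF lcH]
lemmas \<gamma>D = unimodular_haar_measureD[OF \<gamma>]
lemmas \<eta>D = unimodular_haar_measureD[OF \<eta>]

lemma sigma_finite: "sigma_finite_measure \<gamma>" "sigma_finite_measure \<eta>"
  by (rule sigma_finite_of_compact_finite[OF \<gamma>D(1) scG \<gamma>D(3)], assumption)
     (rule sigma_finite_of_compact_finite[OF \<eta>D(1) scH \<eta>D(3)])

lemma space: "space \<gamma> = UNIV" "space \<eta> = UNIV"
  using sets_eq_imp_space_eq[OF \<gamma>D(1)] sets_eq_imp_space_eq[OF \<eta>D(1)] by auto

lemma closed_R: "closed R" and subgroup_R: "is_subgroup R" and haar_R: "haar_measure_on R \<rho>"
  using Polh by (auto simp: Polh_def)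

lemma borel_R: "R \<in> sets borel"
  by (rule borel_closed[OF closed_R])

lemma sets_\<rho>: "sets \<rho> = sets (restrict_space borel R)"
  using haar_R by (simp add: haar_measure_on_def)

lemma emeasure_\<mu>: "E \<in> sets borel \<Longrightarrow> emeasure \<mu> E = emeasure \<rho> (R \<inter> E)"
  by (rule distr_restrict_id(2)[OF sets_\<rho> borel_R])

lemma haar_\<mu>: "extended_haar R \<mu>"
  by (rule haar_measure_on_imp_extended_haar[OF borel_R subgroup_R haar_R])

lemma sigma_compact_R: "sigma_compact R"
  using sigma_compact_Int_closed[OF sigma_compact_Times[OF scG scH] closed_R] by simp

lemma emeasure_\<rho>:
  "A \<in> sets borel \<Longrightarrow> emeasure \<rho> (R \<inter> (A \<times> UNIV)) = emeasure \<mu> (fst -` A)"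
  "B \<in> sets borel \<Longrightarrow> emeasure \<rho> (R \<inter> (UNIV \<times> B)) = emeasure \<mu> (snd -` B)"
proof -
  have v: "fst -` A = A \<times> UNIV" "snd -` B = UNIV \<times> B" for A :: "'g set" and B :: "'h set" by auto
  show "A \<in> sets borel \<Longrightarrow> emeasure \<rho> (R \<inter> (A \<times> UNIV)) = emeasure \<mu> (fst -` A)"
    unfolding v(1)[symmetric] by (intro emeasure_\<mu>[symmetric] vimage_fst_snd_borel)
  show "B \<in> sets borel \<Longrightarrow> emeasure \<rho> (R \<inter> (UNIV \<times> B)) = emeasure \<mu> (snd -` B)"
    unfolding v(2)[symmetric] by (intro emeasure_\<mu>[symmetric] vimage_fst_snd_borel)
qed

lemma dominated:
  "A \<in> sets borel \<Longrightarrow> emeasure \<mu> (fst -` A) \<le> emeasure \<gamma> A"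
  "B \<in> sets borel \<Longrightarrow> emeasure \<mu> (snd -` B) \<le> emeasure \<eta> B"
  using Polh by (auto simp: Polh_def emeasure_\<rho>[symmetric])

lemma polymorphism: "polymorphism \<gamma> \<eta> \<mu>"
  unfolding polymorphism_def
proof (intro conjI ballI)
  show "sets \<mu> = sets (\<gamma> \<Otimes>\<^sub>M \<eta>)" by (simp add: sets_borel_pair[OF \<gamma>D(1) \<eta>D(1)])
  have v: "fst -` A = A \<times> UNIV" "snd -` B = UNIV \<times> B" for A :: "'g set" and B :: "'h set" by auto
  show "emeasure \<mu> (A \<times> space \<eta>) \<le> emeasure \<gamma> A" if "A \<in> sets \<gamma>" for A
    using dominated(1)[of A] that by (simp add: \<gamma>D(1) v space)
  show "emeasure \<mu> (space \<gamma> \<times> B) \<le> emeasure \<eta> B" if "B \<in> sets \<eta>" for B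
    using dominated(2)[of B] that by (simp add: \<eta>D(1) v space)
qed

lemma conditional_measures_exist: "\<exists>m. conditional_measures \<gamma> \<eta> \<mu> m"
  using extended_haar_conditional_measures[OF sigma_compact_R closed_R haar_\<mu> \<gamma> scG \<eta>D(1) dominated(1)]
  by metis

lemma alpha:
  obtains a C where "0 < a" "polyhom_alpha \<gamma> R \<rho> = a"
    "\<And>A. A \<in> sets borel \<Longrightarrow> emeasure \<mu> (fst -` A) = ennreal a * emeasure \<gamma> (A \<inter> Domain R)"
    "compact C" "C \<subseteq> Domain R" "emeasure \<gamma> C \<noteq> 0"
proof -
  obtain a C where a: "0 < a" "\<And>A. A \<in> sets borel \<Longrightarrow>
      emeasure \<mu> (fst -` A) = ennreal a * emeasure \<gamma> (A \<inter> fst ` R)"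
    and C: "compact C" "C \<subseteq> fst ` R" "emeasure \<gamma> C \<noteq> 0"
    by (rule projection_scaling[of fst, OF _ _ sigma_compact_R haar_\<mu> \<gamma> scG dominated(1)])
       (auto intro: continuous_intros)
  have "polyhom_alpha \<gamma> R \<rho> = a"
    using a C \<gamma>D(3)[OF C(1)]
    by (intro polyhom_alpha_eqI[where C=C]) (auto simp: borel_compact emeasure_\<rho> Domain_fst)
  with a C show ?thesis by (intro that) (auto simp: Domain_fst)
qed

lemma beta:
  obtains b C where "0 < b" "polyhom_beta \<eta> R \<rho> = b"
    "\<And>B. B \<in> sets borel \<Longrightarrow> emeasure \<mu> (snd -` B) = ennreal b * emeasure \<eta> (B \<inter> Range R)"
    "compact C" "C \<subseteq> Range R" "emeasure \<eta> C \<noteq> 0"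
proof -
  obtain b C where b: "0 < b" "\<And>A. A \<in> sets borel \<Longrightarrow>
      emeasure \<mu> (snd -` A) = ennreal b * emeasure \<eta> (A \<inter> snd ` R)"
    and C: "compact C" "C \<subseteq> snd ` R" "emeasure \<eta> C \<noteq> 0"
    by (rule projection_scaling[of snd, OF _ _ sigma_compact_R haar_\<mu> \<eta> scH dominated(2)])
       (auto intro: continuous_intros)
  have "polyhom_beta \<eta> R \<rho> = b"
    using b C \<eta>D(3)[OF C(1)]
    by (intro polyhom_beta_eqI[where C=C]) (auto simp: borel_compact emeasure_\<rho> Range_snd)
  with b C show ?thesis by (intro that) (auto simp: Range_snd)
qed

lemma Domain_Range:
  "is_subgroup (Domain R)" "is_subgroup (Range R)" "Domain R \<in> sets borel" "Range R \<in> sets borel"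
proof -
  show "is_subgroup (Domain R)" "is_subgroup (Range R)"
    unfolding Domain_fst Range_snd by (intro is_subgroup_image subgroup_R; simp)+
  show "Domain R \<in> sets borel" "Range R \<in> sets borel"
    unfolding Domain_fst Range_snd
    by (intro sigma_compact_borel sigma_compact_image sigma_compact_R continuous_intros)+
qed

lemma Domain_Range_pos: "emeasure \<gamma> (Domain R) \<noteq> 0" "emeasure \<eta> (Range R) \<noteq> 0"
proof -
  obtain C where C: "C \<subseteq> Domain R" "emeasure \<gamma> C \<noteq> 0" by (rule alpha)
  then show "emeasure \<gamma> (Domain R) \<noteq> 0"
    using emeasure_mono[OF C(1), of \<gamma>] Domain_Range by (auto simp: \<gamma>D(1))
  obtain C where C: "C \<subseteq> Range R" "emeasure \<eta> C \<noteq> 0" by (rule beta)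
  then show "emeasure \<eta> (Range R) \<noteq> 0"
    using emeasure_mono[OF C(1), of \<eta>] Domain_Range by (auto simp: \<eta>D(1))
qed

end

text \<open>Pushing the restriction of \<open>M\<close> to \<open>X\<close> forward along
  \<open>f\<close> reduces this to a nonzero measure on a sigma-compact space. The result supplies
  the compact base set over which cosets are counted.\<close>

lemma obtain_compact_image_pos:
  fixes f :: "'a::second_countable_topology \<Rightarrow> 'b::{t2_space, second_countable_topology}"
  assumes "sets M = sets borel" "f \<in> borel_measurable borel" "sigma_compact (UNIV :: 'b set)"
    and X: "X \<in> sets borel" "emeasure M X \<noteq> 0"
  obtains C where "compact C" "emeasure M (f -` C \<inter> X) \<noteq> 0"
proof -
  have sp: "space M = UNIV" using sets_eq_imp_space_eq[OF assms(1)] by simp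
  have f: "f \<in> borel_measurable (density M (indicator X))"
    using assms(2) by (simp add: measurable_cong_sets[OF assms(1) refl])
  let ?D = "distr (density M (indicator X)) borel f"
  have e: "emeasure ?D C = emeasure M (f -` C \<inter> X)" if "C \<in> sets borel" for C
    using that X measurable_sets_borel[OF assms(2) that]
    by (subst emeasure_distr[OF f that], simp add: sp, subst emeasure_restricted)
       (auto simp: assms(1) Int_commute)
  have "emeasure ?D UNIV \<noteq> 0" using X by (simp add: e)
  then obtain C where "compact C" "emeasure ?D C \<noteq> 0"
    using sigma_compact_emeasure_pos[OF assms(3), of ?D] by auto
  then show ?thesis using that e borel_compact by metis
qed

section \<open>The composite measure of two polyhomomorphisms\<close>

locale polyhomomorphism_pair =
  r: polyhomomorphism \<gamma> \<eta> R \<rho> + t: polyhomomorphism \<eta> \<zeta> T \<tau>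
  for \<gamma> :: "'g::{topological_group_add, t2_space, second_countable_topology} measure"
    and \<eta> :: "'h::{topological_group_add, t2_space, second_countable_topology} measure"
    and \<zeta> :: "'k::{topological_group_add, t2_space, second_countable_topology} measure"
    and R \<rho> T \<tau>
begin

text \<open>Only \<open>n\<close> enters \<open>\<kappa>\<close>; \<open>m\<close> serves to
  identify \<open>\<kappa>\<close> with the product of polymorphisms.\<close>

definition m where "m = (SOME m. conditional_measures \<gamma> \<eta> r.\<mu> m)"
definition n where "n = (SOME n. conditional_measures \<eta> \<zeta> t.\<mu> n)"
definition \<kappa> where "\<kappa> = polymorphism_comp \<gamma> \<zeta> r.\<mu> n"

lemma cond: "conditional_measures \<gamma> \<eta> r.\<mu> m" "conditional_measures \<eta> \<zeta> t.\<mu> n"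
  unfolding m_def n_def
  using someI_ex[OF r.conditional_measures_exist] someI_ex[OF t.conditional_measures_exist] by auto

lemma n_measurable: "n \<in> \<eta> \<rightarrow>\<^sub>M subprob_algebra \<zeta>"
  using cond(2) by (simp add: conditional_measures_def)

lemma sets_n: "sets (n y) = sets borel" "space (n y) = UNIV"
  using subprob_measurableD[OF n_measurable, of y] t.\<eta>D(1) t.space by (auto simp: r.space)

lemma n_borel_measurable [measurable]:
  assumes "C \<in> sets borel"
  shows "(\<lambda>y. emeasure (n y) C) \<in> borel_measurable borel"
  using measurable_emeasure_kernel[OF n_measurable, of C] assms
  by (simp add: t.\<eta>D(1) measurable_cong_sets[OF r.\<eta>D(1) refl])

lemma sets_r: "sets r.\<mu> = sets (\<gamma> \<Otimes>\<^sub>M \<eta>)"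
  by (simp add: sets_borel_pair[OF r.\<gamma>D(1) r.\<eta>D(1)])

lemma \<kappa>_sets: "sets \<kappa> = sets borel"
  unfolding \<kappa>_def
  using polymorphism_comp(1)[OF sets_r n_measurable]
  by (simp add: r.space sets_borel_pair[OF r.\<gamma>D(1) t.\<eta>D(1)])

lemma \<kappa>_rect:
  assumes "A \<in> sets borel" "C \<in> sets borel"
  shows "emeasure \<kappa> (A \<times> C) = (\<integral>\<^sup>+p. indicator A (fst p) * emeasure (n (snd p)) C \<partial>r.\<mu>)"
  unfolding \<kappa>_def using assms
  by (intro polymorphism_comp(3)[OF sets_r n_measurable]) (simp_all add: r.space r.\<gamma>D(1) t.\<eta>D(1))

lemma n_emeasure:
  assumes "B \<in> sets borel" "C \<in> sets borel"
  shows "emeasure t.\<mu> (B \<times> C) = (\<integral>\<^sup>+y\<in>B. emeasure (n y) C \<partial>\<eta>)"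
  using assms
  by (intro emeasure_conditional_measures[OF r.sigma_finite(2) t.sigma_finite(2) t.polymorphism cond(2)])
     (auto simp: r.\<eta>D(1) t.\<eta>D(1))

lemma prod_eq_\<kappa>: "polymorphism_prod \<gamma> \<eta> \<zeta> t.\<mu> r.\<mu> = \<kappa>" "polymorphism \<gamma> \<zeta> \<kappa>"
  unfolding \<kappa>_def
  using polymorphism_prod_eq_comp[OF r.sigma_finite t.sigma_finite(2) _ _ r.polymorphism t.polymorphism cond]
  by (simp_all add: r.space)

lemma \<kappa>_dominated:
  "A \<in> sets borel \<Longrightarrow> emeasure \<kappa> (fst -` A) \<le> emeasure \<gamma> A"
  "C \<in> sets borel \<Longrightarrow> emeasure \<kappa> (snd -` C) \<le> emeasure \<zeta> C"
proof -
  have v: "fst -` A = A \<times> UNIV" "snd -` C = UNIV \<times> C" for A :: "'g set" and C :: "'k set" by auto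
  show "A \<in> sets borel \<Longrightarrow> emeasure \<kappa> (fst -` A) \<le> emeasure \<gamma> A"
    "C \<in> sets borel \<Longrightarrow> emeasure \<kappa> (snd -` C) \<le> emeasure \<zeta> C"
    using prod_eq_\<kappa>(2) by (auto simp: polymorphism_def v r.space t.space r.\<gamma>D(1) t.\<eta>D(1))
qed

abbreviation S where "S \<equiv> R O T"

text \<open>\<open>R O T\<close> is the projection of the closed set of pairs in
  \<open>R \<times> T\<close> with equal middle coordinates.\<close>

lemma sigma_compact_S: "sigma_compact S"
proof -
  have "S = (\<lambda>p. (fst (fst p), snd (snd p))) ` ((R \<times> T) \<inter> {p. snd (fst p) = fst (snd p)})"
    by (force simp: relcomp_unfold)
  moreover have "closed {p :: ('g \<times> 'h) \<times> ('h \<times> 'k). snd (fst p) = fst (snd p)}"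
    by (intro closed_Collect_eq continuous_intros)
  ultimately show ?thesis
    by (simp only:) (intro sigma_compact_image sigma_compact_Int_closed sigma_compact_Times
        r.sigma_compact_R t.sigma_compact_R continuous_intros)
qed

lemma borel_S: "S \<in> sets borel"
  by (rule sigma_compact_borel[OF sigma_compact_S])

lemma subgroup_S: "is_subgroup S"
proof -
  have R: "(0, 0) \<in> R" "\<And>x y x' y'. (x, y) \<in> R \<Longrightarrow> (x', y') \<in> R \<Longrightarrow> (x + x', y + y') \<in> R"
    "\<And>x y. (x, y) \<in> R \<Longrightarrow> (- x, - y) \<in> R"
    using is_subgroupD[OF r.subgroup_R] by (force simp: zero_prod_def)+
  have T: "(0, 0) \<in> T" "\<And>x y x' y'. (x, y) \<in> T \<Longrightarrow> (x', y') \<in> T \<Longrightarrow> (x + x', y + y') \<in> T"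
    "\<And>x y. (x, y) \<in> T \<Longrightarrow> (- x, - y) \<in> T"
    using is_subgroupD[OF t.subgroup_R] by (force simp: zero_prod_def)+
  show ?thesis
    unfolding is_subgroup_def
  proof (intro conjI ballI)
    show "0 \<in> S" using R(1) T(1) by (auto simp: zero_prod_def)
    fix p assume "p \<in> S"
    then obtain x y z where p: "p = (x, z)" "(x, y) \<in> R" "(y, z) \<in> T" by auto
    show "- p \<in> S" using R(3)[OF p(2)] T(3)[OF p(3)] by (auto simp: p)
    fix q assume "q \<in> S"
    then obtain x' y' z' where q: "q = (x', z')" "(x', y') \<in> R" "(y', z') \<in> T" by auto
    show "p + q \<in> S" using R(2)[OF p(2) q(2)] T(2)[OF p(3) q(3)] by (auto simp: p q)
  qed
qed

text \<open>For almost every \<open>y\<close> the measure \<open>n y\<close> is carried by the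
  section of \<open>T\<close> at \<open>y\<close>, because the measure of \<open>T\<close> is
  carried by \<open>T\<close>. When \<open>(x, y)\<close> lies in \<open>R\<close>, this section is
  contained in the section of \<open>S\<close> at \<open>x\<close>.\<close>

lemma \<kappa>_AE_S: "AE p in \<kappa>. p \<in> S"
proof -
  have bT: "- T \<in> sets borel" and bS: "- S \<in> sets borel" using t.borel_R borel_S by auto
  have iT: "(indicator (- T) :: _ \<Rightarrow> ennreal) \<in> borel_measurable (\<eta> \<Otimes>\<^sub>M \<zeta>)"
    by (rule borel_measurable_indicator) (unfold sets_borel_pair[OF r.\<eta>D(1) t.\<eta>D(1)], rule bT)
  have "AE p in t.\<mu>. p \<in> T" using t.haar_\<mu> by (simp add: extended_haar_def)
  then have "emeasure t.\<mu> (- T) = 0"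
    using t.borel_R by (subst (asm) AE_iff_measurable[of "- T"]) auto
  then have "0 = (\<integral>\<^sup>+p. indicator (- T) p \<partial>t.\<mu>)"
    using bT by (subst nn_integral_indicator) auto
  also have "\<dots> = (\<integral>\<^sup>+p. indicator (- T) (fst p, snd p) \<partial>t.\<mu>)" by simp
  also have "\<dots> = (\<integral>\<^sup>+y. \<integral>\<^sup>+z. indicator (- T) (y, z) \<partial>n y \<partial>\<eta>)"
    using iT
    by (intro nn_integral_conditional_measures[OF r.sigma_finite(2) t.sigma_finite(2) t.polymorphism cond(2)])
       simp
  finally have "(\<integral>\<^sup>+y. \<integral>\<^sup>+z. indicator (- T) (y, z) \<partial>n y \<partial>\<eta>) = 0" ..
  moreover have "(\<lambda>y. \<integral>\<^sup>+z. indicator (- T) (y, z) \<partial>n y) \<in> borel_measurable \<eta>"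
    using iT by (intro nn_integral_measurable_subprob_algebra2[OF _ n_measurable]) simp
  ultimately have "AE y in \<eta>. (\<integral>\<^sup>+z. indicator (- T) (y, z) \<partial>n y) = 0"
    by (simp add: nn_integral_0_iff_AE)
  moreover have Tsec: "Pair y -` (- T) \<in> sets (n y)" for y
    using sets_Pair1[of "- T" borel borel y] bT unfolding sets_n borel_prod[symmetric] .
  moreover have "(\<integral>\<^sup>+z. indicator (- T) (y, z) \<partial>n y) = emeasure (n y) (Pair y -` (- T))" for y
    using Tsec[of y] by (subst nn_integral_indicator[symmetric])
      (auto intro!: nn_integral_cong split: split_indicator simp del: nn_integral_indicator)
  ultimately have "AE y in \<eta>. emeasure (n y) (Pair y -` (- T)) = 0" by simp
  then have "AE p in r.\<mu>. emeasure (n (snd p)) (Pair (snd p) -` (- T)) = 0"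
    by (rule polymorphism_AE_snd[OF r.polymorphism])
  moreover have "AE p in r.\<mu>. p \<in> R" using r.haar_\<mu> by (simp add: extended_haar_def)
  ultimately have *: "AE p in r.\<mu>. emeasure (n (snd p)) (Pair (fst p) -` (- S)) = 0"
  proof eventually_elim
    fix p assume p: "emeasure (n (snd p)) (Pair (snd p) -` (- T)) = 0" "p \<in> R"
    have "Pair (fst p) -` (- S) \<subseteq> Pair (snd p) -` (- T)" using p(2) by (cases p) auto
    then have "emeasure (n (snd p)) (Pair (fst p) -` (- S)) \<le> emeasure (n (snd p)) (Pair (snd p) -` (- T))"
      by (rule emeasure_mono[OF _ Tsec])
    then show "emeasure (n (snd p)) (Pair (fst p) -` (- S)) = 0" using p by simp
  qed
  have "emeasure \<kappa> (- S) = (\<integral>\<^sup>+p. emeasure (n (snd p)) (Pair (fst p) -` (- S)) \<partial>r.\<mu>)"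
    unfolding \<kappa>_def using bS
    by (intro polymorphism_comp(2)[OF sets_r n_measurable])
       (simp_all add: r.space sets_borel_pair[OF r.\<gamma>D(1) t.\<eta>D(1)])
  also have "\<dots> = (\<integral>\<^sup>+p. 0 \<partial>r.\<mu>)" by (rule nn_integral_cong_AE[OF *])
  finally have "emeasure \<kappa> (- S) = 0" by simp
  then show ?thesis
    using bS sets_eq_imp_space_eq[OF \<kappa>_sets] by (subst AE_iff_measurable[of "- S"]) (auto simp: \<kappa>_sets)
qed

text \<open>Integrated over \<open>B\<close>, both sides are masses that the measure of
  \<open>T\<close> gives to rectangles, and these rectangles differ by translation by
  \<open>(h, k)\<close>. The null set depends on \<open>(h, k)\<close> and \<open>C\<close>.\<close>

lemma n_equivariant:
  assumes hk: "(h, k) \<in> T" and C: "C \<in> sets borel"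
  shows "AE y in \<eta>. emeasure (n (h + y)) C = emeasure (n y) ((+) k -` C)"
proof (rule AE_eq_of_finite_set_integrals[OF r.sigma_finite(2)])
  note [measurable_cong] = r.\<eta>D(1)
  have kC: "(+) k -` C \<in> sets borel" using C by (rule vimage_add_borel)
  note [measurable] = n_borel_measurable[OF C] n_borel_measurable[OF kC]
  show "(\<lambda>y. emeasure (n (h + y)) C) \<in> borel_measurable \<eta>"
    "(\<lambda>y. emeasure (n y) ((+) k -` C)) \<in> borel_measurable \<eta>"
    by measurable
  fix B assume "B \<in> sets \<eta>" "emeasure \<eta> B < \<infinity>"
  then have B[measurable]: "B \<in> sets borel" by (simp add: r.\<eta>D(1))
  let ?B = "(+) (- h) -` B"
  have hB[measurable]: "?B \<in> sets borel" by (rule vimage_add_borel[OF B])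
  have BC: "?B \<times> C \<in> sets borel" by (rule borel_Times2[OF hB C])
  have "(\<integral>\<^sup>+y\<in>B. emeasure (n (h + y)) C \<partial>\<eta>) =
      (\<integral>\<^sup>+y. (\<lambda>y. emeasure (n y) C * indicator ?B y) (h + y) \<partial>\<eta>)"
    by (intro nn_integral_cong) (auto simp: add.assoc[symmetric] split: split_indicator)
  also have "\<dots> = (\<integral>\<^sup>+y\<in>?B. emeasure (n y) C \<partial>\<eta>)"
    by (rule left_invariant_nn_integral[OF r.\<eta>D(2,1) UNIV_I]) measurable
  also have "\<dots> = emeasure t.\<mu> (?B \<times> C)" by (rule n_emeasure[OF hB C, symmetric])
  also have "\<dots> = emeasure (distr t.\<mu> borel ((+) (h, k))) (?B \<times> C)"
    using t.haar_\<mu> hk by (simp add: extended_haar_def left_invariant_def)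
  also have "\<dots> = emeasure t.\<mu> ((+) (h, k) -` (?B \<times> C))"
    using BC by (subst emeasure_distr) auto
  also have "(+) (h, k) -` (?B \<times> C) = B \<times> ((+) k -` C)"
    by (auto simp: add.assoc[symmetric])
  also have "emeasure t.\<mu> \<dots> = (\<integral>\<^sup>+y\<in>B. emeasure (n y) ((+) k -` C) \<partial>\<eta>)"
    by (rule n_emeasure[OF B kC])
  finally show "(\<integral>\<^sup>+y\<in>B. emeasure (n (h + y)) C \<partial>\<eta>) = (\<integral>\<^sup>+y\<in>B. emeasure (n y) ((+) k -` C) \<partial>\<eta>)" .
qed

lemma \<kappa>_finite: "A \<in> sets borel \<Longrightarrow> emeasure \<gamma> A < \<infinity> \<Longrightarrow> E \<subseteq> fst -` A \<Longrightarrow> emeasure \<kappa> E < \<infinity>"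
  using emeasure_mono[of E "fst -` A" \<kappa>] \<kappa>_dominated(1)[of A] vimage_fst_snd_borel(1)[of A]
  by (auto simp: \<kappa>_sets intro: le_less_trans)

lemma \<kappa>_compact_finite: "compact C \<Longrightarrow> emeasure \<kappa> C < \<infinity>"
proof -
  assume "compact C"
  then have C: "compact (fst ` C)" by (intro compact_continuous_image continuous_intros)
  then show ?thesis
    using r.\<gamma>D(3) by (intro \<kappa>_finite[of "fst ` C"] borel_compact) auto
qed

text \<open>For \<open>(g, k)\<close> in \<open>S\<close> take a middle point \<open>h\<close>.
  Translating the measure of \<open>R\<close> by \<open>(g, h)\<close> replaces \<open>n y\<close>
  by \<open>n (h + y)\<close>, and equivariance turns this into translation by \<open>k\<close> in
  the last coordinate.\<close>

lemma \<kappa>_left_invariant: "left_invariant S \<kappa>"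
  unfolding left_invariant_def
proof
  fix p assume "p \<in> S"
  then obtain g h k where p: "p = (g, k)" "(g, h) \<in> R" "(h, k) \<in> T" by auto
  have sp\<kappa>: "space \<kappa> = UNIV" using sets_eq_imp_space_eq[OF \<kappa>_sets] by simp
  have s: "sets (\<gamma> \<Otimes>\<^sub>M \<zeta>) = sets borel" by (rule sets_borel_pair[OF r.\<gamma>D(1) t.\<eta>D(1)])
  have "\<kappa> = distr \<kappa> borel ((+) p)"
  proof (rule measure_eqI_finite_rectangles[OF r.sigma_finite(1) t.sigma_finite(2)])
    show "sets \<kappa> = sets (\<gamma> \<Otimes>\<^sub>M \<zeta>)" "sets (distr \<kappa> borel ((+) p)) = sets (\<gamma> \<Otimes>\<^sub>M \<zeta>)"
      by (simp_all add: \<kappa>_sets s)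
    fix A C assume AC: "A \<in> sets \<gamma>" "C \<in> sets \<zeta>" "emeasure \<gamma> A < \<infinity>" "emeasure \<zeta> C < \<infinity>"
    have A[measurable]: "A \<in> sets borel" and C[measurable]: "C \<in> sets borel"
      using AC by (simp_all add: r.\<gamma>D(1) t.\<eta>D(1))
    show "emeasure \<kappa> (A \<times> C) < \<infinity>" using A AC(3) by (rule \<kappa>_finite) auto
    let ?A = "(+) g -` A" and ?C = "(+) k -` C"
    have A': "?A \<in> sets borel" "?C \<in> sets borel" by (rule vimage_add_borel, fact)+
    note [measurable] = n_borel_measurable[OF C]
    have "emeasure \<kappa> (A \<times> C) = (\<integral>\<^sup>+q. indicator A (fst q) * emeasure (n (snd q)) C \<partial>r.\<mu>)"
      by (rule \<kappa>_rect[OF A C])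
    also have "\<dots> = (\<integral>\<^sup>+q. (\<lambda>q. indicator A (fst q) * emeasure (n (snd q)) C) ((g, h) + q) \<partial>r.\<mu>)"
      using r.haar_\<mu> p(2) unfolding extended_haar_def
      by (intro left_invariant_nn_integral[symmetric, of R]) auto
    also have "\<dots> = (\<integral>\<^sup>+q. indicator ?A (fst q) * emeasure (n (snd q)) ?C \<partial>r.\<mu>)"
      using polymorphism_AE_snd[OF r.polymorphism n_equivariant[OF p(3) C]]
      by (intro nn_integral_cong_AE) (auto elim!: eventually_mono split: split_indicator)
    also have "\<dots> = emeasure \<kappa> (?A \<times> ?C)" by (rule \<kappa>_rect[OF A', symmetric])
    also have "?A \<times> ?C = (+) p -` (A \<times> C)" by (auto simp: p)
    also have "emeasure \<kappa> \<dots> = emeasure (distr \<kappa> borel ((+) p)) (A \<times> C)"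
      using borel_Times2[OF A C] by (subst emeasure_distr) (auto simp: sp\<kappa> measurable_cong_sets[OF \<kappa>_sets refl])
    finally show "emeasure \<kappa> (A \<times> C) = emeasure (distr \<kappa> borel ((+) p)) (A \<times> C)" .
  qed
  then show "distr \<kappa> borel ((+) p) = \<kappa>" ..
qed

section \<open>Marginals of the composite and the two indices\<close>

abbreviation "index_R \<equiv> subgroup_index (polyhom_indef R) (polyhom_indef R \<inter> Domain T)"
abbreviation "index_T \<equiv> subgroup_index (polyhom_ker T) (polyhom_ker T \<inter> Range R)"

lemma intersection_pos: "emeasure \<eta> (Domain T \<inter> Range R) \<noteq> 0"
  by (rule emeasure_Int_subgroup_pos[OF r.\<eta>D(1) r.sigma_finite(2) r.\<eta>D(2)])
     (use r.Domain_Range t.Domain_Range r.Domain_Range_pos t.Domain_Range_pos in auto)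

text \<open>The first marginal of the measure of \<open>T\<close> has density
  \<open>\<alpha> T\<close> on \<open>Domain T\<close> and zero elsewhere, and this density is the
  total mass of \<open>n y\<close> for almost every \<open>y\<close>.\<close>

lemma \<kappa>_fst:
  assumes A: "A \<in> sets borel"
  shows "emeasure \<kappa> (fst -` A) = ennreal (polyhom_alpha \<eta> T \<tau>) * emeasure r.\<mu> (fst -` A \<inter> snd -` Domain T)"
proof -
  note [measurable_cong] = r.\<eta>D(1)
  obtain a where a: "0 < a" "polyhom_alpha \<eta> T \<tau> = a"
    "\<And>B. B \<in> sets borel \<Longrightarrow> emeasure t.\<mu> (fst -` B) = ennreal a * emeasure \<eta> (B \<inter> Domain T)"
    using t.alpha by metis
  have [measurable]: "Domain T \<in> sets borel" by (rule t.Domain_Range)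
  note [measurable] = n_borel_measurable[of UNIV, simplified] A
  have "AE y in \<eta>. emeasure (n y) UNIV = ennreal a * indicator (Domain T) y"
  proof (rule AE_eq_of_finite_set_integrals[OF r.sigma_finite(2)])
    fix B assume "B \<in> sets \<eta>"
    then have B[measurable]: "B \<in> sets borel" by (simp add: r.\<eta>D(1))
    have "(\<integral>\<^sup>+y\<in>B. emeasure (n y) UNIV \<partial>\<eta>) = emeasure t.\<mu> (B \<times> UNIV)"
      by (rule n_emeasure[OF B, symmetric]) simp
    also have "B \<times> UNIV = (fst -` B :: ('h \<times> 'k) set)" by auto
    also have "emeasure t.\<mu> \<dots> = ennreal a * emeasure \<eta> (B \<inter> Domain T)" by (rule a(3)[OF B])
    also have "\<dots> = (\<integral>\<^sup>+y. ennreal a * indicator (B \<inter> Domain T) y \<partial>\<eta>)"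
      by (rule nn_integral_cmult_indicator[symmetric]) measurable
    also have "\<dots> = (\<integral>\<^sup>+y\<in>B. (ennreal a * indicator (Domain T) y) \<partial>\<eta>)"
      by (intro nn_integral_cong) (auto split: split_indicator)
    finally show "(\<integral>\<^sup>+y\<in>B. emeasure (n y) UNIV \<partial>\<eta>) = (\<integral>\<^sup>+y\<in>B. (ennreal a * indicator (Domain T) y) \<partial>\<eta>)" .
  qed measurable
  then have ae: "AE p in r.\<mu>. emeasure (n (snd p)) UNIV = ennreal a * indicator (Domain T) (snd p)"
    by (rule polymorphism_AE_snd[OF r.polymorphism])
  have "fst -` A = A \<times> (UNIV :: 'k set)" by auto
  then have "emeasure \<kappa> (fst -` A) = (\<integral>\<^sup>+p. indicator A (fst p) * emeasure (n (snd p)) UNIV \<partial>r.\<mu>)"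
    using \<kappa>_rect[OF A, of UNIV] by simp
  also have "\<dots> = (\<integral>\<^sup>+p. ennreal a * indicator (fst -` A \<inter> snd -` Domain T) p \<partial>r.\<mu>)"
    using ae by (intro nn_integral_cong_AE) (auto elim!: eventually_mono split: split_indicator)
  also have "\<dots> = ennreal a * emeasure r.\<mu> (fst -` A \<inter> snd -` Domain T)"
    using A vimage_fst_snd_borel(1)[of A] vimage_fst_snd_borel(2)[of "Domain T"] t.Domain_Range
    by (intro nn_integral_cmult_indicator) auto
  finally show ?thesis by (simp add: a)
qed

text \<open>No disintegration over the last factor enters. The integrand depends on the middle
  coordinate only, whose law under the measure of \<open>R\<close> is \<open>\<beta> R\<close> times
  \<open>\<eta>\<close> on \<open>Range R\<close>; integrating \<open>n\<close> there returns the
  measure of \<open>T\<close> over \<open>Range R\<close>.\<close>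

lemma \<kappa>_snd:
  assumes C: "C \<in> sets borel"
  shows "emeasure \<kappa> (snd -` C) = ennreal (polyhom_beta \<eta> R \<rho>) * emeasure t.\<mu> (snd -` C \<inter> fst -` Range R)"
proof -
  note [measurable_cong] = r.\<eta>D(1)
  obtain b where b: "0 < b" "polyhom_beta \<eta> R \<rho> = b"
    "\<And>B. B \<in> sets borel \<Longrightarrow> emeasure r.\<mu> (snd -` B) = ennreal b * emeasure \<eta> (B \<inter> Range R)"
    using r.beta by metis
  have Ra[measurable]: "Range R \<in> sets borel" by (rule r.Domain_Range)
  note [measurable] = n_borel_measurable[OF C]
  have d: "distr r.\<mu> \<eta> snd = density \<eta> (\<lambda>y. ennreal b * indicator (Range R) y)"
  proof (rule measure_eqI)
    fix B assume "B \<in> sets (distr r.\<mu> \<eta> snd)"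
    then have B[measurable]: "B \<in> sets borel" by (simp add: r.\<eta>D(1))
    have "emeasure (distr r.\<mu> \<eta> snd) B = emeasure r.\<mu> (snd -` B)"
      by (subst emeasure_distr) (auto simp: r.\<eta>D(1) measurable_cong_sets[OF refl r.\<eta>D(1)])
    also have "\<dots> = ennreal b * emeasure \<eta> (B \<inter> Range R)" by (rule b(3)[OF B])
    also have "\<dots> = (\<integral>\<^sup>+y. ennreal b * indicator (B \<inter> Range R) y \<partial>\<eta>)"
      by (rule nn_integral_cmult_indicator[symmetric]) measurable
    also have "\<dots> = (\<integral>\<^sup>+y\<in>B. (ennreal b * indicator (Range R) y) \<partial>\<eta>)"
      by (intro nn_integral_cong) (auto split: split_indicator)
    also have "\<dots> = emeasure (density \<eta> (\<lambda>y. ennreal b * indicator (Range R) y)) B"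
      by (rule emeasure_density[symmetric]) measurable
    finally show "emeasure (distr r.\<mu> \<eta> snd) B = emeasure (density \<eta> (\<lambda>y. ennreal b * indicator (Range R) y)) B" .
  qed simp
  have "snd -` C = (UNIV :: 'g set) \<times> C" by auto
  then have "emeasure \<kappa> (snd -` C) = (\<integral>\<^sup>+p. emeasure (n (snd p)) C \<partial>r.\<mu>)"
    using \<kappa>_rect[of UNIV, OF _ C] by simp
  also have "\<dots> = (\<integral>\<^sup>+y. emeasure (n y) C \<partial>distr r.\<mu> \<eta> snd)"
    by (rule nn_integral_distr[symmetric]) (auto simp: measurable_cong_sets[OF refl r.\<eta>D(1)])
  also have "\<dots> = (\<integral>\<^sup>+y. ennreal b * (emeasure (n y) C * indicator (Range R) y) \<partial>\<eta>)"
    unfolding d by (subst nn_integral_density) (auto simp: mult_ac intro!: nn_integral_cong)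
  also have "\<dots> = ennreal b * (\<integral>\<^sup>+y\<in>Range R. emeasure (n y) C \<partial>\<eta>)"
    by (rule nn_integral_cmult) measurable
  also have "\<dots> = ennreal b * emeasure t.\<mu> (Range R \<times> C)" by (simp add: n_emeasure[OF Ra C])
  also have "Range R \<times> C = snd -` C \<inter> fst -` Range R" by auto
  finally show ?thesis by (simp add: b)
qed

end

context polyhomomorphism_pair
begin

text \<open>Positivity of the index comes with the formula because \<open>card\<close> is 0 on an
  infinite set of cosets, where the quotient would be meaningless. Nonvanishing of
  \<open>\<kappa>\<close> falls out of the same compact base set.\<close>

lemma index_R:
  shows "0 < index_R"
    and "A \<in> sets borel \<Longrightarrow> emeasure \<kappa> (fst -` A) =
      ennreal (polyhom_alpha \<gamma> R \<rho> * polyhom_alpha \<eta> T \<tau> / real index_R) * emeasure \<gamma> (A \<inter> Domain S)"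
    and "emeasure \<kappa> S \<noteq> 0"
proof -
  obtain a where a: "0 < a" "polyhom_alpha \<gamma> R \<rho> = a"
    "\<And>A. A \<in> sets borel \<Longrightarrow> emeasure r.\<mu> (fst -` A) = ennreal a * emeasure \<gamma> (A \<inter> Domain R)"
    using r.alpha by metis
  obtain a' where a': "0 < a'" "polyhom_alpha \<eta> T \<tau> = a'" using t.alpha by metis
  obtain b where b: "0 < b"
    "\<And>B. B \<in> sets borel \<Longrightarrow> emeasure r.\<mu> (snd -` B) = ennreal b * emeasure \<eta> (B \<inter> Range R)"
    using r.beta by metis
  have DT: "Domain T \<in> sets borel" "is_subgroup (Domain T)" by (rule t.Domain_Range)+
  have DS: "Domain S \<in> sets borel"
    unfolding Domain_fst by (intro sigma_compact_borel sigma_compact_image sigma_compact_S continuous_intros)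
  \<comment> \<open>The middle marginal of the measure of \<open>R\<close> is carried by
    \<open>Range R\<close>, so this is positivity of \<open>\<eta>\<close> on
    \<open>Domain T \<inter> Range R\<close>.\<close>
  have pos: "emeasure r.\<mu> (snd -` Domain T) \<noteq> 0"
    using b(1) intersection_pos by (simp add: b(2)[OF DT(1)])
  \<comment> \<open>A compact base has finite mass above it by domination; that part of this mass
    lies over \<open>Domain T\<close> is what bounds the number of cosets.\<close>
  obtain A0 where A0: "compact A0" "emeasure r.\<mu> (fst -` A0 \<inter> snd -` Domain T) \<noteq> 0"
    by (rule obtain_compact_image_pos[OF sets_distr borel_measurable_fst_snd(1) r.scG
          vimage_fst_snd_borel(2)[OF DT(1)] pos])
  have A0b: "A0 \<in> sets borel" by (rule borel_compact[OF A0(1)])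
  have A0f: "emeasure r.\<mu> (fst -` A0) \<noteq> \<infinity>"
    using r.dominated(1)[OF A0b] r.\<gamma>D(3)[OF A0(1)] by (auto simp: top_unique)
  have N: "polyhom_indef R = snd ` {p \<in> R. fst p = 0}" by (force simp: polyhom_indef_def)
  note tile = subgroup_index_tiling[of fst snd, OF fst_add borel_measurable_fst_snd(1) snd_add
      borel_measurable_fst_snd(2) r.haar_\<mu> DT N A0b A0f A0(2)]
  show pos: "0 < index_R" by (rule tile(1))
  show *: "emeasure \<kappa> (fst -` A) =
      ennreal (polyhom_alpha \<gamma> R \<rho> * polyhom_alpha \<eta> T \<tau> / real index_R) * emeasure \<gamma> (A \<inter> Domain S)"
    if A: "A \<in> sets borel" for A
  proof -
    have dom: "Domain S = fst ` (R \<inter> snd -` Domain T)" by (force simp: relcomp_unfold)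
    have AD: "A \<inter> Domain S \<in> sets borel" using A DS by auto
    have "of_nat index_R * emeasure r.\<mu> (fst -` A \<inter> snd -` Domain T) =
        emeasure r.\<mu> {p \<in> R. fst p \<in> A \<and> fst p \<in> Domain S}"
      unfolding dom by (rule tile(2)[OF A, symmetric])
    also have "{p \<in> R. fst p \<in> A \<and> fst p \<in> Domain S} = fst -` (A \<inter> Domain S) \<inter> R" by auto
    also have "emeasure r.\<mu> \<dots> = emeasure r.\<mu> (fst -` (A \<inter> Domain S))"
      using r.haar_\<mu> vimage_fst_snd_borel(1)[OF AD]
      by (intro emeasure_AE_Int) (auto simp: extended_haar_def)
    also have "\<dots> = ennreal a * emeasure \<gamma> (A \<inter> Domain S)"
    proof -
      have "A \<inter> Domain S \<inter> Domain R = A \<inter> Domain S" by auto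
      then show ?thesis using a(3)[OF AD] by simp
    qed
    finally have "of_nat index_R * emeasure r.\<mu> (fst -` A \<inter> snd -` Domain T) =
        ennreal a * emeasure \<gamma> (A \<inter> Domain S)" .
    then have "ennreal a' * (ennreal (real index_R) * emeasure r.\<mu> (fst -` A \<inter> snd -` Domain T)) =
        ennreal a' * (ennreal a * emeasure \<gamma> (A \<inter> Domain S))"
      by (simp add: ennreal_of_nat_eq_real_of_nat)
    then have "ennreal (real index_R) * emeasure \<kappa> (fst -` A) =
        ennreal (a' * a) * emeasure \<gamma> (A \<inter> Domain S)"
      using a' a(1) by (simp add: \<kappa>_fst[OF A] ennreal_mult mult_ac)
    also have "a' * a = real index_R * (a * a' / real index_R)" using pos by simp
    also have "ennreal \<dots> = ennreal (real index_R) * ennreal (a * a' / real index_R)"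
      using a(1) a'(1) by (intro ennreal_mult) auto
    finally show ?thesis
      using pos a(2) a'(2) by (simp add: mult.assoc ennreal_mult_cancel_left)
  qed
  have "emeasure \<kappa> (fst -` A0) \<noteq> 0" using A0(2) a' by (simp add: \<kappa>_fst[OF A0b])
  moreover have "emeasure \<kappa> (fst -` A0 \<inter> S) = emeasure \<kappa> (fst -` A0)"
    using vimage_fst_snd_borel(1)[OF A0b] borel_S
    by (intro emeasure_AE_Int[OF \<kappa>_AE_S]) (auto simp: \<kappa>_sets)
  moreover have "emeasure \<kappa> (fst -` A0 \<inter> S) \<le> emeasure \<kappa> S"
    using borel_S by (intro emeasure_mono) (auto simp: \<kappa>_sets)
  ultimately show "emeasure \<kappa> S \<noteq> 0" by auto
qed

text \<open>The tiling now takes place in \<open>T\<close>, with the two coordinates exchanged: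
  \<open>snd\<close> is the projection and \<open>fst\<close> carries the cosets.\<close>

lemma index_T:
  shows "0 < index_T"
    and "C \<in> sets borel \<Longrightarrow> emeasure \<kappa> (snd -` C) =
      ennreal (polyhom_beta \<eta> R \<rho> * polyhom_beta \<zeta> T \<tau> / real index_T) * emeasure \<zeta> (C \<inter> Range S)"
proof -
  obtain b where b: "0 < b" "polyhom_beta \<zeta> T \<tau> = b"
    "\<And>B. B \<in> sets borel \<Longrightarrow> emeasure t.\<mu> (snd -` B) = ennreal b * emeasure \<zeta> (B \<inter> Range T)"
    using t.beta by metis
  obtain b' where b': "0 < b'" "polyhom_beta \<eta> R \<rho> = b'" using r.beta by metis
  obtain a where a: "0 < a"
    "\<And>B. B \<in> sets borel \<Longrightarrow> emeasure t.\<mu> (fst -` B) = ennreal a * emeasure \<eta> (B \<inter> Domain T)"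
    using t.alpha by metis
  have RR: "Range R \<in> sets borel" "is_subgroup (Range R)" by (rule r.Domain_Range)+
  have RS: "Range S \<in> sets borel"
    unfolding Range_snd by (intro sigma_compact_borel sigma_compact_image sigma_compact_S continuous_intros)
  have pos: "emeasure t.\<mu> (fst -` Range R) \<noteq> 0"
    using a(1) intersection_pos by (simp add: a(2)[OF RR(1)] Int_commute)
  obtain C0 where C0: "compact C0" "emeasure t.\<mu> (snd -` C0 \<inter> fst -` Range R) \<noteq> 0"
    by (rule obtain_compact_image_pos[OF sets_distr borel_measurable_fst_snd(2) t.scH
          vimage_fst_snd_borel(1)[OF RR(1)] pos])
  have C0b: "C0 \<in> sets borel" by (rule borel_compact[OF C0(1)])
  have C0f: "emeasure t.\<mu> (snd -` C0) \<noteq> \<infinity>"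
    using t.dominated(2)[OF C0b] t.\<eta>D(3)[OF C0(1)] by (auto simp: top_unique)
  have N: "polyhom_ker T = fst ` {p \<in> T. snd p = 0}" by (force simp: polyhom_ker_def)
  note tile = subgroup_index_tiling[of snd fst, OF snd_add borel_measurable_fst_snd(2) fst_add
      borel_measurable_fst_snd(1) t.haar_\<mu> RR N C0b C0f C0(2)]
  show pos: "0 < index_T" by (rule tile(1))
  show "emeasure \<kappa> (snd -` C) =
      ennreal (polyhom_beta \<eta> R \<rho> * polyhom_beta \<zeta> T \<tau> / real index_T) * emeasure \<zeta> (C \<inter> Range S)"
    if C: "C \<in> sets borel"
  proof -
    have ran: "Range S = snd ` (T \<inter> fst -` Range R)" by (force simp: relcomp_unfold)
    have CR: "C \<inter> Range S \<in> sets borel" using C RS by auto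
    have "of_nat index_T * emeasure t.\<mu> (snd -` C \<inter> fst -` Range R) =
        emeasure t.\<mu> {p \<in> T. snd p \<in> C \<and> snd p \<in> Range S}"
      unfolding ran by (rule tile(2)[OF C, symmetric])
    also have "{p \<in> T. snd p \<in> C \<and> snd p \<in> Range S} = snd -` (C \<inter> Range S) \<inter> T" by auto
    also have "emeasure t.\<mu> \<dots> = emeasure t.\<mu> (snd -` (C \<inter> Range S))"
      using t.haar_\<mu> vimage_fst_snd_borel(2)[OF CR]
      by (intro emeasure_AE_Int) (auto simp: extended_haar_def)
    also have "\<dots> = ennreal b * emeasure \<zeta> (C \<inter> Range S)"
    proof -
      have "C \<inter> Range S \<inter> Range T = C \<inter> Range S" by auto
      then show ?thesis using b(3)[OF CR] by simp
    qed
    finally have "of_nat index_T * emeasure t.\<mu> (snd -` C \<inter> fst -` Range R) =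
        ennreal b * emeasure \<zeta> (C \<inter> Range S)" .
    then have "ennreal b' * (ennreal (real index_T) * emeasure t.\<mu> (snd -` C \<inter> fst -` Range R)) =
        ennreal b' * (ennreal b * emeasure \<zeta> (C \<inter> Range S))"
      by (simp add: ennreal_of_nat_eq_real_of_nat)
    then have "ennreal (real index_T) * emeasure \<kappa> (snd -` C) =
        ennreal (b' * b) * emeasure \<zeta> (C \<inter> Range S)"
      using b' b(1) by (simp add: \<kappa>_snd[OF C] ennreal_mult mult_ac)
    also have "b' * b = real index_T * (b' * b / real index_T)" using pos by simp
    also have "ennreal \<dots> = ennreal (real index_T) * ennreal (b' * b / real index_T)"
      using b(1) b'(1) by (intro ennreal_mult) auto
    finally show ?thesis
      using pos b(2) b'(2) by (simp add: mult.assoc ennreal_mult_cancel_left)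
  qed
qed

text \<open>Local finiteness comes from the first marginal alone: the tube over a neighbourhood of
  the projection of \<open>Q\<close> that lies in a compact set has finite mass by
  domination.\<close>

lemma closed_S: "closed S"
proof (rule closed_subgroup_of_invariant_measure[OF \<kappa>_sets sigma_compact_S subgroup_S
      \<kappa>_left_invariant \<kappa>_AE_S index_R(3)])
  fix Q :: "('g \<times> 'k) set" assume "compact Q"
  then have "compact (fst ` Q)" by (intro compact_continuous_image continuous_intros)
  then obtain V K where V: "open V" "compact K" "fst ` Q \<subseteq> V" "V \<subseteq> K"
    by (rule locally_compact_compact_nbhd[OF r.lcG])
  have "open (fst -` V :: ('g \<times> 'k) set)" using V(1) by (intro open_vimage continuous_intros)
  moreover have "emeasure \<kappa> (fst -` V) < \<infinity>"
    using V r.\<gamma>D(3)[OF V(2)] by (intro \<kappa>_finite[of K] borel_compact) auto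
  ultimately show "\<exists>V. open V \<and> Q \<subseteq> V \<and> emeasure \<kappa> V < \<infinity>" using V(3) by blast
qed

section \<open>The normalized Haar measure on the composed subgroup\<close>

lemma haar_\<kappa>: "extended_haar S \<kappa>"
  using borel_S subgroup_S \<kappa>_sets \<kappa>_left_invariant \<kappa>_AE_S index_R(3) by (simp add: extended_haar_def)

abbreviation \<sigma> where "\<sigma> \<equiv> restrict_space \<kappa> S"

lemmas haar_\<sigma> = extended_haar_imp_haar_measure_on[OF haar_\<kappa> \<kappa>_compact_finite]

lemma emeasure_\<sigma>:
  "A \<in> sets borel \<Longrightarrow> emeasure \<sigma> (S \<inter> (A \<times> UNIV)) = emeasure \<kappa> (fst -` A)"
  "C \<in> sets borel \<Longrightarrow> emeasure \<sigma> (S \<inter> (UNIV \<times> C)) = emeasure \<kappa> (snd -` C)"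
proof -
  have v: "A \<times> UNIV = fst -` A" "UNIV \<times> C = snd -` C" for A :: "'g set" and C :: "'k set" by auto
  show "A \<in> sets borel \<Longrightarrow> emeasure \<sigma> (S \<inter> (A \<times> UNIV)) = emeasure \<kappa> (fst -` A)"
    unfolding v by (intro haar_\<sigma>(3) vimage_fst_snd_borel)
  show "C \<in> sets borel \<Longrightarrow> emeasure \<sigma> (S \<inter> (UNIV \<times> C)) = emeasure \<kappa> (snd -` C)"
    unfolding v by (intro haar_\<sigma>(3) vimage_fst_snd_borel)
qed

lemma Polh_\<sigma>: "Polyhom S \<sigma> \<in> Polh \<gamma> \<zeta>"
  using closed_S subgroup_S haar_\<sigma>(1) \<kappa>_dominated by (auto simp: Polh_def emeasure_\<sigma>)

text \<open>The facts about scaling constants and projections become available for \<open>S\<close>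
  itself.\<close>

sublocale s: polyhomomorphism \<gamma> \<zeta> S \<sigma>
  by standard (rule r.lcG t.lcH r.\<gamma> t.\<eta> Polh_\<sigma>)+

text \<open>The two normalizations are compatible because both are computed from marginals of the
  one measure \<open>\<kappa>\<close>.\<close>

lemma alpha_beta_\<sigma>:
  "polyhom_alpha \<gamma> S \<sigma> = polyhom_alpha \<gamma> R \<rho> * polyhom_alpha \<eta> T \<tau> / real index_R"
  "polyhom_beta \<zeta> S \<sigma> = polyhom_beta \<eta> R \<rho> * polyhom_beta \<zeta> T \<tau> / real index_T"
proof -
  obtain C where C: "compact C" "C \<subseteq> Domain S" "emeasure \<gamma> C \<noteq> 0" by (rule s.alpha)
  have "0 < polyhom_alpha \<gamma> R \<rho>" "0 < polyhom_alpha \<eta> T \<tau>"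
    by (metis r.alpha, metis t.alpha)
  then show "polyhom_alpha \<gamma> S \<sigma> = polyhom_alpha \<gamma> R \<rho> * polyhom_alpha \<eta> T \<tau> / real index_R"
    using index_R(1,2) C r.\<gamma>D(3)[OF C(1)]
    by (intro polyhom_alpha_eqI[where C=C]) (auto simp: emeasure_\<sigma> borel_compact)
  obtain C where C: "compact C" "C \<subseteq> Range S" "emeasure \<zeta> C \<noteq> 0" by (rule s.beta)
  have "0 < polyhom_beta \<eta> R \<rho>" "0 < polyhom_beta \<zeta> T \<tau>"
    by (metis r.beta, metis t.beta)
  then show "polyhom_beta \<zeta> S \<sigma> = polyhom_beta \<eta> R \<rho> * polyhom_beta \<zeta> T \<tau> / real index_T"
    using index_T(1,2) C t.\<eta>D(3)[OF C(1)]
    by (intro polyhom_beta_eqI[where C=C]) (auto simp: emeasure_\<sigma> borel_compact)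
qed

text \<open>
  A competitor \<open>\<sigma>'\<close> in the definition of the product could a priori have no scaling constant at
  all, its \<^const>\<open>polyhom_alpha\<close> being then the unspecified value of a definite description.
  This is excluded by the uniqueness of Haar measure on \<open>S\<close>.
\<close>

lemma haar_measure_on_S_scaling:
  assumes h: "haar_measure_on S \<sigma>'"
  obtains c where "0 < c" "\<And>E. E \<in> sets borel \<Longrightarrow> emeasure \<sigma>' (S \<inter> E) = ennreal c * emeasure \<kappa> E"
proof -
  have s': "sets \<sigma>' = sets (restrict_space borel S)" using h by (simp add: haar_measure_on_def)
  define \<kappa>' where "\<kappa>' = distr \<sigma>' borel (\<lambda>x. x)"
  have e: "emeasure \<kappa>' E = emeasure \<sigma>' (S \<inter> E)" if "E \<in> sets borel" for E
    unfolding \<kappa>'_def by (rule distr_restrict_id(2)[OF s' borel_S that])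
  have h': "extended_haar S \<kappa>'"
    unfolding \<kappa>'_def by (rule haar_measure_on_imp_extended_haar[OF borel_S subgroup_S h])
  have sets': "sets \<kappa>' = sets borel" and inv': "left_invariant S \<kappa>'"
    and ae': "AE x in \<kappa>'. x \<in> S" and nz': "emeasure \<kappa>' S \<noteq> 0"
    using h' by (auto simp: extended_haar_def)
  have cf': "emeasure \<kappa>' C < \<infinity>" if "compact C" for C
  proof -
    have "compact (S \<inter> C)" using that closed_S by (simp add: closed_Int_compact)
    then show ?thesis using h that by (simp add: e borel_compact haar_measure_on_def)
  qed
  have scP: "sigma_compact (UNIV :: ('g \<times> 'k) set)"
    using sigma_compact_Times[OF r.scG t.scH] by simp
  have sf: "sigma_finite_measure \<kappa>'" "sigma_finite_measure \<kappa>"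
    using sigma_finite_of_compact_finite[OF sets' scP cf']
      sigma_finite_of_compact_finite[OF \<kappa>_sets scP \<kappa>_compact_finite] by auto
  obtain a C where a: "0 < a"
    "\<And>A. A \<in> sets borel \<Longrightarrow> emeasure s.\<mu> (fst -` A) = ennreal a * emeasure \<gamma> (A \<inter> Domain S)"
    and C: "compact C" "C \<subseteq> Domain S" "emeasure \<gamma> C \<noteq> 0"
    using s.alpha by metis
  have \<mu>\<kappa>: "s.\<mu> = \<kappa>" by (rule haar_\<sigma>(2))
  have Cb: "C \<in> sets borel" by (rule borel_compact[OF C(1)])
  have Cf: "emeasure \<gamma> C \<noteq> \<infinity>" using r.\<gamma>D(3)[OF C(1)] by simp
  \<comment> \<open>The test set is the tube over \<open>C\<close>. Right translation by an element
    of \<open>S\<close> moves only its base, within \<open>Domain S\<close>, so right invariance of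
    \<open>\<gamma>\<close> keeps its mass constant.\<close>
  let ?A = "fst -` C :: ('g \<times> 'k) set"
  have Ab: "?A \<in> sets borel" by (rule vimage_fst_snd_borel(1)[OF Cb])
  have w: "emeasure \<kappa> {y. y + x \<in> ?A} = ennreal a * emeasure \<gamma> C" if x: "x \<in> S" for x
  proof -
    let ?C = "{g. g + fst x \<in> C}"
    have x': "fst x \<in> Domain S" using x by (cases x) auto
    have "?C \<subseteq> Domain S"
    proof
      fix g assume "g \<in> ?C"
      then have "g + fst x - fst x \<in> Domain S"
        using C(2) x' by (intro is_subgroup_minus[OF s.Domain_Range(1)]) auto
      then show "g \<in> Domain S" by simp
    qed
    then have "?C \<inter> Domain S = ?C" by auto
    moreover have "?C \<in> sets borel" using Cb by measurable
    moreover have "{y. y + x \<in> ?A} = fst -` ?C" by auto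
    ultimately show ?thesis using a(2)[of ?C] r.\<gamma>D(4)[OF Cb] by (simp add: \<mu>\<kappa>)
  qed
  have uniq: "emeasure \<kappa>' ?A * emeasure \<kappa> B = emeasure \<kappa> ?A * emeasure \<kappa>' B" if "B \<in> sets borel" for B
  proof (rule left_invariant_unique[OF sets' \<kappa>_sets sf subgroup_S ae' \<kappa>_AE_S inv' \<kappa>_left_invariant Ab that])
    fix x assume x: "x \<in> S"
    show "emeasure \<kappa> {y. y + x \<in> ?A} \<noteq> 0" "emeasure \<kappa> {y. y + x \<in> ?A} \<noteq> \<infinity>"
      unfolding w[OF x] using a(1) C(3) Cf by (auto simp: ennreal_mult_eq_top_iff)
  qed
  have \<kappa>A: "emeasure \<kappa> ?A = ennreal a * emeasure \<gamma> C"
    using w[OF is_subgroupD(1)[OF subgroup_S]] by (simp add: vimage_def)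
  have A0: "emeasure \<kappa> ?A \<noteq> 0" "emeasure \<kappa> ?A \<noteq> \<infinity>"
    using a(1) C(3) Cf by (auto simp: \<kappa>A ennreal_mult_eq_top_iff)
  obtain B where B: "compact B" "B \<subseteq> S" "emeasure \<kappa> B \<noteq> 0"
    using sigma_compact_emeasure_pos[OF sigma_compact_S \<kappa>_sets index_R(3)] by metis
  \<comment> \<open>The tube need not be compact, so its finiteness under the competitor is obtained
    by testing the proportionality on a compact \<open>B\<close> of positive mass.\<close>
  have A1: "emeasure \<kappa>' ?A \<noteq> \<infinity>"
  proof
    assume "emeasure \<kappa>' ?A = \<infinity>"
    then have "emeasure \<kappa> ?A * emeasure \<kappa>' B = \<infinity>"
      using uniq[OF borel_compact[OF B(1)]] B(3) by (simp add: ennreal_top_mult)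
    moreover have "emeasure \<kappa> ?A * emeasure \<kappa>' B < \<infinity>"
      using A0(2) cf'[OF B(1)] by (simp add: ennreal_mult_less_top less_top)
    ultimately show False by simp
  qed
  have A2: "emeasure \<kappa>' ?A \<noteq> 0"
    using uniq[OF borel_S] nz' A0(1) by auto
  define c where "c = measure \<kappa>' ?A / measure \<kappa> ?A"
  have m: "emeasure \<kappa>' ?A = ennreal (measure \<kappa>' ?A)" "emeasure \<kappa> ?A = ennreal (measure \<kappa> ?A)"
    using A0 A1 by (auto simp: emeasure_eq_ennreal_measure)
  have pos: "0 < measure \<kappa>' ?A" "0 < measure \<kappa> ?A"
    using m A0(1) A2 by (metis ennreal_0 measure_nonneg order_le_less)+
  have "emeasure \<kappa>' E = ennreal c * emeasure \<kappa> E" if E: "E \<in> sets borel" for E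
  proof -
    have "emeasure \<kappa> ?A * (ennreal c * emeasure \<kappa> E) = emeasure \<kappa>' ?A * emeasure \<kappa> E"
      unfolding m c_def mult.assoc[symmetric] using pos by (simp flip: ennreal_mult')
    also have "\<dots> = emeasure \<kappa> ?A * emeasure \<kappa>' E" by (rule uniq[OF E])
    finally show ?thesis using A0 by (simp add: ennreal_mult_cancel_left)
  qed
  with pos show ?thesis by (intro that[of c]) (auto simp: e c_def)
qed

text \<open>Rescaling by \<open>c\<close> multiplies the first constant by \<open>c\<close>, so
  equal first constants force \<open>c = 1\<close>.\<close>

lemma \<sigma>_unique:
  assumes h: "haar_measure_on S \<sigma>'" and al: "polyhom_alpha \<gamma> S \<sigma>' = polyhom_alpha \<gamma> S \<sigma>"
  shows "\<sigma>' = \<sigma>"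
proof -
  obtain c where c: "0 < c" "\<And>E. E \<in> sets borel \<Longrightarrow> emeasure \<sigma>' (S \<inter> E) = ennreal c * emeasure \<kappa> E"
    using haar_measure_on_S_scaling[OF h] by metis
  obtain a C where a: "0 < a" "polyhom_alpha \<gamma> S \<sigma> = a"
    "\<And>A. A \<in> sets borel \<Longrightarrow> emeasure s.\<mu> (fst -` A) = ennreal a * emeasure \<gamma> (A \<inter> Domain S)"
    and C: "compact C" "C \<subseteq> Domain S" "emeasure \<gamma> C \<noteq> 0"
    using s.alpha by metis
  have "polyhom_alpha \<gamma> S \<sigma>' = c * a"
  proof (rule polyhom_alpha_eqI[where C=C])
    fix A :: "'g set" assume A: "A \<in> sets borel"
    have "A \<times> UNIV = (fst -` A :: ('g \<times> 'k) set)" by auto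
    then show "emeasure \<sigma>' (S \<inter> (A \<times> UNIV)) = ennreal (c * a) * emeasure \<gamma> (A \<inter> Domain S)"
      using c(2)[OF vimage_fst_snd_borel(1)[OF A]] a(3)[OF A] c(1) a(1)
      by (simp add: haar_\<sigma>(2) ennreal_mult mult.assoc)
  qed (use c(1) a(1) C r.\<gamma>D(3)[OF C(1)] in \<open>auto simp: borel_compact\<close>)
  then have "c = 1" using al a by simp
  have s': "sets \<sigma>' = sets (restrict_space borel S)" using h by (simp add: haar_measure_on_def)
  show ?thesis
  proof (rule measure_eqI)
    show "sets \<sigma>' = sets \<sigma>" by (simp add: s' s.sets_\<rho>)
    fix E assume "E \<in> sets \<sigma>'"
    then obtain E' where E': "E' \<in> sets borel" "E = S \<inter> E'" by (auto simp: s' sets_restrict_space)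
    then show "emeasure \<sigma>' E = emeasure \<sigma> E"
      using c(2)[OF E'(1)] \<open>c = 1\<close> by (simp add: haar_\<sigma>(3))
  qed
qed

lemma polyhom_prod_eq: "polyhom_prod \<gamma> \<eta> \<zeta> (Polyhom T \<tau>) (Polyhom R \<rho>) = Polyhom S \<sigma>"
proof -
  have "(THE \<sigma>'. haar_measure_on S \<sigma>' \<and>
      polyhom_alpha \<gamma> S \<sigma>' = polyhom_alpha \<gamma> R \<rho> * polyhom_alpha \<eta> T \<tau> / real index_R \<and>
      polyhom_beta \<zeta> S \<sigma>' = polyhom_beta \<eta> R \<rho> * polyhom_beta \<zeta> T \<tau> / real index_T) = \<sigma>"
    using haar_\<sigma>(1) alpha_beta_\<sigma> by (intro the_equality conjI) (auto intro: \<sigma>_unique)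
  then show ?thesis by simp
qed

lemma polyhom_prod_correct:
  "polyhom_prod \<gamma> \<eta> \<zeta> (Polyhom T \<tau>) (Polyhom R \<rho>) \<in> Polh \<gamma> \<zeta>"
  "polyhom_measure (polyhom_prod \<gamma> \<eta> \<zeta> (Polyhom T \<tau>) (Polyhom R \<rho>)) =
     polymorphism_prod \<gamma> \<eta> \<zeta> (polyhom_measure (Polyhom T \<tau>)) (polyhom_measure (Polyhom R \<rho>))"
  using Polh_\<sigma> prod_eq_\<kappa>(1) haar_\<sigma>(2) by (simp_all only: polyhom_prod_eq polyhom_measure.simps)

end

section \<open>Zero factors and the final case distinction\<close>

lemma null_measure_conditional_measures:
  assumes "space Y \<noteq> {}" "sets M = sets (X \<Otimes>\<^sub>M Y)"
  shows "polymorphism X Y (null_measure M)" "conditional_measures X Y (null_measure M) (\<lambda>_. null_measure Y)"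
  using assms by (auto simp: polymorphism_def conditional_measures_def)

lemma Polh_conditional_measures:
  fixes \<gamma> :: "'g::{topological_group_add, t2_space, second_countable_topology} measure"
    and \<eta> :: "'h::{topological_group_add, t2_space, second_countable_topology} measure"
  assumes lc: "locally_compact_space (euclidean :: 'g topology)"
      "locally_compact_space (euclidean :: 'h topology)"
    and u: "unimodular_haar_measure \<gamma>" "unimodular_haar_measure \<eta>"
    and P: "P \<in> Polh \<gamma> \<eta>"
  shows "polymorphism \<gamma> \<eta> (polyhom_measure P)"
    "\<exists>m. conditional_measures \<gamma> \<eta> (polyhom_measure P) m"
proof -
  have "polymorphism \<gamma> \<eta> (polyhom_measure P) \<and> (\<exists>m. conditional_measures \<gamma> \<eta> (polyhom_measure P) m)"
  proof (cases P)
    case Zero_Polyhom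
    have "sets (borel :: ('g \<times> 'h) measure) = sets (\<gamma> \<Otimes>\<^sub>M \<eta>)"
      using sets_borel_pair unimodular_haar_measureD(1)[OF u(1)] unimodular_haar_measureD(1)[OF u(2)] by metis
    moreover have "space \<eta> \<noteq> {}"
      using sets_eq_imp_space_eq[OF unimodular_haar_measureD(1)[OF u(2)]] by simp
    ultimately show ?thesis
      using null_measure_conditional_measures[of \<eta> borel \<gamma>] Zero_Polyhom by auto
  next
    case (Polyhom R \<rho>)
    interpret polyhomomorphism \<gamma> \<eta> R \<rho> by standard (use assms Polyhom in auto)
    show ?thesis using polymorphism conditional_measures_exist Polyhom by simp
  qed
  then show "polymorphism \<gamma> \<eta> (polyhom_measure P)"
    "\<exists>m. conditional_measures \<gamma> \<eta> (polyhom_measure P) m" by auto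
qed

theorem theorem1p5:
  fixes \<gamma> :: "'g::{topological_group_add, t2_space, second_countable_topology} measure"
    and \<eta> :: "'h::{topological_group_add, t2_space, second_countable_topology} measure"
    and \<zeta> :: "'k::{topological_group_add, t2_space, second_countable_topology} measure"
    and R :: "('g, 'h) polyhom"
    and T :: "('h, 'k) polyhom"
  assumes "locally_compact_space (euclidean :: 'g topology)"
    and "locally_compact_space (euclidean :: 'h topology)"
    and "locally_compact_space (euclidean :: 'k topology)"
    and "unimodular_haar_measure \<gamma>"
    and "unimodular_haar_measure \<eta>"
    and "unimodular_haar_measure \<zeta>"
    and "R \<in> Polh \<gamma> \<eta>"
    and "T \<in> Polh \<eta> \<zeta>"
  shows "polyhom_prod \<gamma> \<eta> \<zeta> T R \<in> Polh \<gamma> \<zeta> \<and>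
    polyhom_measure (polyhom_prod \<gamma> \<eta> \<zeta> T R) =
      polymorphism_prod \<gamma> \<eta> \<zeta> (polyhom_measure T) (polyhom_measure R)"
proof (cases "R = Zero_Polyhom \<or> T = Zero_Polyhom")
  case False
  then obtain R' \<rho> T' \<tau> where RT: "R = Polyhom R' \<rho>" "T = Polyhom T' \<tau>"
    by (metis polyhom.exhaust)
  interpret polyhomomorphism_pair \<gamma> \<eta> \<zeta> R' \<rho> T' \<tau>
    by standard (use assms RT in auto)
  show ?thesis using polyhom_prod_correct by (simp add: RT)
next
  case True
  then have 0: "polyhom_prod \<gamma> \<eta> \<zeta> T R = Zero_Polyhom"
    by (cases R; cases T) auto
  note G = unimodular_haar_measureD[OF assms(4)] and H = unimodular_haar_measureD[OF assms(5)]
    and K = unimodular_haar_measureD[OF assms(6)]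
  have sp: "space \<gamma> \<noteq> {}" "space \<eta> \<noteq> {}" "space \<zeta> \<noteq> {}"
    using sets_eq_imp_space_eq[OF G(1)] sets_eq_imp_space_eq[OF H(1)] sets_eq_imp_space_eq[OF K(1)] by auto
  have sf: "sigma_finite_measure \<gamma>" "sigma_finite_measure \<eta>" "sigma_finite_measure \<zeta>"
    by (intro sigma_finite_of_compact_finite G H K sigma_compact_UNIV assms; assumption)+
  \<comment> \<open>With a zero factor the definite description in \<open>polymorphism_prod\<close>
    still has to be evaluated, so conditional measures of both factors are required.\<close>
  note r = Polh_conditional_measures[OF assms(1,2,4,5,7)]
  note t = Polh_conditional_measures[OF assms(2,3,5,6,8)]
  obtain m where m: "conditional_measures \<gamma> \<eta> (polyhom_measure R) m" using r(2) by blast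
  have GH: "sets (borel :: ('g \<times> 'h) measure) = sets (\<gamma> \<Otimes>\<^sub>M \<eta>)"
    "sets (borel :: ('h \<times> 'k) measure) = sets (\<eta> \<Otimes>\<^sub>M \<zeta>)"
    by (rule sets_borel_pair[symmetric], rule G, rule H) (rule sets_borel_pair[symmetric], rule H, rule K)
  \<comment> \<open>For zero \<open>R\<close> any version will do, since the outer integral is
    against the null measure; otherwise \<open>T\<close> is zero and the null kernel is one of its
    versions.\<close>
  obtain n where n: "conditional_measures \<eta> \<zeta> (polyhom_measure T) n"
    and null: "R = Zero_Polyhom \<or> n = (\<lambda>_. null_measure \<zeta>)"
    using True t(2) null_measure_conditional_measures(2)[OF sp(3) GH(2)] by fastforce
  let ?\<kappa> = "polymorphism_comp \<gamma> \<zeta> (polyhom_measure R) n"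
  have s\<mu>: "sets (polyhom_measure R) = sets (\<gamma> \<Otimes>\<^sub>M \<eta>)" using r(1) by (simp add: polymorphism_def)
  have nm: "n \<in> \<eta> \<rightarrow>\<^sub>M subprob_algebra \<zeta>" using n by (simp add: conditional_measures_def)
  note comp = polymorphism_comp[OF s\<mu> nm sp(1,2)]
  have "?\<kappa> = null_measure borel"
  proof (rule measure_eqI)
    show "sets ?\<kappa> = sets (null_measure borel)"
      by (simp add: comp(1) sets_borel_pair[OF G(1) K(1)])
    fix E assume "E \<in> sets ?\<kappa>"
    then have "emeasure ?\<kappa> E = (\<integral>\<^sup>+p. emeasure (n (snd p)) (Pair (fst p) -` E) \<partial>polyhom_measure R)"
      by (intro comp(2)) (simp add: comp(1))
    also have "\<dots> = 0" using null by (auto simp: nn_integral_null_measure)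
    finally show "emeasure ?\<kappa> E = emeasure (null_measure borel) E" by simp
  qed
  then show ?thesis
    using polymorphism_prod_eq_comp(1)[OF sf sp(1,2) r(1) t(1) m n] by (simp add: 0 Polh_def)
qed

end
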